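(* Suppose that $n\ge 2$, that $R$ has a nondegenerate distribution and belongs to the class $\mathcal{C}_{\mathcal R}$, that $\mathbf B\ge 0$ and that $\mathbf A$ has rank at least one. Suppose that the zero eigenvalue at the right edge of support has multiplicity $m=1$. Put $$t_0=\frac{1}{4n}\Big\{2n-1+\nu_0^2-\sqrt{(\nu_0^2+2n-1)^2-(2n-1)^2+1}\Big\},$$ $$u_0=\sqrt{\frac{n-1}{2}+\frac{2t_0^2}{(1-2t_0)^2}+\frac{4\nu_0^2t_0^2}{(1-2t_0)^3}},\qquad \eta_2=\frac{\nu_0^2}{2(1-2t_0)}.$$ Then $$\lim_{r\uparrow r^*}\frac{\Pr(R>r)}{\widehat{\Pr}_1(R>r)}=\frac{\sqrt{2\pi(1-2t_0)}\,(2t_0)^{(n-1)/2}\,u_0\,e^{-\eta_2}}{B\!\left(\frac12,\frac{n+1}{2}\right)\frac n2}\;{}_1F_1\!\left(\frac n2;\frac12;\frac{\nu_0^2}{2}\right),$$ and the first-order saddlepoint density has the same relative limit, i.e. $\lim_{r\uparrow r^*} f_R(r)/\hat f_R(r)$ equals the same right-hand side. (All these parameters are determined by $\nu_0$, so the right-hand side is a function of $\nu_0$ alone for given $n$.)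
   Context: **Setting.** $\mathbf A,\mathbf B$ are real symmetric $n\times n$ matrices, $\mathbf B\ge 0$ (positive semidefinite) and $\mathbf B\neq 0$; $\boldsymbol\epsilon\sim \mathbf N(\boldsymbol\mu,\mathbf I_n)$ with $\boldsymbol\mu\in\mathbb R^n$; $R=\boldsymbol\epsilon'\mathbf A\boldsymbol\epsilon/\boldsymbol\epsilon'\mathbf B\boldsymbol\epsilon$ (denominator positive with probability one). $(l,r^* )$ is the support of $R$, i.e. $l$ and $r^*$ are its left and right endpoints, possibly infinite. For real $r$, $\lambda_1(r)\le\dots\le\lambda_n(r)$ are the ordered eigenvalues of $\mathbf A-r\mathbf B$. $R$ is in the class $\mathcal C_{\mathcal R}$ if $\lim_{r\uparrow r^*}\lambda_n(r)=0$ ($n$ fixed). $f_R$ is the density of $R$. **Multiplicity $m$ and $\nu_0$.** If $r^*<\infty$, $m$ is the multiplicity of the eigenvalue $0$ of $\mathbf A-r^*\mathbf B$; when $m=1$, $\nu_0=\mathbf p_n(r^* )'\boldsymbol\mu$, where $\mathbf p_n(r^* )$ is a unit eigenvector of $\mathbf A-r^*\mathbf B$ for the eigenvalue $0$. If $r^*=\infty$, $m$ is the number of $i$ with $\lim_{r\to\infty}\lambda_i(r)=0$. In that case, let the columns of the $n\times p$ matrix $\mathbf O_{\mathbf B2}$ be an orthonormal basis of the null space of $\mathbf B$ and $\mathbf C_{22}=\mathbf O_{\mathbf B2}'\mathbf A\mathbf O_{\mathbf B2}$; when $m=1$, $\nu_0=\mathbf o_n'\mathbf O_{\mathbf B2}'\boldsymbol\mu$,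 where $\mathbf o_n$ is a unit eigenvector of $\mathbf C_{22}$ for its zero eigenvalue. (Only $\nu_0^2$ matters.) **Saddlepoint approximations.** For $r\in(l,r^* )$ write $\mathbf A-r\mathbf B=\mathbf P_r'\boldsymbol\Lambda_r\mathbf P_r$ with $\mathbf P_r$ orthogonal and $\boldsymbol\Lambda_r=\mathrm{diag}(\lambda_1,\dots,\lambda_n)$, $\lambda_i=\lambda_i(r)$; let $\boldsymbol\nu_r=(\nu_1,\dots,\nu_n)'=\mathbf P_r\boldsymbol\mu$ and $X_r=\boldsymbol\epsilon'(\mathbf A-r\mathbf B)\boldsymbol\epsilon$, with moment generating function $$M_{X_r}(s)=\prod_{i=1}^n(1-2s\lambda_i)^{-1/2}\exp\Big\{s\sum_{i=1}^n\frac{\lambda_i\nu_i^2}{1-2s\lambda_i}\Big\},\qquad \frac1{2\lambda_1(r)}<s<\frac1{2\lambda_n(r)},$$ and $K_{X_r}=\ln M_{X_r}$. The saddlepoint $\hat s=\hat s(r)$ is the unique root of $K_{X_r}'(\hat s)=0$ in this interval. Put $\hat w=\mathrm{sgn}(\hat s)\sqrt{-2K_{X_r}(\hat s)}$, $\hat u=\hat s\sqrt{K_{X_r}''(\hat s)}$. The first-order Lugannani–Rice approximation is $$\widehat{\Pr}_1(R\le r)=\begin{cases}\Phi(\hat w)+\phi(\hat w)\{\hat w^{-1}-\hat u^{-1}\},& \mathcal E[X_r]\ne0,\\[2pt] \frac12+\dfrac{K_{X_r}'''(0)}{6\sqrt{2\pi}K_{X_r}''(0)^{3/2}},&\mathcal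 E[X_r]=0,\end{cases}$$ with $\Phi,\phi$ the standard normal c.d.f. and density, and $\widehat{\Pr}_1(R>r)=1-\widehat{\Pr}_1(R\le r)$. The first-order saddlepoint density is $$\hat f_R(r)=\frac{J_r(\hat s)}{\sqrt{2\pi K_{X_r}''(\hat s)}}M_{X_r}(\hat s),$$ $$J_r(s)=\mathrm{tr}\{(\mathbf I-2s\boldsymbol\Lambda_r)^{-1}\mathbf H_r\}+\boldsymbol\nu_r'(\mathbf I-2s\boldsymbol\Lambda_r)^{-1}\mathbf H_r(\mathbf I-2s\boldsymbol\Lambda_r)^{-1}\boldsymbol\nu_r,\qquad \mathbf H_r=\mathbf P_r\mathbf B\mathbf P_r'.$$ $B(\cdot,\cdot)$ is the Beta function and ${}_1F_1$ the confluent hypergeometric function. *)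

theory Defs
  imports "HOL-Probability.Probability"
begin

text \<open>
  Vectors and matrices are indexed by a finite linearly ordered type, so that
  \<open>Min UNIV\<close> and \<open>Max UNIV\<close> play the roles of the indices \<open>1\<close> and \<open>n\<close>.
\<close>

definition diag_mat :: "real ^ 'n \<Rightarrow> real ^ 'n ^ 'n" where
  "diag_mat d = (\<chi> i j. if i = j then d $ i else 0)"

definition pos_semidef :: "real ^ 'n ^ 'n \<Rightarrow> bool" where
  "pos_semidef B \<longleftrightarrow> transpose B = B \<and> (\<forall>x. 0 \<le> x \<bullet> (B *v x))"

text \<open>Ordered eigenvalues of a symmetric matrix, repeated according to multiplicity.\<close>

definition eigvals :: "real ^ ('n :: {finite, linorder}) ^ 'n::_ \<Rightarrow> real ^ 'n::_" where
  "eigvals S = (THE d. mono (\<lambda>i. d $ i) \<and>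
                  (\<forall>c. card {i. d $ i = c} = dim {x. S *v x = c *\<^sub>R x}))"

definition mvn_density :: "real ^ 'n \<Rightarrow> real ^ 'n \<Rightarrow> real" where
  "mvn_density \<mu> x = (2 * pi) powr (- real CARD('n) / 2) * exp (- (norm (x - \<mu>))\<^sup>2 / 2)"

definition qform :: "real ^ 'n ^ 'n \<Rightarrow> real ^ 'n \<Rightarrow> real" where
  "qform S x = x \<bullet> (S *v x)"

definition rv_support :: "'w measure \<Rightarrow> ('w \<Rightarrow> real) \<Rightarrow> real set" where
  "rv_support M X = {x. \<forall>U. open U \<longrightarrow> x \<in> U \<longrightarrow> 0 < measure (distr M borel X) U}"

definition left_end :: "'w measure \<Rightarrow> ('w \<Rightarrow> real) \<Rightarrow> ereal" where
  "left_end M X = (INF x \<in> rv_support M X. ereal x)"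

definition right_end :: "'w measure \<Rightarrow> ('w \<Rightarrow> real) \<Rightarrow> ereal" where
  "right_end M X = (SUP x \<in> rv_support M X. ereal x)"

text \<open>
  A pointwise limit of a density needs a choice of version: here it is the one that
  agrees with the derivative of the distribution function wherever this derivative exists.
\<close>

definition is_density :: "'w measure \<Rightarrow> ('w \<Rightarrow> real) \<Rightarrow> (real \<Rightarrow> real) \<Rightarrow> bool" where
  "is_density M X f \<longleftrightarrow>
     (\<forall>r. 0 \<le> f r) \<and> distributed M lborel X (\<lambda>r. ennreal (f r)) \<and>
     (\<forall>r D. (cdf (distr M borel X) has_real_derivative D) (at r) \<longrightarrow> f r = D)"

text \<open>The filter for \<open>r \<up> \<rho>\<close>, \<open>r\<close> real, where \<open>\<rho>\<close> is real or \<open>\<infinity>\<close>.\<close>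

definition at_edge :: "ereal \<Rightarrow> real filter" where
  "at_edge \<rho> = (if \<rho> = \<infinity> then at_top else at_left (real_of_ereal \<rho>))"

definition class_CR ::
    "real ^ ('n :: {finite, linorder}) ^ 'n::_ \<Rightarrow> real ^ 'n::_ ^ 'n::_ \<Rightarrow> ereal \<Rightarrow> bool" where
  "class_CR A B \<rho> \<longleftrightarrow> ((\<lambda>r. eigvals (A - r *\<^sub>R B) $ Max UNIV) \<longlongrightarrow> 0) (at_edge \<rho>)"

definition edge_mult ::
    "real ^ ('n :: {finite, linorder}) ^ 'n::_ \<Rightarrow> real ^ 'n::_ ^ 'n::_ \<Rightarrow> ereal \<Rightarrow> nat" where
  "edge_mult A B \<rho> =
     (if \<rho> = \<infinity> then card {i. ((\<lambda>r. eigvals (A - r *\<^sub>R B) $ i) \<longlongrightarrow> 0) at_top}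
      else dim {x. (A - real_of_ereal \<rho> *\<^sub>R B) *v x = 0})"

text \<open>
  For \<open>\<rho> = \<infinity>\<close> the dimension \<open>p\<close> of the null space of \<open>B\<close> is not a type, so the columns of
  \<open>O\<^sub>B\<^sub>2\<close> are the vectors \<open>b 0, \<dots>, b (p - 1)\<close>; then \<open>C\<^sub>2\<^sub>2\<close> has the entries
  \<open>b j \<bullet> (A *v b k)\<close>, and \<open>w\<close> is its unit null vector.
\<close>

definition edge_noncentrality ::
    "real ^ 'n ^ 'n \<Rightarrow> real ^ 'n ^ 'n \<Rightarrow> real ^ 'n \<Rightarrow> ereal \<Rightarrow> real \<Rightarrow> bool" where
  "edge_noncentrality A B \<mu> \<rho> \<nu>0 \<longleftrightarrow>
     (if \<rho> = \<infinity> then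
        \<exists>(p :: nat) (b :: nat \<Rightarrow> real ^ 'n) (w :: nat \<Rightarrow> real).
          (\<forall>j<p. \<forall>k<p. b j \<bullet> b k = (if j = k then 1 else 0)) \<and>
          span (b ` {..<p}) = {x. B *v x = 0} \<and>
          (\<Sum>j<p. (w j)\<^sup>2) = 1 \<and>
          (\<forall>j<p. (\<Sum>k<p. (b j \<bullet> (A *v b k)) * w k) = 0) \<and>
          \<nu>0 = (\<Sum>j<p. w j * (b j \<bullet> \<mu>))
      else
        \<exists>x. norm x = 1 \<and> (A - real_of_ereal \<rho> *\<^sub>R B) *v x = 0 \<and> \<nu>0 = x \<bullet> \<mu>)"

text \<open>
  Below, \<open>d\<close> and \<open>v\<close> are the eigenvalues \<open>\<lambda>\<^sub>i\<close> and the noncentralities \<open>\<nu>\<^sub>i\<close> of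
  \<open>X\<^sub>r\<close>, and \<open>m\<close> is the mean of \<open>X\<^sub>r\<close>.
\<close>

definition qf_mgf :: "real ^ 'n \<Rightarrow> real ^ 'n \<Rightarrow> real \<Rightarrow> real" where
  "qf_mgf d v s = (\<Prod>i\<in>UNIV. (1 - 2 * s * d $ i) powr (- 1 / 2)) *
                  exp (s * (\<Sum>i\<in>UNIV. d $ i * (v $ i)\<^sup>2 / (1 - 2 * s * d $ i)))"

definition qf_cgf :: "real ^ 'n \<Rightarrow> real ^ 'n \<Rightarrow> real \<Rightarrow> real" where
  "qf_cgf d v s = ln (qf_mgf d v s)"

definition saddlepoint :: "real ^ ('n :: {finite, linorder}) \<Rightarrow> real ^ 'n::_ \<Rightarrow> real" where
  "saddlepoint d v =
     (THE s. 1 / (2 * d $ Min UNIV) < s \<and> s < 1 / (2 * d $ Max UNIV) \<and>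
             deriv (qf_cgf d v) s = 0)"

definition lr_cdf :: "real ^ ('n :: {finite, linorder}) \<Rightarrow> real ^ 'n::_ \<Rightarrow> real \<Rightarrow> real" where
  "lr_cdf d v m =
     (let K = qf_cgf d v; s = saddlepoint d v;
          w = sgn s * sqrt (- 2 * K s);
          u = s * sqrt ((deriv ^^ 2) K s)
      in if m \<noteq> 0
         then cdf std_normal_distribution w + std_normal_density w * (1 / w - 1 / u)
         else 1 / 2 + (deriv ^^ 3) K 0 / (6 * sqrt (2 * pi) * ((deriv ^^ 2) K 0) powr (3 / 2)))"

definition sp_J :: "real ^ 'n \<Rightarrow> real ^ 'n \<Rightarrow> real ^ 'n ^ 'n \<Rightarrow> real \<Rightarrow> real" where
  "sp_J d v H s =
     (let Q = matrix_inv (mat 1 - (2 * s) *\<^sub>R diag_mat d)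
      in trace (Q ** H) + v \<bullet> ((Q ** H ** Q) *v v))"

definition sp_density ::
    "real ^ ('n :: {finite, linorder}) \<Rightarrow> real ^ 'n::_ \<Rightarrow> real ^ 'n::_ ^ 'n::_ \<Rightarrow> real" where
  "sp_density d v H =
     (let s = saddlepoint d v
      in sp_J d v H s / sqrt (2 * pi * (deriv ^^ 2) (qf_cgf d v) s) * qf_mgf d v s)"

definition hyp1F1 :: "real \<Rightarrow> real \<Rightarrow> real \<Rightarrow> real" where
  "hyp1F1 a b z = eval_fps (fps_hypergeo [a] [b] 1) z"

definition edge_t :: "nat \<Rightarrow> real \<Rightarrow> real" where
  "edge_t n \<nu>0 = 1 / (4 * real n) *
     (2 * real n - 1 + \<nu>0\<^sup>2 - sqrt ((\<nu>0\<^sup>2 + 2 * real n - 1)\<^sup>2 - (2 * real n - 1)\<^sup>2 + 1))"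

definition edge_u :: "nat \<Rightarrow> real \<Rightarrow> real" where
  "edge_u n \<nu>0 = (let t = edge_t n \<nu>0 in
     sqrt ((real n - 1) / 2 + 2 * t\<^sup>2 / (1 - 2 * t)\<^sup>2 + 4 * \<nu>0\<^sup>2 * t\<^sup>2 / (1 - 2 * t) ^ 3))"

definition edge_eta :: "nat \<Rightarrow> real \<Rightarrow> real" where
  "edge_eta n \<nu>0 = \<nu>0\<^sup>2 / (2 * (1 - 2 * edge_t n \<nu>0))"

definition edge_limit :: "nat \<Rightarrow> real \<Rightarrow> real" where
  "edge_limit n \<nu>0 = (let t = edge_t n \<nu>0 in
     sqrt (2 * pi * (1 - 2 * t)) * (2 * t) powr ((real n - 1) / 2) * edge_u n \<nu>0 *
       exp (- edge_eta n \<nu>0) /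
     (Beta (1 / 2) ((real n + 1) / 2) * (real n / 2)) *
     hyp1F1 (real n / 2) (1 / 2) (\<nu>0\<^sup>2 / 2))"

end

theory Submission
  imports Defs
begin

text \<open>
  Let \<open>\<lambda>\<^sub>1 \<le> \<dots> \<le> \<lambda>\<^sub>n\<close> be the eigenvalues of \<open>A - r B\<close> and \<open>\<nu> = P\<^sub>r \<mu>\<close>.  Near the right edge
  \<open>\<lambda>\<^sub>n\<close> is positive and tends to \<open>0\<close>, multiplicity one keeps all other eigenvalues below a fixed
  \<open>- c\<close>, and \<open>\<nu>\<^sub>n\<^sup>2\<close> tends to \<open>\<nu>0\<^sup>2\<close> (\<open>rest_bounded_finite\<close>, \<open>rest_bounded_infinite\<close>,
  \<open>top_noncentrality_tendsto\<close>).  Everything else follows from these three facts.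

  For the tail, note that in eigencoordinates \<open>z\<close>, the event \<open>R > r\<close> is \<open>\<Sum> \<lambda>\<^sub>i z\<^sub>i\<^sup>2 > 0\<close> for a standard normal vector
  shifted by \<open>\<nu>\<close>.  Put \<open>z\<^sub>i = s\<^sub>i y\<^sub>i\<close> with \<open>s\<^sub>n = 1\<close> and \<open>s\<^sub>i = sqrt (\<lambda>\<^sub>n / - \<lambda>\<^sub>i)\<close> otherwise: the event
  becomes the fixed circular cone \<open>\<Sum>\<^bsub>i<n\<^esub> y\<^sub>i\<^sup>2 < y\<^sub>n\<^sup>2\<close>, and since \<open>s\<^sub>i\<close> tends to \<open>0\<close> for \<open>i < n\<close>, dominated
  convergence (\<open>cone_mass_tendsto\<close>) gives
  \<open>Pr (R > r) \<sim> E(r) (2 \<pi>)\<^bsup>-n/2\<^esup> \<integral> exp (- (y\<^sub>n - \<nu>0)\<^sup>2 / 2)\<close>, integrated over the cone, where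
  \<open>E(r) = (\<Prod> s\<^sub>i) exp (- \<Sum>\<^bsub>i<n\<^esub> \<nu>\<^sub>i\<^sup>2 / 2)\<close> is \<open>edge_scale\<close>.  Integrating out the first \<open>n - 1\<close>
  coordinates leaves absolute moments of a shifted normal variable, whose expansion in \<open>\<nu>0\<^sup>2 / 2\<close> is the
  confluent hypergeometric series (\<open>cone_gauss_mass_normalized\<close>).

  For the density, passing from \<open>r\<close> to \<open>r + h\<close> replaces the cone \<open>0 < y \<bullet> J y\<close> by \<open>0 < y \<bullet> (J - h G) y\<close>, with
  \<open>J\<close> the diagonal matrix of signs and \<open>G\<close> the rescaled form of \<open>B\<close>.  The linear maps
  \<open>1 + h J G / 2 \<plusminus> c h\<^sup>2 J\<close> carry the fixed cone to an inner and an outer approximation of the moved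
  one, and both bounds have the same derivative at \<open>h = 0\<close>; so the distribution function is differentiable
  near the edge, with the derivative given by an integral over the fixed cone
  (\<open>has_real_derivative_gauss_cone\<close>).  In this integral every term except one carries a vanishing
  factor \<open>s\<^sub>i\<close> or is odd in the limit, and the scale invariance of the cone
  (\<open>gauss_cone_scaling_identity\<close>) turns the remaining one into the cone mass.  The density is therefore
  asymptotic to \<open>edge_rate k G\<close> times the tail (\<open>cone_derivative_tendsto\<close>), although \<open>edge_rate k G\<close> itself
  need not have a limit.

  For the approximations, the equation \<open>s K'(s) = 0\<close> at \<open>s = t / \<lambda>\<^sub>n\<close> converges to an
  equation whose root in \<open>(0, 1/2)\<close> is \<open>t\<^sub>0\<close>, so the saddlepoint satisfies \<open>s \<lambda>\<^sub>n \<longlonglongrightarrow> t\<^sub>0\<close>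
  (\<open>saddle_limit\<close>).  Then \<open>M(s) / E(r)\<close> has a limit, \<open>s sqrt (K''(s))\<close> tends to \<open>u\<^sub>0\<close>, and \<open>s J(s)\<close> is
  asymptotic to \<open>edge_rate k G\<close>.  In the Lugannani-Rice formula \<open>w\<close> tends to infinity, hence Mills' ratio
  and \<open>1 / w\<close> drop out and \<open>\<phi>(w) / u = M(s) / (sqrt (2 \<pi>) u)\<close> is left.  Both quotients of the theorem thus
  compare quantities with the same factor \<open>E(r)\<close>, respectively \<open>edge_rate k G E(r)\<close>, and converge to the
  same quotient of constants, evaluated in \<open>edge_limit_eq\<close>.
\<close>

section \<open>Linear changes of variables in Lebesgue integrals\<close>

lemma Basis_vec_real: "(Basis :: (real ^ 'n) set) = range (\<lambda>i. axis i 1)"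
  by (auto simp: Basis_vec_def)

lemma prod_Basis_vec: "(\<Prod>b\<in>Basis. (x :: real ^ 'n) \<bullet> b) = (\<Prod>i\<in>UNIV. x $ i)"
  unfolding Basis_vec_real by (subst prod.reindex) (auto simp: inj_on_def axis_eq_axis inner_axis)

lemma measurable_vec_lambda_PiM [measurable]:
  "(\<lambda>f. \<chi> i. f i) \<in> Pi\<^sub>M (UNIV :: 'n set) (\<lambda>_. lborel) \<rightarrow>\<^sub>M (borel :: (real ^ 'n) measure)"
  by (rule borel_measurable_euclidean_space[THEN iffD2])
     (auto simp: Basis_vec_def inner_axis)

lemma lborel_vec_eq_PiM:
  "(lborel :: (real ^ 'n) measure) = distr (Pi\<^sub>M UNIV (\<lambda>_. lborel)) borel (\<lambda>f. \<chi> i. f i)"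
proof (rule lborel_eqI)
  interpret product_sigma_finite "\<lambda>_ :: 'n. lborel :: real measure"
    by standard
  fix l u :: "real ^ 'n"
  assume le: "\<And>b. b \<in> Basis \<Longrightarrow> l \<bullet> b \<le> u \<bullet> b"
  have le': "l $ i \<le> u $ i" for i
    using le[of "axis i 1"] by (simp add: inner_axis)
  have "(\<lambda>f. \<chi> i. f i) -` box l u \<inter> space (Pi\<^sub>M (UNIV :: 'n set) (\<lambda>_. lborel)) = 
        Pi\<^sub>E UNIV (\<lambda>i. {l $ i <..< u $ i})"
    by (auto simp: space_PiM mem_box_cart PiE_def Pi_iff)
  then have "emeasure (distr (Pi\<^sub>M UNIV (\<lambda>_. lborel)) borel (\<lambda>f. \<chi> i. f i)) (box l u) =
     emeasure (Pi\<^sub>M UNIV (\<lambda>_. lborel)) (Pi\<^sub>E UNIV (\<lambda>i. {l $ i <..< u $ i}))"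
    by (simp add: emeasure_distr)
  also have "\<dots> = (\<Prod>i\<in>UNIV. ennreal (u $ i - l $ i))"
    by (subst emeasure_PiM) (auto simp: le')
  also have "\<dots> = ennreal (\<Prod>i\<in>UNIV. u $ i - l $ i)"
    by (rule prod_ennreal) (simp add: le')
  also have "(\<Prod>i\<in>UNIV. u $ i - l $ i) = (\<Prod>b\<in>Basis. (u - l) \<bullet> b)"
    by (simp add: prod_Basis_vec)
  finally show "emeasure (distr (Pi\<^sub>M UNIV (\<lambda>_. lborel)) borel (\<lambda>f. \<chi> i. f i)) (box l u) =
     ennreal (\<Prod>b\<in>Basis. (u - l) \<bullet> b)" .
qed simp

lemma nn_integral_vec_eq_PiM:
  fixes f :: "real ^ 'n \<Rightarrow> ennreal"
  assumes [measurable]: "f \<in> borel_measurable borel"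
  shows "(\<integral>\<^sup>+x. f x \<partial>lborel) = (\<integral>\<^sup>+y. f (\<chi> i. y i) \<partial>Pi\<^sub>M UNIV (\<lambda>_. lborel))"
  by (subst lborel_vec_eq_PiM, subst nn_integral_distr) auto

text \<open>
  Fubini for a single coordinate: shears and the slicing of a cone both act on one coordinate
  while the others are held fixed.
\<close>

lemma nn_integral_vec_split_coordinate:
  fixes f :: "real ^ 'n \<Rightarrow> ennreal"
  assumes [measurable]: "f \<in> borel_measurable borel"
  shows "(\<integral>\<^sup>+x. f x \<partial>lborel) =
      (\<integral>\<^sup>+y. \<integral>\<^sup>+z. f (\<chi> i. if i = k then z else y i) \<partial>lborel \<partial>Pi\<^sub>M (UNIV - {k}) (\<lambda>_. lborel))"
    and "(\<integral>\<^sup>+x. f x \<partial>lborel) =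
      (\<integral>\<^sup>+z. \<integral>\<^sup>+y. f (\<chi> i. if i = k then z else y i) \<partial>Pi\<^sub>M (UNIV - {k}) (\<lambda>_. lborel) \<partial>lborel)"
proof -
  interpret product_sigma_finite "\<lambda>_ :: 'n. lborel :: real measure"
    by standard
  have U: "insert k (UNIV - {k}) = (UNIV :: 'n set)" by auto
  have m: "(\<lambda>y. f (\<chi> i. y i)) \<in> borel_measurable (Pi\<^sub>M (insert k (UNIV - {k})) (\<lambda>_. lborel))"
    unfolding U by measurable
  have "(\<lambda>i. (y(k := z)) i) = (\<lambda>i. if i = k then z else y i)" for y :: "'n \<Rightarrow> real" and z
    by (auto simp: fun_eq_iff)
  then have eq: "(\<chi> i. (y(k := z)) i) = (\<chi> i. if i = k then z else y i)" for y :: "'n \<Rightarrow> real" and z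
    by simp
  show "(\<integral>\<^sup>+x. f x \<partial>lborel) =
      (\<integral>\<^sup>+y. \<integral>\<^sup>+z. f (\<chi> i. if i = k then z else y i) \<partial>lborel \<partial>Pi\<^sub>M (UNIV - {k}) (\<lambda>_. lborel))"
    using product_nn_integral_insert[OF _ _ m] unfolding U nn_integral_vec_eq_PiM[OF assms] eq by simp
  show "(\<integral>\<^sup>+x. f x \<partial>lborel) =
      (\<integral>\<^sup>+z. \<integral>\<^sup>+y. f (\<chi> i. if i = k then z else y i) \<partial>Pi\<^sub>M (UNIV - {k}) (\<lambda>_. lborel) \<partial>lborel)"
    using product_nn_integral_insert_rev[OF _ _ m] unfolding U nn_integral_vec_eq_PiM[OF assms] eq by simp
qed

lemma borel_measurable_matrix_vector_mult [measurable (raw)]: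
  fixes T :: "real ^ 'n ^ 'm"
  assumes "f \<in> borel_measurable M"
  shows "(\<lambda>x. T *v f x) \<in> borel_measurable M"
  using assms by (rule borel_measurable_continuous_on[rotated])
    (auto intro!: linear_continuous_on linear_conv_bounded_linear[THEN iffD1] matrix_vector_mul_linear)

text \<open>
  With the other coordinates held fixed, a shear is a translation in one coordinate.
\<close>

lemma nn_integral_shear:
  fixes f :: "real ^ 'n \<Rightarrow> ennreal" and c :: real
  assumes [measurable]: "f \<in> borel_measurable borel" and ij: "i \<noteq> j"
  defines "T \<equiv> (\<chi> p q. if p = i \<and> q = j then c else of_bool (p = q)) :: real ^ 'n ^ 'n"
  shows "(\<integral>\<^sup>+x. f (T *v x) \<partial>lborel) = (\<integral>\<^sup>+x. f x \<partial>lborel)"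
proof -
  have T: "T *v (\<chi> p. if p = i then z else y p) = (\<chi> p. if p = i then c * y j + z else y p)" for z y
  proof -
    have "(\<Sum>q\<in>UNIV. (if p = i \<and> q = j then c else of_bool (p = q)) * (if q = i then z else y q)) =
        (\<Sum>q\<in>UNIV. (if q = j then if p = i then c * y j else 0 else 0) + (if q = p then (if p = i then z else y p) else 0))" for p
      by (rule sum.cong) (use ij in auto)
    then show ?thesis
      by (auto simp: T_def vec_eq_iff matrix_vector_mult_def sum.distrib)
  qed
  have "(\<integral>\<^sup>+x. f (T *v x) \<partial>lborel) = (\<integral>\<^sup>+y. \<integral>\<^sup>+z. f (T *v (\<chi> p. if p = i then z else y p)) \<partial>lborel \<partial>Pi\<^sub>M (UNIV - {i}) (\<lambda>_. lborel))"
    by (rule nn_integral_vec_split_coordinate) measurable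
  also have "\<dots> = (\<integral>\<^sup>+y. \<integral>\<^sup>+z. f (\<chi> p. if p = i then z else y p) \<partial>lborel \<partial>Pi\<^sub>M (UNIV - {i}) (\<lambda>_. lborel))"
  proof (rule nn_integral_cong)
    fix y :: "'n \<Rightarrow> real"
    have [measurable]: "(\<lambda>z. \<chi> p. if p = i then z else y p) \<in> borel_measurable (borel :: real measure)"
      by (rule borel_measurable_euclidean_space[THEN iffD2]) (auto simp: Basis_vec_def inner_axis)
    show "(\<integral>\<^sup>+z. f (T *v (\<chi> p. if p = i then z else y p)) \<partial>lborel) = (\<integral>\<^sup>+z. f (\<chi> p. if p = i then z else y p) \<partial>lborel)"
      unfolding T
      by (subst (2) nn_integral_real_affine[where c=1 and t="c * y j"]) (simp_all cong: if_cong)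
  qed
  also have "\<dots> = (\<integral>\<^sup>+x. f x \<partial>lborel)"
    by (rule nn_integral_vec_split_coordinate[symmetric]) measurable
  finally show ?thesis .
qed

lemma nn_integral_diagonal:
  fixes f :: "real ^ 'n \<Rightarrow> ennreal" and T :: "real ^ 'n ^ 'n"
  assumes f[measurable]: "f \<in> borel_measurable borel"
    and T: "\<And>i j. i \<noteq> j \<Longrightarrow> T $ i $ j = 0" and nz: "\<And>i. T $ i $ i \<noteq> 0"
  shows "(\<integral>\<^sup>+x. f x \<partial>lborel) = ennreal \<bar>\<Prod>i\<in>UNIV. T $ i $ i\<bar> * (\<integral>\<^sup>+x. f (T *v x) \<partial>lborel)"
proof -
  define c where "c b = (\<Sum>i\<in>UNIV. b $ i * T $ i $ i)" for b :: "real ^ 'n"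
  have c: "c (axis i 1) = T $ i $ i" for i
    by (simp add: c_def axis_def if_distrib[of "\<lambda>u. u * _"] cong: if_cong)
  have Tx: "T *v x = 0 + (\<Sum>b\<in>Basis. (c b * (x \<bullet> b)) *\<^sub>R b)" for x
  proof -
    have "(\<Sum>b\<in>Basis. (c b * (x \<bullet> b)) *\<^sub>R b) = (\<Sum>i\<in>UNIV. (T $ i $ i * x $ i) *\<^sub>R axis i 1)"
      unfolding Basis_vec_real
      by (subst sum.reindex) (auto simp: inj_on_def axis_eq_axis c inner_axis)
    moreover have "(T *v x) $ p = (\<Sum>i\<in>UNIV. (T $ i $ i * x $ i) *\<^sub>R axis i 1) $ p" for p
    proof -
      have "(T *v x) $ p = (\<Sum>i\<in>UNIV. if i = p then T $ p $ p * x $ p else 0)"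
        unfolding matrix_vector_mult_def vec_lambda_beta by (rule sum.cong) (use T in auto)
      moreover have "(\<Sum>i\<in>UNIV. (T $ i $ i * x $ i) *\<^sub>R axis i 1) $ p = (\<Sum>i\<in>UNIV. if i = p then T $ p $ p * x $ p else 0)"
        unfolding sum_component by (rule sum.cong) (auto simp: axis_def)
      ultimately show ?thesis by simp
    qed
    ultimately show ?thesis by (simp add: vec_eq_iff)
  qed
  have "lborel = density (distr lborel borel ((*v) T)) (\<lambda>_. ennreal (\<Prod>b\<in>Basis. \<bar>c b\<bar>))"
    unfolding Tx by (subst lborel_affine_euclidean[of c 0]) (auto simp: Basis_vec_real c nz)
  also have "(\<Prod>b\<in>Basis. \<bar>c b\<bar>) = \<bar>\<Prod>i\<in>UNIV. T $ i $ i\<bar>"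
    unfolding Basis_vec_real by (subst prod.reindex) (auto simp: inj_on_def axis_eq_axis c abs_prod)
  finally have "(\<integral>\<^sup>+x. f x \<partial>lborel) = (\<integral>\<^sup>+x. f x \<partial>density (distr lborel borel ((*v) T)) (\<lambda>_. ennreal \<bar>\<Prod>i\<in>UNIV. T $ i $ i\<bar>))"
    by (rule arg_cong)
  also have "\<dots> = ennreal \<bar>\<Prod>i\<in>UNIV. T $ i $ i\<bar> * (\<integral>\<^sup>+x. f (T *v x) \<partial>lborel)"
    by (subst nn_integral_density) (auto simp: nn_integral_distr nn_integral_cmult)
  finally show ?thesis .
qed

lemma nn_integral_transpose_coordinates:
  fixes f :: "real ^ 'n \<Rightarrow> ennreal" and p q :: 'n 
  assumes f[measurable]: "f \<in> borel_measurable borel"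
  defines "T \<equiv> (\<chi> i j. mat 1 $ i $ Transposition.transpose p q j) :: real ^ 'n ^ 'n"
  shows "(\<integral>\<^sup>+x. f (T *v x) \<partial>lborel) = (\<integral>\<^sup>+x. f x \<partial>lborel)"
proof -
  let ?t = "Transposition.transpose p q"
  have Tx: "T *v x = (\<chi> i. x $ ?t i)" for x
  proof -
    have "(\<Sum>j\<in>UNIV. (if i = ?t j then 1 else 0) * x $ j) = (\<Sum>j\<in>UNIV. (if j = ?t i then x $ ?t i else 0))" for i
      by (rule sum.cong) (auto simp: transpose_eq_iff)
    then show ?thesis by (simp add: T_def mat_def matrix_vector_mult_def vec_eq_iff)
  qed
  have "lborel = distr lborel borel ((*v) T)"
  proof (rule lborel_eqI)
    fix l u :: "real ^ 'n"
    assume le: "\<And>b. b \<in> Basis \<Longrightarrow> l \<bullet> b \<le> u \<bullet> b"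
    have le': "l $ i \<le> u $ i" for i
      using le[of "axis i 1"] by (simp add: inner_axis)
    have "(*v) T -` box l u = box (\<chi> i. l $ ?t i) (\<chi> i. u $ ?t i)"
      by (auto simp: Tx mem_box_cart) (metis transpose_involutory)+
    then have "emeasure (distr lborel borel ((*v) T)) (box l u) = (\<Prod>b\<in>Basis. ((\<chi> i. u $ ?t i) - (\<chi> i. l $ ?t i)) \<bullet> b)"
      by (subst emeasure_distr) (auto simp: emeasure_lborel_box_eq Basis_vec_real inner_axis le')
    also have "\<dots> = (\<Prod>i\<in>UNIV. u $ i - l $ i)"
    proof -
      have "(\<Prod>i\<in>UNIV. u $ ?t i - l $ ?t i) = (\<Prod>i\<in>UNIV. u $ i - l $ i)"
        by (rule prod.reindex_bij_betw[of ?t]) (auto simp: bij_betw_def)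
      then show ?thesis by (simp add: prod_Basis_vec)
    qed
    finally show "emeasure (distr lborel borel ((*v) T)) (box l u) = ennreal (\<Prod>b\<in>Basis. (u - l) \<bullet> b)"
      by (simp add: prod_Basis_vec)
  qed simp
  then have "(\<integral>\<^sup>+x. f x \<partial>lborel) = (\<integral>\<^sup>+x. f x \<partial>distr lborel borel ((*v) T))" by (rule arg_cong)
  then show ?thesis by (simp add: nn_integral_distr)
qed

text \<open>
  Every matrix is a product of elementary matrices, and the formula is multiplicative in \<open>T\<close>.  So
  it suffices to know it for diagonal matrices, transpositions and shears.
\<close>

proposition nn_integral_linear_change:
  fixes f :: "real ^ 'n \<Rightarrow> ennreal" and T :: "real ^ 'n ^ 'n"
  assumes f: "f \<in> borel_measurable borel" and T: "det T \<noteq> 0"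
  shows "(\<integral>\<^sup>+x. f x \<partial>lborel) = ennreal \<bar>det T\<bar> * (\<integral>\<^sup>+x. f (T *v x) \<partial>lborel)"
proof -
  define Q where "Q T \<longleftrightarrow> (det T \<noteq> 0 \<longrightarrow> (\<forall>f\<in>borel_measurable borel. (\<integral>\<^sup>+x. f x \<partial>lborel) = ennreal \<bar>det T\<bar> * (\<integral>\<^sup>+x. f (T *v x) \<partial>lborel)))"
    for T :: "real ^ 'n ^ 'n"
  have QD: "(\<integral>\<^sup>+x. f x \<partial>lborel) = ennreal \<bar>det T\<bar> * (\<integral>\<^sup>+x. f (T *v x) \<partial>lborel)"
    if "Q T" "det T \<noteq> 0" "f \<in> borel_measurable borel" for f T
    using that unfolding Q_def by blast
  have "Q T"
  proof (rule induct_matrix_elementary)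
    fix A B :: "real ^ 'n ^ 'n"
    assume AB: "Q A" "Q B"
    show "Q (A ** B)"
      unfolding Q_def
    proof (intro impI ballI)
      assume "det (A ** B) \<noteq> 0"
      then have nz: "det A \<noteq> 0" "det B \<noteq> 0" by (auto simp: det_mul)
      fix f :: "real ^ 'n \<Rightarrow> ennreal" assume f[measurable]: "f \<in> borel_measurable borel"
      have "(\<integral>\<^sup>+x. f x \<partial>lborel) = ennreal \<bar>det A\<bar> * (\<integral>\<^sup>+x. f (A *v x) \<partial>lborel)"
        by (rule QD[OF AB(1) nz(1) f])
      also have "(\<integral>\<^sup>+x. f (A *v x) \<partial>lborel) = ennreal \<bar>det B\<bar> * (\<integral>\<^sup>+x. f (A *v (B *v x)) \<partial>lborel)"
        by (rule QD[OF AB(2) nz(2)]) measurable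
      finally show "(\<integral>\<^sup>+x. f x \<partial>lborel) = ennreal \<bar>det (A ** B)\<bar> * (\<integral>\<^sup>+x. f ((A ** B) *v x) \<partial>lborel)"
        by (simp add: det_mul abs_mult ennreal_mult' mult.assoc matrix_vector_mul_assoc)
    qed
  next
    fix A :: "real ^ 'n ^ 'n" and i assume "row i A = 0"
    then show "Q A" by (simp add: Q_def det_zero_row)
  next
    fix A :: "real ^ 'n ^ 'n" assume A: "\<And>i j. i \<noteq> j \<Longrightarrow> A $ i $ j = 0"
    show "Q A"
      unfolding Q_def
    proof (intro impI ballI)
      assume "det A \<noteq> 0"
      then have "A $ i $ i \<noteq> 0" for i using det_diagonal[of A] A by auto
      then show "(\<integral>\<^sup>+x. f x \<partial>lborel) = ennreal \<bar>det A\<bar> * (\<integral>\<^sup>+x. f (A *v x) \<partial>lborel)"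
        if "f \<in> borel_measurable borel" for f
        using nn_integral_diagonal[OF that A] A det_diagonal[of A] by simp
    qed
  next
    fix m n :: 'n assume "m \<noteq> n"
    have "\<bar>det (\<chi> i j. (mat 1 :: real ^ 'n ^ 'n) $ i $ Transposition.transpose m n j)\<bar> = 1"
      by (simp add: det_permute_columns permutes_swap_id sign_swap_id abs_mult)
    then show "Q (\<chi> i j. mat 1 $ i $ Transposition.transpose m n j)"
      unfolding Q_def using nn_integral_transpose_coordinates[of _ m n] by simp
  next
    fix m n :: 'n and c :: real assume mn: "m \<noteq> n"
    have "(\<chi> i j. if i = m \<and> j = n then c else of_bool (i = j)) =
        ((\<chi> k. if k = m then row m (mat 1) + c *s row n (mat 1) else row k (mat 1)) :: real ^ 'n ^ 'n)"
      using mn by (auto simp: vec_eq_iff row_def mat_def)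
    then have "det ((\<chi> i j. if i = m \<and> j = n then c else of_bool (i = j)) :: real ^ 'n ^ 'n) = 1"
      using det_row_operation[OF mn, of "mat 1 :: real ^ 'n ^ 'n" c] by simp
    then show "Q (\<chi> i j. if i = m \<and> j = n then c else of_bool (i = j))"
      unfolding Q_def using nn_integral_shear[OF _ mn, of _ c] by simp
  qed
  then show ?thesis by (rule QD[OF _ T f])
qed

corollary integral_linear_change:
  fixes f :: "real ^ 'n \<Rightarrow> real" and T :: "real ^ 'n ^ 'n"
  assumes f[measurable]: "f \<in> borel_measurable borel" and T: "det T \<noteq> 0"
  shows "integrable lborel (\<lambda>x. f (T *v x)) \<longleftrightarrow> integrable lborel f"
    and "(\<integral>x. f x \<partial>lborel) = \<bar>det T\<bar> * (\<integral>x. f (T *v x) \<partial>lborel)"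
proof -
  have eq: "lborel = density (distr lborel borel ((*v) T)) (\<lambda>_. ennreal \<bar>det T\<bar>)"
  proof (rule measure_eqI)
    fix X :: "(real ^ 'n) set" assume "X \<in> sets lborel"
    then have [measurable]: "X \<in> sets borel" by simp
    have "emeasure lborel X = (\<integral>\<^sup>+x. indicator X x \<partial>lborel)" by simp
    also have "\<dots> = ennreal \<bar>det T\<bar> * (\<integral>\<^sup>+x. indicator X (T *v x) \<partial>lborel)"
      by (rule nn_integral_linear_change[OF _ T]) measurable
    also have "\<dots> = emeasure (density (distr lborel borel ((*v) T)) (\<lambda>_. ennreal \<bar>det T\<bar>)) X"
    proof -
      have "(\<integral>\<^sup>+x. indicator X (T *v x) \<partial>lborel) = (\<integral>\<^sup>+x. indicator X x \<partial>distr lborel borel ((*v) T))"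
        by (subst nn_integral_distr) auto
      then show ?thesis by (subst emeasure_density) (auto simp: nn_integral_cmult)
    qed
    finally show "emeasure lborel X = emeasure (density (distr lborel borel ((*v) T)) (\<lambda>_. ennreal \<bar>det T\<bar>)) X" .
  qed simp
  show "integrable lborel (\<lambda>x. f (T *v x)) \<longleftrightarrow> integrable lborel f"
    by (subst (2) eq, subst integrable_density) (use T in \<open>auto simp: integrable_distr_eq\<close>)
  show "(\<integral>x. f x \<partial>lborel) = \<bar>det T\<bar> * (\<integral>x. f (T *v x) \<partial>lborel)"
    by (subst eq, subst integral_density) (auto simp: integral_distr)
qed

section \<open>Differentiation of Gaussian integrals\<close>

text \<open>
  By the mean value theorem the difference quotients are bounded by the integrable \<open>w\<close>, so dominated
  convergence along every null sequence applies.
\<close>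

lemma has_real_derivative_integral:
  fixes f f' :: "real \<Rightarrow> 'a \<Rightarrow> real"
  assumes \<eta>: "0 < \<eta>"
    and int: "\<And>h. \<bar>h\<bar> < \<eta> \<Longrightarrow> integrable M (f h)"
    and der: "\<And>h x. x \<in> space M \<Longrightarrow> \<bar>h\<bar> < \<eta> \<Longrightarrow> ((\<lambda>h. f h x) has_real_derivative f' h x) (at h)"
    and bound: "\<And>h x. x \<in> space M \<Longrightarrow> \<bar>h\<bar> < \<eta> \<Longrightarrow> \<bar>f' h x\<bar> \<le> w x"
    and w: "integrable M w"
    and meas: "f' 0 \<in> borel_measurable M"
  shows "((\<lambda>h. \<integral>x. f h x \<partial>M) has_real_derivative (\<integral>x. f' 0 x \<partial>M)) (at 0)"
  unfolding DERIV_def tendsto_at_iff_sequentially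
proof (intro allI impI)
  fix X :: "nat \<Rightarrow> real"
  assume X0: "\<forall>i. X i \<in> UNIV - {0}" and X: "X \<longlonglongrightarrow> 0"
  from X \<eta> have "\<forall>\<^sub>F i in sequentially. \<bar>X i\<bar> < \<eta>"
    by (auto dest!: tendstoD[of X 0 _ \<eta>])
  then obtain N where N: "\<And>i. N \<le> i \<Longrightarrow> \<bar>X i\<bar> < \<eta>"
    by (auto simp: eventually_sequentially)
  show "((\<lambda>h. ((\<integral>x. f (0 + h) x \<partial>M) - (\<integral>x. f 0 x \<partial>M)) / h) \<circ> X) \<longlonglongrightarrow> (\<integral>x. f' 0 x \<partial>M)"
  proof (rule LIMSEQ_offset)
    have eq: "((\<lambda>h. ((\<integral>x. f (0 + h) x \<partial>M) - (\<integral>x. f 0 x \<partial>M)) / h) \<circ> X) (i + N) =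
        (\<integral>x. (f (X (i + N)) x - f 0 x) / X (i + N) \<partial>M)" for i
      using int[of "X (i + N)"] int[of 0] \<eta> N[of "i + N"] by simp
    show "(\<lambda>i. ((\<lambda>h. ((\<integral>x. f (0 + h) x \<partial>M) - (\<integral>x. f 0 x \<partial>M)) / h) \<circ> X) (i + N)) \<longlonglongrightarrow> (\<integral>x. f' 0 x \<partial>M)"
      unfolding eq
    proof (rule integral_dominated_convergence[where w = w])
      show "f' 0 \<in> borel_measurable M" by fact
      show "(\<lambda>x. (f (X (i + N)) x - f 0 x) / X (i + N)) \<in> borel_measurable M" for i
        using int[of "X (i + N)"] int[of 0] \<eta> N[of "i + N"]
        by (auto intro!: borel_measurable_divide borel_measurable_diff borel_measurable_integrable)
      show "integrable M w" by fact
      show "AE x in M. (\<lambda>i. (f (X (i + N)) x - f 0 x) / X (i + N)) \<longlonglongrightarrow> f' 0 x"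
      proof (rule AE_I2)
        fix x assume x: "x \<in> space M"
        have "((\<lambda>h. (f (0 + h) x - f 0 x) / h) \<longlongrightarrow> f' 0 x) (at 0)"
          using der[OF x, of 0] \<eta> by (simp add: DERIV_def)
        then have "(\<lambda>i. (f (X i) x - f 0 x) / X i) \<longlonglongrightarrow> f' 0 x"
          using X0 X by (auto simp: tendsto_at_iff_sequentially comp_def)
        then show "(\<lambda>i. (f (X (i + N)) x - f 0 x) / X (i + N)) \<longlonglongrightarrow> f' 0 x"
          by (rule LIMSEQ_ignore_initial_segment)
      qed
      show "AE x in M. norm ((f (X (i + N)) x - f 0 x) / X (i + N)) \<le> w x" for i
      proof (rule AE_I2)
        fix x assume x: "x \<in> space M"
        let ?h = "X (i + N)"
        have h: "?h \<noteq> 0" "\<bar>?h\<bar> < \<eta>" using X0 N by auto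
        have "norm (f ?h x - f 0 x) \<le> w x * norm (?h - 0)"
        proof (rule field_differentiable_bound)
          show "convex {- \<bar>?h\<bar>..\<bar>?h\<bar>}" by simp
          fix z assume z: "z \<in> {- \<bar>?h\<bar>..\<bar>?h\<bar>}"
          then have "\<bar>z\<bar> < \<eta>" using h by auto
          then show "((\<lambda>h. f h x) has_field_derivative f' z x) (at z within {- \<bar>?h\<bar>..\<bar>?h\<bar>})"
            using der[OF x] by (auto intro: has_field_derivative_at_within)
          show "norm (f' z x) \<le> w x" using bound[OF x \<open>\<bar>z\<bar> < \<eta>\<close>] by simp
        qed auto
        then show "norm ((f ?h x - f 0 x) / ?h) \<le> w x"
          using h by (simp add: field_simps abs_divide)
      qed
    qed
  qed
qed

lemma integrable_exp_neg_norm_square: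
  assumes "0 < c"
  shows "integrable lborel (\<lambda>y :: real ^ 'n. exp (- (c * (norm y)\<^sup>2)))"
proof -
  interpret product_sigma_finite "\<lambda>_ :: 'n. lborel :: real measure"
    by standard
  define \<sigma> where "\<sigma> = 1 / sqrt (2 * c)"
  have \<sigma>: "0 < \<sigma>" "2 * \<sigma>\<^sup>2 = 1 / c"
    using assms by (auto simp: \<sigma>_def power_divide)
  have "exp (- (c * x\<^sup>2)) = sqrt (2 * pi * \<sigma>\<^sup>2) * normal_density 0 \<sigma> x" for x
    using \<sigma> by (simp add: normal_density_def)
  then have i1: "integrable lborel (\<lambda>x :: real. exp (- (c * x\<^sup>2)))"
    using \<sigma> by simp
  have "exp (- (c * (norm y)\<^sup>2)) = (\<Prod>i\<in>UNIV. exp (- (c * (y $ i)\<^sup>2)))" for y :: "real ^ 'n"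
    by (simp add: norm_vec_def L2_set_def sum_nonneg exp_sum[symmetric] sum_distrib_left sum_negf)
  moreover have "integrable (Pi\<^sub>M UNIV (\<lambda>_. lborel)) (\<lambda>y. \<Prod>i\<in>(UNIV :: 'n set). exp (- (c * (y i)\<^sup>2)))"
    by (rule product_integrable_prod) (use i1 in auto)
  ultimately show ?thesis
    by (subst lborel_vec_eq_PiM, subst integrable_distr_eq) auto
qed

lemma one_plus_square_times_exp_le:
  fixes t c :: real
  assumes "0 < c" "0 \<le> t"
  shows "(1 + t)\<^sup>2 * exp (- (c * t\<^sup>2)) \<le> (2 + 4 / c) * exp (- (c / 2 * t\<^sup>2))"
proof -
  have "(1 + t)\<^sup>2 \<le> 2 + 2 * t\<^sup>2"
    using sum_squares_ge_zero[of "1 - t" 0] by (simp add: power2_eq_square algebra_simps)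
  also have "\<dots> \<le> (2 + 4 / c) * (1 + c / 2 * t\<^sup>2)"
    using assms by (simp add: field_simps)
  also have "\<dots> \<le> (2 + 4 / c) * exp (c / 2 * t\<^sup>2)"
    using assms by (intro mult_left_mono exp_ge_add_one_self) auto
  finally have "(1 + t)\<^sup>2 * exp (- (c * t\<^sup>2)) \<le> (2 + 4 / c) * exp (c / 2 * t\<^sup>2) * exp (- (c * t\<^sup>2))"
    by (intro mult_right_mono) auto
  also have "\<dots> = (2 + 4 / c) * exp (- (c / 2 * t\<^sup>2))"
    by (simp add: mult.assoc exp_add[symmetric])
  finally show ?thesis .
qed

lemma integrable_one_plus_norm_square_exp:
  assumes "0 < c"
  shows "integrable lborel (\<lambda>y :: real ^ 'n. (1 + norm y)\<^sup>2 * exp (- (c * (norm y)\<^sup>2)))"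
proof (rule Bochner_Integration.integrable_bound)
  show "integrable lborel (\<lambda>y :: real ^ 'n. (2 + 4 / c) * exp (- (c / 2 * (norm y)\<^sup>2)))"
    using integrable_exp_neg_norm_square[of "c / 2", where 'n = 'n] assms by simp
  show "AE y :: real ^ 'n in lborel. norm ((1 + norm y)\<^sup>2 * exp (- (c * (norm y)\<^sup>2)))
      \<le> norm ((2 + 4 / c) * exp (- (c / 2 * (norm y)\<^sup>2)))"
    using one_plus_square_times_exp_le[OF assms] assms by (auto simp: abs_mult)
qed measurable

text \<open>
  An unnormalized normal density in coordinates in which the covariance is not the identity: the
  matrix \<open>T\<close> is moved into the exponent so that domains of integration can be kept fixed.
\<close>

definition gauss :: "real ^ 'n ^ 'n \<Rightarrow> real ^ 'n \<Rightarrow> real ^ 'n \<Rightarrow> real" where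
  "gauss T \<nu> y = exp (- (norm (T *v y - \<nu>))\<^sup>2 / 2)"

lemma borel_measurable_gauss [measurable]: "gauss T \<nu> \<in> borel_measurable borel"
  unfolding gauss_def by measurable

lemma gauss_pos: "0 < gauss T \<nu> y" and gauss_nonneg: "0 \<le> gauss T \<nu> y"
  by (auto simp: gauss_def)

lemma norm_diff_square_ge:
  fixes a b :: "'a :: real_inner"
  shows "(norm a)\<^sup>2 / 2 - (norm b)\<^sup>2 \<le> (norm (a - b))\<^sup>2"
proof -
  have "0 \<le> (norm (a - 2 *\<^sub>R b))\<^sup>2" by simp
  then show ?thesis
    by (simp add: power2_norm_eq_inner inner_simps inner_commute field_simps)
qed

text \<open>
  The domination for integrability and for differentiation under the integral: the bound depends on \<open>T\<close>
  only through the coercivity constant \<open>c\<close>, so it serves all small perturbations of a matrix at once.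
\<close>

lemma gauss_le:
  assumes "c * norm y \<le> norm (T *v y)" "0 \<le> c"
  shows "gauss T \<nu> y \<le> exp ((norm \<nu>)\<^sup>2 / 2) * exp (- (c\<^sup>2 / 4 * (norm y)\<^sup>2))"
proof -
  have "(c * norm y)\<^sup>2 \<le> (norm (T *v y))\<^sup>2"
    using assms by (intro power_mono) auto
  then have "- (norm (T *v y - \<nu>))\<^sup>2 / 2 \<le> (norm \<nu>)\<^sup>2 / 2 + (- (c\<^sup>2 / 4 * (norm y)\<^sup>2))"
    using norm_diff_square_ge[of "T *v y" \<nu>] by (simp add: power_mult_distrib field_simps)
  then show ?thesis
    unfolding gauss_def exp_add[symmetric] by simp
qed

lemma matrix_vector_mult_norm_le:
  fixes T :: "real ^ 'n ^ 'm"
  obtains K where "0 < K" "\<And>y. norm (T *v y) \<le> K * norm y"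
proof -
  have "bounded_linear ((*v) T)"
    using linear_conv_bounded_linear matrix_vector_mul_linear by blast
  from bounded_linear.pos_bounded[OF this] show ?thesis
    using that by (auto simp: mult.commute)
qed

text \<open>
  For small \<open>h\<close> the matrices \<open>S + h U + h\<^sup>2 V\<close> stay coercive with constant \<open>c / 2\<close>, which provides the
  dominating function for differentiation under the integral sign.  The quadratic term leaves the derivative at
  \<open>0\<close> unchanged; it separates the inner from the outer approximation of a moving cone.
\<close>

lemma has_real_derivative_gauss_integral:
  fixes S U V :: "real ^ 'n ^ 'n" and \<nu> :: "real ^ 'n" and C :: "(real ^ 'n) set"
  assumes c: "0 < c" "\<And>y. c * norm y \<le> norm (S *v y)" and C[measurable]: "C \<in> sets borel"
  shows "((\<lambda>h. \<integral>y. indicator C y * gauss (S + h *\<^sub>R U + h\<^sup>2 *\<^sub>R V) \<nu> y \<partial>lborel) has_real_derivative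
           (\<integral>y. - (indicator C y * ((S *v y - \<nu>) \<bullet> (U *v y)) * gauss S \<nu> y) \<partial>lborel)) (at 0)"
proof -
  obtain Ks where Ks: "0 < Ks" "\<And>y. norm (S *v y) \<le> Ks * norm y" by (rule matrix_vector_mult_norm_le[of S]) blast
  obtain Ku where Ku: "0 < Ku" "\<And>y. norm (U *v y) \<le> Ku * norm y" by (rule matrix_vector_mult_norm_le[of U]) blast
  obtain Kv where Kv: "0 < Kv" "\<And>y. norm (V *v y) \<le> Kv * norm y" by (rule matrix_vector_mult_norm_le[of V]) blast
  define T where "T h = S + h *\<^sub>R U + h\<^sup>2 *\<^sub>R V" for h
  define D where "D h = U + (2 * h) *\<^sub>R V" for h
  \<comment> \<open>the perturbation of size at most \<open>\<eta> (Ku + Kv)\<close> consumes half of the coercivity\<close>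
  define \<eta> where "\<eta> = min 1 (c / (2 * (Ku + Kv)))"
  have \<eta>: "0 < \<eta>" "\<eta> \<le> 1" "\<eta> * (Ku + Kv) \<le> c / 2"
  proof -
    have "\<eta> * (Ku + Kv) \<le> c / (2 * (Ku + Kv)) * (Ku + Kv)"
      using Ku Kv unfolding \<eta>_def by (intro mult_right_mono) auto
    also have "\<dots> = c / 2" using Ku(1) Kv(1) by (simp add: field_simps)
    finally show "\<eta> * (Ku + Kv) \<le> c / 2" .
  qed (use Ku Kv c in \<open>auto simp: \<eta>_def\<close>)
  have Ty: "T h *v y = S *v y + h *\<^sub>R (U *v y) + h\<^sup>2 *\<^sub>R (V *v y)" for h y
    by (simp add: T_def matrix_vector_mult_add_rdistrib scaleR_matrix_vector_assoc)
  have Dy: "D h *v y = U *v y + (2 * h) *\<^sub>R (V *v y)" for h y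
    by (simp add: D_def matrix_vector_mult_add_rdistrib scaleR_matrix_vector_assoc)
  have pert: "norm (h *\<^sub>R (U *v y) + h\<^sup>2 *\<^sub>R (V *v y)) \<le> c / 2 * norm y" if h: "\<bar>h\<bar> < \<eta>" for h y
  proof -
    have "\<bar>h\<bar> * \<bar>h\<bar> \<le> \<bar>h\<bar> * 1" using h \<eta>(2) by (intro mult_left_mono) auto
    then have "h\<^sup>2 \<le> \<bar>h\<bar>" by (simp add: power2_eq_square)
    then have "norm (h *\<^sub>R (U *v y) + h\<^sup>2 *\<^sub>R (V *v y)) \<le> \<bar>h\<bar> * (Ku * norm y) + \<bar>h\<bar> * (Kv * norm y)"
      using Ku(2)[of y] Kv(2)[of y]
      by (intro norm_triangle_le add_mono) (auto intro!: mult_mono mult_left_mono)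
    also have "\<dots> = \<bar>h\<bar> * (Ku + Kv) * norm y" by (simp add: algebra_simps)
    also have "\<dots> \<le> \<eta> * (Ku + Kv) * norm y"
      using h Ku Kv by (intro mult_right_mono) auto
    also have "\<dots> \<le> c / 2 * norm y" using \<eta> by (intro mult_right_mono) auto
    finally show ?thesis .
  qed
  have Tlow: "c / 2 * norm y \<le> norm (T h *v y)" if h: "\<bar>h\<bar> < \<eta>" for h y
    using norm_diff_ineq[of "S *v y" "h *\<^sub>R (U *v y) + h\<^sup>2 *\<^sub>R (V *v y)"] pert[OF h, of y] c(2)[of y]
    by (simp add: Ty add.assoc)
  define K where "K = (Ks + c / 2 + norm \<nu>) * (Ku + 2 * Kv)"
  have K0: "0 \<le> K" using Ks Ku Kv c by (simp add: K_def)
  have g_le: "gauss (T h) \<nu> y \<le> exp ((norm \<nu>)\<^sup>2 / 2) * exp (- ((c / 2)\<^sup>2 / 4 * (norm y)\<^sup>2))"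
    if "\<bar>h\<bar> < \<eta>" for h y
    by (rule gauss_le[OF Tlow[OF that]]) (use c in auto)
  let ?w = "\<lambda>y :: real ^ 'n. K * exp ((norm \<nu>)\<^sup>2 / 2) * ((1 + norm y)\<^sup>2 * exp (- ((c / 2)\<^sup>2 / 4 * (norm y)\<^sup>2)))"
  let ?f = "\<lambda>h y. indicator C y * gauss (T h) \<nu> y"
  let ?f' = "\<lambda>h y. - (indicator C y * ((T h *v y - \<nu>) \<bullet> (D h *v y)) * gauss (T h) \<nu> y)"
  have "((\<lambda>h. \<integral>y. ?f h y \<partial>lborel) has_real_derivative (\<integral>y. ?f' 0 y \<partial>lborel)) (at 0)"
  proof (rule has_real_derivative_integral[OF \<eta>(1), where w = ?w])
    show "integrable lborel (?f h)" if "\<bar>h\<bar> < \<eta>" for h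
    proof (rule Bochner_Integration.integrable_bound)
      show "integrable lborel (\<lambda>y :: real ^ 'n. exp ((norm \<nu>)\<^sup>2 / 2) * exp (- ((c / 2)\<^sup>2 / 4 * (norm y)\<^sup>2)))"
        using integrable_exp_neg_norm_square[of "(c / 2)\<^sup>2 / 4", where 'n = 'n] c by simp
      show "AE y in lborel. norm (?f h y) \<le> norm (exp ((norm \<nu>)\<^sup>2 / 2) * exp (- ((c / 2)\<^sup>2 / 4 * (norm y)\<^sup>2)))"
        using g_le[OF that] by (intro AE_I2) (auto simp: indicator_def gauss_nonneg)
    qed measurable
    show "integrable lborel ?w"
      using integrable_one_plus_norm_square_exp[of "(c / 2)\<^sup>2 / 4", where 'n = 'n] c by (intro integrable_mult_right) auto
    show "?f' 0 \<in> borel_measurable lborel" by measurable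
    fix h y assume h: "\<bar>h\<bar> < \<eta>"
    define Q where "Q h = (norm (T h *v y - \<nu>))\<^sup>2" for h
    have "((\<lambda>h. T h *v y - \<nu>) has_derivative (\<lambda>x. x *\<^sub>R (D h *v y))) (at h)"
      unfolding Ty Dy by (auto intro!: derivative_eq_intros simp: algebra_simps)
    from has_derivative_inner[OF this this]
    have Q: "(Q has_real_derivative 2 * ((T h *v y - \<nu>) \<bullet> (D h *v y))) (at h)"
      unfolding has_field_derivative_def Q_def power2_norm_eq_inner
      by (rule has_derivative_eq_rhs) (auto simp: fun_eq_iff inner_commute)
    have "((\<lambda>h. indicator C y * exp (- Q h / 2)) has_real_derivative
        indicator C y * (exp (- Q h / 2) * (- (2 * ((T h *v y - \<nu>) \<bullet> (D h *v y))) / 2))) (at h)"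
      by (intro DERIV_cmult DERIV_chain2[OF DERIV_exp] DERIV_cdivide DERIV_minus Q)
    then show "((\<lambda>h. ?f h y) has_real_derivative ?f' h y) (at h)"
      by (simp add: gauss_def Q_def mult_ac)
    have n1: "norm (T h *v y - \<nu>) \<le> (Ks + c / 2 + norm \<nu>) * (1 + norm y)"
    proof -
      have "norm (T h *v y - \<nu>) \<le> norm (S *v y) + norm (h *\<^sub>R (U *v y) + h\<^sup>2 *\<^sub>R (V *v y)) + norm \<nu>"
        using norm_triangle_ineq4[of "T h *v y" \<nu>]
          norm_triangle_ineq[of "S *v y" "h *\<^sub>R (U *v y) + h\<^sup>2 *\<^sub>R (V *v y)"]
        by (simp add: Ty add.assoc)
      also have "\<dots> \<le> Ks * norm y + c / 2 * norm y + norm \<nu>"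
        using Ks(2)[of y] pert[OF h, of y] by simp
      also have "\<dots> \<le> (Ks + c / 2 + norm \<nu>) * (1 + norm y)"
        using Ks(1) c(1) mult_nonneg_nonneg[of "norm \<nu>" "norm y"] by (simp add: distrib_left distrib_right)
      finally show ?thesis .
    qed
    have n2: "norm (D h *v y) \<le> (Ku + 2 * Kv) * (1 + norm y)"
    proof -
      have "norm (D h *v y) \<le> norm (U *v y) + \<bar>2 * h\<bar> * norm (V *v y)"
        unfolding Dy by (metis norm_scaleR norm_triangle_ineq)
      also have "\<dots> \<le> Ku * norm y + 2 * (Kv * norm y)"
        using Ku(2)[of y] Kv(2)[of y] h \<eta> by (intro add_mono mult_mono) auto
      also have "\<dots> \<le> (Ku + 2 * Kv) * (1 + norm y)"
        using Ku(1) Kv(1) by (simp add: distrib_left distrib_right)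
      finally show ?thesis .
    qed
    have "\<bar>(T h *v y - \<nu>) \<bullet> (D h *v y)\<bar> \<le> norm (T h *v y - \<nu>) * norm (D h *v y)"
      by (rule Cauchy_Schwarz_ineq2)
    also have "\<dots> \<le> ((Ks + c / 2 + norm \<nu>) * (1 + norm y)) * ((Ku + 2 * Kv) * (1 + norm y))"
      using n1 n2 Ks c by (intro mult_mono) auto
    also have "\<dots> = K * (1 + norm y)\<^sup>2" by (simp add: K_def power2_eq_square)
    finally have ip: "\<bar>(T h *v y - \<nu>) \<bullet> (D h *v y)\<bar> \<le> K * (1 + norm y)\<^sup>2" .
    have "\<bar>?f' h y\<bar> \<le> \<bar>(T h *v y - \<nu>) \<bullet> (D h *v y)\<bar> * gauss (T h) \<nu> y"
      by (auto simp: indicator_def abs_mult gauss_nonneg)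
    also have "\<dots> \<le> (K * (1 + norm y)\<^sup>2) * (exp ((norm \<nu>)\<^sup>2 / 2) * exp (- ((c / 2)\<^sup>2 / 4 * (norm y)\<^sup>2)))"
      using ip g_le[OF h, of y] K0 by (intro mult_mono) (auto simp: gauss_nonneg)
    finally show "\<bar>?f' h y\<bar> \<le> ?w y" by (simp add: mult_ac)
  qed
  moreover have "T 0 = S" "D 0 = U" by (auto simp: T_def D_def)
  ultimately show ?thesis unfolding T_def by simp
qed

text \<open>
  In the derivative of the Leibniz expansion all but one factor of each product are entries of the
  identity matrix.  A permutation that fixes all indices but one fixes that one too, so only the identity
  permutation contributes.
\<close>

lemma has_real_derivative_det_near_identity:
  fixes N K :: "real ^ 'n ^ 'n"
  shows "((\<lambda>h. det (mat 1 + h *\<^sub>R N + h\<^sup>2 *\<^sub>R K)) has_real_derivative trace N) (at 0)"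
proof -
  define a where "a h i j = (mat 1 :: real ^ 'n ^ 'n) $ i $ j + h * N $ i $ j + h\<^sup>2 * K $ i $ j" for h i j
  have d: "((\<lambda>h. a h i j) has_real_derivative N $ i $ j) (at 0)" for i j
    unfolding a_def by (auto intro!: derivative_eq_intros)
  have "((\<lambda>h. \<Sum>p | p permutes (UNIV :: 'n set). of_int (sign p) * (\<Prod>i\<in>UNIV. a h i (p i))) has_real_derivative
      (\<Sum>p | p permutes (UNIV :: 'n set). of_int (sign p) * (\<Sum>i\<in>UNIV. N $ i $ p i * (\<Prod>j\<in>UNIV - {i}. a 0 j (p j))))) (at 0)"
    by (intro DERIV_sum DERIV_cmult has_field_derivative_prod d)
  moreover have "(\<Sum>p | p permutes (UNIV :: 'n set). of_int (sign p) * (\<Sum>i\<in>UNIV. N $ i $ p i * (\<Prod>j\<in>UNIV - {i}. a 0 j (p j)))) = 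
      (\<Sum>p | p permutes (UNIV :: 'n set). if p = id then trace N else 0)"
  proof (rule sum.cong)
    fix p :: "'n \<Rightarrow> 'n" assume "p \<in> {p. p permutes UNIV}"
    then have p: "p permutes UNIV" by simp
    show "of_int (sign p) * (\<Sum>i\<in>UNIV. N $ i $ p i * (\<Prod>j\<in>UNIV - {i}. a 0 j (p j))) = (if p = id then trace N else 0)"
    proof (cases "p = id")
      case True
      then show ?thesis by (simp add: a_def mat_def trace_def)
    next
      case False
      have z: "(\<Prod>j\<in>UNIV - {i}. a 0 j (p j)) = 0" for i
      proof (rule ccontr)
        assume "(\<Prod>j\<in>UNIV - {i}. a 0 j (p j)) \<noteq> 0"
        then have *: "p j = j" if "j \<noteq> i" for j
          using that by (auto simp: a_def mat_def split: if_splits)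
        have "p i = i"
          using *[of "p i"] p by (metis permutes_def)
        with * have "p = id" by (metis eq_id_iff)
        with False show False by simp
      qed
      show ?thesis unfolding z using False by simp
    qed
  qed simp
  moreover have "finite {p. p permutes (UNIV :: 'n set)}" by simp
  ultimately show ?thesis
    by (simp add: det_def a_def permutes_id)
qed

lemma integrable_gauss:
  assumes "0 < c" "\<And>y. c * norm y \<le> norm (S *v y)"
  shows "integrable lborel (gauss S \<nu>)"
proof (rule Bochner_Integration.integrable_bound)
  show "integrable lborel (\<lambda>y :: real ^ 'n. exp ((norm \<nu>)\<^sup>2 / 2) * exp (- (c\<^sup>2 / 4 * (norm y)\<^sup>2)))"
    using integrable_exp_neg_norm_square[of "c\<^sup>2 / 4", where 'n = 'n] assms by simp
  show "AE y in lborel. norm (gauss S \<nu> y) \<le> norm (exp ((norm \<nu>)\<^sup>2 / 2) * exp (- (c\<^sup>2 / 4 * (norm y)\<^sup>2)))"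
    using gauss_le[OF assms(2), of \<nu>] assms(1) by (intro AE_I2) (auto simp: gauss_nonneg)
qed measurable

lemma integrable_indicator_gauss:
  assumes "0 < c" "\<And>y. c * norm y \<le> norm (S *v y)" "C \<in> sets borel"
  shows "integrable lborel (\<lambda>y. indicator C y * gauss S \<nu> y)"
  using integrable_real_mult_indicator[OF _ integrable_gauss[OF assms(1,2)], of C \<nu>] assms(3)
  by (simp add: mult.commute)

lemma gauss_compose: "gauss S \<nu> (L *v y) = gauss (S ** L) \<nu> y"
  by (simp add: gauss_def matrix_vector_mul_assoc)

lemma matrix_add_mult_distrib_left: "(S :: real ^ 'n ^ 'm) ** (A + B) = S ** A + S ** (B :: real ^ 'p ^ 'n)"
  by (simp add: matrix_matrix_mult_def vec_eq_iff distrib_left sum.distrib)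

lemma matrix_mult_scaleR_right: "(S :: real ^ 'n ^ 'm) ** (c *\<^sub>R A) = c *\<^sub>R (S ** (A :: real ^ 'p ^ 'n))"
  by (simp add: matrix_matrix_mult_def vec_eq_iff sum_distrib_left mult_ac)

lemma eventually_det_near_identity_pos:
  fixes N K :: "real ^ 'n ^ 'n"
  shows "\<forall>\<^sub>F h in nhds 0. 0 < det (mat 1 + h *\<^sub>R N + h\<^sup>2 *\<^sub>R K)"
proof -
  define f where "f h = det (mat 1 + h *\<^sub>R N + h\<^sup>2 *\<^sub>R K)" for h
  have "isCont f 0"
    unfolding f_def by (rule DERIV_isCont[OF has_real_derivative_det_near_identity])
  then have "(f \<longlongrightarrow> f 0) (nhds 0)"
    unfolding isCont_def tendsto_at_iff_tendsto_nhds .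
  then have "\<forall>\<^sub>F h in nhds 0. 0 < f h" by (rule order_tendstoD) (simp add: f_def)
  then show ?thesis by (simp add: f_def)
qed

text \<open>
  The left-hand side is the Gaussian mass of the image of \<open>C\<close> under \<open>1 + h N + h\<^sup>2 K\<close>; pulled back to
  the fixed set \<open>C\<close>, its derivative consists of a Jacobian part and a density part, and depends on \<open>N\<close>
  only.
\<close>

lemma has_real_derivative_transported_gauss_integral:
  fixes S N K :: "real ^ 'n ^ 'n" and \<nu> :: "real ^ 'n" and C :: "(real ^ 'n) set"
  assumes c: "0 < c" "\<And>y. c * norm y \<le> norm (S *v y)" and C: "C \<in> sets borel"
  defines "L \<equiv> \<lambda>h. mat 1 + h *\<^sub>R N + h\<^sup>2 *\<^sub>R K"
  shows "((\<lambda>h. \<bar>det (L h)\<bar> * (\<integral>y. indicator C y * gauss S \<nu> (L h *v y) \<partial>lborel)) has_real_derivative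
           trace N * (\<integral>y. indicator C y * gauss S \<nu> y \<partial>lborel) -
           (\<integral>y. indicator C y * ((S *v y - \<nu>) \<bullet> (S *v (N *v y))) * gauss S \<nu> y \<partial>lborel)) (at 0)"
proof -
  have SL: "S ** L h = S + h *\<^sub>R (S ** N) + h\<^sup>2 *\<^sub>R (S ** K)" for h
    by (simp add: L_def matrix_add_mult_distrib_left matrix_mult_scaleR_right)
  have "((\<lambda>h. det (L h) * (\<integral>y. indicator C y * gauss (S + h *\<^sub>R (S ** N) + h\<^sup>2 *\<^sub>R (S ** K)) \<nu> y \<partial>lborel)) has_real_derivative
      trace N * (\<integral>y. indicator C y * gauss (S + 0 *\<^sub>R (S ** N) + 0\<^sup>2 *\<^sub>R (S ** K)) \<nu> y \<partial>lborel) +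
      (\<integral>y. - (indicator C y * ((S *v y - \<nu>) \<bullet> ((S ** N) *v y)) * gauss S \<nu> y) \<partial>lborel) * det (L 0)) (at 0)"
    unfolding L_def
    by (intro DERIV_mult has_real_derivative_det_near_identity has_real_derivative_gauss_integral[OF c C])
  moreover have "\<forall>\<^sub>F h in nhds 0. det (L h) = \<bar>det (L h)\<bar>"
    using eventually_det_near_identity_pos[of N K] unfolding L_def by eventually_elim simp
  then have "\<forall>\<^sub>F h in nhds 0. det (L h) * (\<integral>y. indicator C y * gauss (S + h *\<^sub>R (S ** N) + h\<^sup>2 *\<^sub>R (S ** K)) \<nu> y \<partial>lborel)
      = \<bar>det (L h)\<bar> * (\<integral>y. indicator C y * gauss S \<nu> (L h *v y) \<partial>lborel)"
    by eventually_elim (simp add: gauss_compose SL)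
  ultimately have "((\<lambda>h. \<bar>det (L h)\<bar> * (\<integral>y. indicator C y * gauss S \<nu> (L h *v y) \<partial>lborel)) has_real_derivative
      trace N * (\<integral>y. indicator C y * gauss (S + 0 *\<^sub>R (S ** N) + 0\<^sup>2 *\<^sub>R (S ** K)) \<nu> y \<partial>lborel) +
      (\<integral>y. - (indicator C y * ((S *v y - \<nu>) \<bullet> ((S ** N) *v y)) * gauss S \<nu> y) \<partial>lborel) * det (L 0)) (at 0)"
    by (subst (asm) DERIV_cong_ev[OF refl _ refl]) auto
  then show ?thesis by (simp add: L_def matrix_vector_mul_assoc)
qed

lemma has_real_derivative_sandwich:
  fixes f l u :: "real \<Rightarrow> real"
  assumes l: "(l has_real_derivative D) (at a)" and u: "(u has_real_derivative D) (at a)"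
    and eq: "l a = f a" "u a = f a"
    and le: "\<forall>\<^sub>F x in at a. l x \<le> f x \<and> f x \<le> u x"
  shows "(f has_real_derivative D) (at a)"
proof -
  let ?q = "\<lambda>g x. (g x - g a) / (x - a) - D"
  have 0: "((\<lambda>x. \<bar>?q l x\<bar> + \<bar>?q u x\<bar>) \<longlongrightarrow> 0) (at a)"
    using tendsto_add[OF tendsto_rabs[OF LIM_zero[OF l[unfolded has_field_derivative_iff]]]
        tendsto_rabs[OF LIM_zero[OF u[unfolded has_field_derivative_iff]]]] by simp
  have "(?q f \<longlongrightarrow> 0) (at a)"
  proof (rule Lim_null_comparison[OF _ 0])
    show "\<forall>\<^sub>F x in at a. norm (?q f x) \<le> \<bar>?q l x\<bar> + \<bar>?q u x\<bar>"
      using le eventually_neq_at_within[of a a UNIV]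
    proof eventually_elim
      case (elim x)
      show ?case
      proof (cases "x > a")
        case True
        then have "(l x - l a) / (x - a) \<le> (f x - f a) / (x - a)" "(f x - f a) / (x - a) \<le> (u x - u a) / (x - a)"
          using elim eq by (auto intro!: divide_right_mono)
        then show ?thesis unfolding real_norm_def by linarith
      next
        case False
        then have "(u x - u a) / (x - a) \<le> (f x - f a) / (x - a)" "(f x - f a) / (x - a) \<le> (l x - l a) / (x - a)"
          using elim eq by (auto intro!: divide_right_mono_neg)
        then show ?thesis unfolding real_norm_def by linarith
      qed
    qed
  qed
  then show ?thesis by (simp add: has_field_derivative_iff LIM_zero_iff)
qed

section \<open>The Gaussian mass of a moving cone\<close>

definition lorentz_mat :: "'n \<Rightarrow> real ^ 'n ^ 'n" where
  "lorentz_mat k = diag_mat (\<chi> i. if i = k then 1 else - 1)"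

definition light_cone :: "'n \<Rightarrow> (real ^ 'n) set" where
  "light_cone k = {y. (\<Sum>i\<in>UNIV - {k}. (y $ i)\<^sup>2) < (y $ k)\<^sup>2}"

lemma diag_mat_mult_vec [simp]: "(diag_mat d *v y) $ i = d $ i * y $ i"
  by (simp add: diag_mat_def matrix_vector_mult_def if_distrib[of "\<lambda>u. u * _"] cong: if_cong)

lemma lorentz_mat_mult_vec: "(lorentz_mat k *v y) $ i = (if i = k then y $ i else - y $ i)"
  by (simp add: lorentz_mat_def)

lemma lorentz_mat_involution [simp]: "lorentz_mat k *v (lorentz_mat k *v y) = y"
  by (simp add: vec_eq_iff lorentz_mat_mult_vec)

lemma inner_lorentz_mat: "x \<bullet> (lorentz_mat k *v y) = (lorentz_mat k *v x) \<bullet> y"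
  unfolding inner_vec_def by (rule sum.cong) (auto simp: lorentz_mat_mult_vec)

lemma norm_lorentz_mat [simp]: "norm (lorentz_mat k *v y) = norm y"
  by (simp add: norm_eq_sqrt_inner inner_lorentz_mat)

lemma light_cone_eq: "light_cone k = {y :: real ^ 'n. 0 < y \<bullet> (lorentz_mat k *v y)}"
proof -
  have "y \<bullet> (lorentz_mat k *v y) = (y $ k)\<^sup>2 - (\<Sum>i\<in>UNIV - {k}. (y $ i)\<^sup>2)" for y :: "real ^ 'n"
    unfolding inner_vec_def
    by (subst sum.remove[of _ k]) (auto simp: lorentz_mat_mult_vec power2_eq_square sum_negf intro!: sum.cong)
  then show ?thesis by (auto simp: light_cone_def)
qed

lemma sets_quadratic_region [measurable]: "{y :: real ^ 'n. 0 < y \<bullet> (Q *v y)} \<in> sets borel"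
proof -
  have "{y \<in> space borel. 0 < y \<bullet> (Q *v y)} \<in> sets borel" by measurable
  then show ?thesis by simp
qed

lemma sets_light_cone [measurable]: "light_cone k \<in> sets borel"
  unfolding light_cone_eq by measurable

text \<open>
  With \<open>N = J G / 2\<close> the first-order terms of \<open>(1 + h N)\<^sup>T (J - h G) (1 + h N)\<close> cancel, because \<open>J\<^sup>2 = 1\<close>.
  The correction \<open>\<sigma> c h\<^sup>2 J\<close> adds \<open>2 \<sigma> c h\<^sup>2 \<bar>x\<bar>\<^sup>2\<close>, which for large \<open>c\<close> dominates the error of order \<open>h\<^sup>2\<close>
  and decides its sign.  Hence for \<open>\<sigma> = 1\<close> the image of the light cone lies inside the cone of \<open>J - h G\<close>,
  and for \<open>\<sigma> = - 1\<close> it contains that cone.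
\<close>

lemma transported_cone_perturbation:
  fixes G :: "real ^ 'n ^ 'n" and k :: 'n
  assumes G: "transpose G = G"
  defines "J \<equiv> lorentz_mat k :: real ^ 'n ^ 'n"
  obtains c \<eta> :: real where "0 < \<eta>"
    "\<And>h x \<sigma>. \<bar>h\<bar> < \<eta> \<Longrightarrow> \<bar>\<sigma>\<bar> = 1 \<Longrightarrow>
       (let Lx = (mat 1 + h *\<^sub>R ((1 / 2) *\<^sub>R (J ** G)) + h\<^sup>2 *\<^sub>R ((\<sigma> * c) *\<^sub>R J)) *v x
        in 0 \<le> \<sigma> * (Lx \<bullet> ((J - h *\<^sub>R G) *v Lx) - x \<bullet> (J *v x)))"
proof -
  obtain g where g: "0 < g" "\<And>y. norm (G *v y) \<le> g * norm y" by (rule matrix_vector_mult_norm_le[of G]) blast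
  \<comment> \<open>\<open>b\<close> bounds the displacement \<open>u\<close> relative to \<open>x\<close>, and \<open>c\<close> collects the three error terms bounded below\<close>
  define b where "b = g / 2 + 1"
  define c where "c = b * b + 2 * (g * b) + g * (b * b)"
  define \<eta> where "\<eta> = min 1 (1 / c)"
  have b: "0 < b" using g by (simp add: b_def)
  have c: "0 < c" using g b by (auto simp: c_def intro!: add_pos_pos)
  have \<eta>: "0 < \<eta>" "\<eta> \<le> 1" "\<eta> \<le> 1 / c" using c by (auto simp: \<eta>_def)
  have Gsym: "x \<bullet> (G *v y) = (G *v x) \<bullet> y" for x y
    using dot_lmul_matrix[of x G y] transpose_matrix_vector[of G x] by (simp add: G)
  show thesis
  proof (rule that[OF \<eta>(1), of c], unfold Let_def)
    fix h \<sigma> :: real and x :: "real ^ 'n"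
    assume h: "\<bar>h\<bar> < \<eta>" and \<sigma>: "\<bar>\<sigma>\<bar> = 1"
    define p where "p = (1 / 2) *\<^sub>R (J *v (G *v x))"
    define u where "u = p + (h * (\<sigma> * c)) *\<^sub>R (J *v x)"
    have Lx: "(mat 1 + h *\<^sub>R ((1 / 2) *\<^sub>R (J ** G)) + h\<^sup>2 *\<^sub>R ((\<sigma> * c) *\<^sub>R J)) *v x = x + h *\<^sub>R u"
      by (simp add: u_def p_def matrix_vector_mult_add_rdistrib scaleR_matrix_vector_assoc[symmetric]
          matrix_vector_mul_assoc[symmetric] scaleR_add_right power2_eq_square)
    have Jxu: "x \<bullet> (J *v u) = 1 / 2 * (x \<bullet> (G *v x)) + h * (\<sigma> * c) * (norm x)\<^sup>2"
      by (simp add: u_def p_def J_def matrix_vector_right_distrib inner_add_right power2_norm_eq_inner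
          matrix_vector_mult_scaleR)
    have Jux: "u \<bullet> (J *v x) = x \<bullet> (J *v u)"
      unfolding J_def by (metis inner_lorentz_mat inner_commute)
    have Gux: "u \<bullet> (G *v x) = x \<bullet> (G *v u)"
      by (metis Gsym inner_commute)
    define e where "e = u \<bullet> (J *v u) - 2 * (x \<bullet> (G *v u)) - h * (u \<bullet> (G *v u))"
    have q: "(x + h *\<^sub>R u) \<bullet> ((J - h *\<^sub>R G) *v (x + h *\<^sub>R u)) - x \<bullet> (J *v x) = h\<^sup>2 * (2 * \<sigma> * c * (norm x)\<^sup>2 + e)"
    proof -
      have "(x + h *\<^sub>R u) \<bullet> (M *v (x + h *\<^sub>R u)) =
          x \<bullet> (M *v x) + h * (x \<bullet> (M *v u)) + h * (u \<bullet> (M *v x)) + h\<^sup>2 * (u \<bullet> (M *v u))" for M :: "real ^ 'n ^ 'n"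
        unfolding matrix_vector_right_distrib matrix_vector_mult_scaleR inner_add_left inner_add_right
          inner_scaleR_left inner_scaleR_right by (simp add: power2_eq_square algebra_simps)
      from this[of J] this[of G] show ?thesis
        unfolding matrix_vector_mult_diff_rdistrib scaleR_matrix_vector_assoc[symmetric] inner_diff_right
          inner_scaleR_right Jux Gux Jxu e_def
        by algebra
    qed
    have nu: "norm u \<le> b * norm x"
    proof -
      have "norm u \<le> norm p + norm ((h * (\<sigma> * c)) *\<^sub>R (J *v x))"
        unfolding u_def by (rule norm_triangle_ineq)
      also have "\<dots> \<le> g / 2 * norm x + 1 * norm x"
      proof (rule add_mono)
        show "norm p \<le> g / 2 * norm x" using g(2)[of x] by (simp add: p_def J_def)
        have "\<bar>h\<bar> * c \<le> 1 / c * c" using h \<eta> c by (intro mult_right_mono) auto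
        then have "\<bar>h\<bar> * c \<le> 1" using c by simp
        then show "norm ((h * (\<sigma> * c)) *\<^sub>R (J *v x)) \<le> 1 * norm x"
          using c \<sigma> by (simp add: abs_mult J_def mult_right_le_one_le mult_left_le_one_le)
      qed
      finally show ?thesis by (simp add: b_def algebra_simps)
    qed
    have nn: "norm x * norm x \<ge> 0" by simp
    have e1: "\<bar>u \<bullet> (J *v u)\<bar> \<le> b * b * (norm x)\<^sup>2"
    proof -
      have "\<bar>u \<bullet> (J *v u)\<bar> \<le> norm u * norm u"
        using Cauchy_Schwarz_ineq2[of u "J *v u"] by (simp add: J_def)
      also have "\<dots> \<le> (b * norm x) * (b * norm x)" using nu b by (intro mult_mono) auto
      finally show ?thesis by (simp add: power2_eq_square mult_ac)
    qed
    have Gu: "norm (G *v u) \<le> g * (b * norm x)"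
      using g nu by (meson mult_left_mono order_trans less_imp_le)
    have e2: "\<bar>x \<bullet> (G *v u)\<bar> \<le> g * b * (norm x)\<^sup>2"
    proof -
      have "\<bar>x \<bullet> (G *v u)\<bar> \<le> norm x * norm (G *v u)" by (rule Cauchy_Schwarz_ineq2)
      also have "\<dots> \<le> norm x * (g * (b * norm x))" by (intro mult_left_mono Gu) auto
      finally show ?thesis by (simp add: power2_eq_square mult_ac)
    qed
    have e3: "\<bar>h * (u \<bullet> (G *v u))\<bar> \<le> g * (b * b) * (norm x)\<^sup>2"
    proof -
      have "\<bar>h * (u \<bullet> (G *v u))\<bar> \<le> 1 * (norm u * norm (G *v u))"
        unfolding abs_mult using h \<eta> by (intro mult_mono Cauchy_Schwarz_ineq2) auto
      also have "\<dots> \<le> 1 * ((b * norm x) * (g * (b * norm x)))"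
        using nu Gu b by (intro mult_mono) auto
      finally show ?thesis by (simp add: power2_eq_square mult_ac)
    qed
    have e: "\<bar>e\<bar> \<le> c * (norm x)\<^sup>2"
      using e1 e2 e3 unfolding e_def c_def by (simp add: distrib_right)
    have "\<sigma> = 1 \<or> \<sigma> = - 1" using \<sigma> by auto
    then have "0 \<le> \<sigma> * (2 * \<sigma> * c * (norm x)\<^sup>2 + e)"
      using e c mult_nonneg_nonneg[of c "(norm x)\<^sup>2"] by (auto simp: abs_le_iff)
    then have "0 \<le> h\<^sup>2 * (\<sigma> * (2 * \<sigma> * c * (norm x)\<^sup>2 + e))" by simp
    then show "0 \<le> \<sigma> *
        (((mat 1 + h *\<^sub>R ((1 / 2) *\<^sub>R (J ** G)) + h\<^sup>2 *\<^sub>R ((\<sigma> * c) *\<^sub>R J)) *v x) \<bullet>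
          ((J - h *\<^sub>R G) *v ((mat 1 + h *\<^sub>R ((1 / 2) *\<^sub>R (J ** G)) + h\<^sup>2 *\<^sub>R ((\<sigma> * c) *\<^sub>R J)) *v x)) -
          x \<bullet> (J *v x))"
      unfolding Lx q by (simp add: mult_ac)
  qed
qed

text \<open>
  The masses of the two linear images of the light cone enclose the mass of the moving cone, and their
  derivatives agree since they depend on the first-order part of the map only.
\<close>

proposition has_real_derivative_gauss_cone:
  fixes S G :: "real ^ 'n ^ 'n" and \<nu> :: "real ^ 'n" and k :: 'n
  assumes c: "0 < c" "\<And>y. c * norm y \<le> norm (S *v y)" and G: "transpose G = G"
  defines "N \<equiv> (1 / 2) *\<^sub>R (lorentz_mat k ** G)"
  shows "((\<lambda>h. \<integral>y. indicator {y. 0 < y \<bullet> ((lorentz_mat k - h *\<^sub>R G) *v y)} y * gauss S \<nu> y \<partial>lborel) has_real_derivative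
           trace N * (\<integral>y. indicator (light_cone k) y * gauss S \<nu> y \<partial>lborel) -
           (\<integral>y. indicator (light_cone k) y * ((S *v y - \<nu>) \<bullet> (S *v (N *v y))) * gauss S \<nu> y \<partial>lborel)) (at 0)"
    (is "(?F has_real_derivative ?D) (at 0)")
proof -
  let ?J = "lorentz_mat k :: real ^ 'n ^ 'n"
  obtain c' \<eta> where \<eta>: "0 < \<eta>" and pert: "\<And>h x \<sigma>. \<bar>h\<bar> < \<eta> \<Longrightarrow> \<bar>\<sigma>\<bar> = 1 \<Longrightarrow>
       (let Lx = (mat 1 + h *\<^sub>R ((1 / 2) *\<^sub>R (?J ** G)) + h\<^sup>2 *\<^sub>R ((\<sigma> * c') *\<^sub>R ?J)) *v x
        in 0 \<le> \<sigma> * (Lx \<bullet> ((?J - h *\<^sub>R G) *v Lx) - x \<bullet> (?J *v x)))"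
    by (rule transported_cone_perturbation[OF G]) blast
  define L where "L \<sigma> h = mat 1 + h *\<^sub>R N + h\<^sup>2 *\<^sub>R ((\<sigma> * c') *\<^sub>R ?J)" for \<sigma> h
  define \<Phi> where "\<Phi> \<sigma> h = \<bar>det (L \<sigma> h)\<bar> * (\<integral>y. indicator (light_cone k) y * gauss S \<nu> (L \<sigma> h *v y) \<partial>lborel)" for \<sigma> h
  have d: "(\<Phi> \<sigma> has_real_derivative ?D) (at 0)" for \<sigma>
    unfolding \<Phi>_def L_def by (rule has_real_derivative_transported_gauss_integral[OF c]) measurable
  let ?A = "\<lambda>h. {y :: real ^ 'n. 0 < y \<bullet> ((?J - h *\<^sub>R G) *v y)}"
  have F: "?F h = \<bar>det (L \<sigma> h)\<bar> * (\<integral>y. indicator (?A h) (L \<sigma> h *v y) * gauss S \<nu> (L \<sigma> h *v y) \<partial>lborel)"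
    if "det (L \<sigma> h) \<noteq> 0" for h \<sigma>
    by (rule integral_linear_change(2)) (use that in measurable)
  have i1: "integrable lborel (\<lambda>y. indicator (light_cone k) y * gauss S \<nu> (L \<sigma> h *v y))"
    if "det (L \<sigma> h) \<noteq> 0" for h \<sigma>
  proof -
    have "integrable lborel (\<lambda>y. gauss S \<nu> (L \<sigma> h *v y))"
      using integral_linear_change(1)[OF borel_measurable_gauss that] integrable_gauss[OF c] by simp
    from integrable_real_mult_indicator[OF _ this, of "light_cone k"] show ?thesis
      by (simp add: mult.commute)
  qed
  have i2: "integrable lborel (\<lambda>y. indicator (?A h) (L \<sigma> h *v y) * gauss S \<nu> (L \<sigma> h *v y))"
    if "det (L \<sigma> h) \<noteq> 0" for h \<sigma>
    using integrable_indicator_gauss[OF c, of "?A h" \<nu>] that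
    by (subst integral_linear_change(1)[of "\<lambda>y. indicator (?A h) y * gauss S \<nu> y"]) auto
  have ev: "\<forall>\<^sub>F h in at 0. det (L \<sigma> h) \<noteq> 0" for \<sigma>
    using eventually_det_near_identity_pos[of N "(\<sigma> * c') *\<^sub>R ?J"]
    unfolding eventually_at_filter L_def by eventually_elim auto
  have ev\<eta>: "\<forall>\<^sub>F h :: real in at 0. \<bar>h\<bar> < \<eta>"
    using \<eta> by (auto simp: eventually_at dist_real_def)
  show ?thesis
  proof (rule has_real_derivative_sandwich[OF d[of 1] d[of "-1"]])
    have "L \<sigma> 0 = mat 1" for \<sigma> by (simp add: L_def)
    then have "\<Phi> \<sigma> 0 = ?F 0" for \<sigma>
      by (simp add: \<Phi>_def light_cone_eq)
    then show "\<Phi> 1 0 = ?F 0" "\<Phi> (- 1) 0 = ?F 0" by blast+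
    show "\<forall>\<^sub>F h in at 0. \<Phi> 1 h \<le> ?F h \<and> ?F h \<le> \<Phi> (- 1) h"
      using ev[of 1] ev[of "-1"] ev\<eta>
    proof eventually_elim
      case (elim h)
      have "indicator (light_cone k) y * gauss S \<nu> (L 1 h *v y) \<le> indicator (?A h) (L 1 h *v y) * gauss S \<nu> (L 1 h *v y)" for y
        using pert[OF elim(3), of 1 y]
        by (auto simp: indicator_def gauss_nonneg light_cone_eq L_def N_def Let_def)
      then have 1: "\<Phi> 1 h \<le> ?F h"
        unfolding F[OF elim(1)] \<Phi>_def using elim
        by (intro mult_left_mono integral_mono i1 i2) auto
      have "indicator (?A h) (L (-1) h *v y) * gauss S \<nu> (L (-1) h *v y) \<le> indicator (light_cone k) y * gauss S \<nu> (L (-1) h *v y)" for y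
        using pert[OF elim(3), of "-1" y]
        by (auto simp: indicator_def gauss_nonneg light_cone_eq L_def N_def Let_def)
      then have 2: "?F h \<le> \<Phi> (-1) h"
        unfolding F[OF elim(2)] \<Phi>_def using elim
        by (intro mult_left_mono integral_mono i1 i2) auto
      from 1 2 show ?case ..
    qed
  qed
qed

text \<open>
  For \<open>G = 2 J\<close> the moving cone is \<open>0 < (1 - 2 h) (y \<bullet> J y)\<close>, which does not move at all.  The derivative
  of its mass is therefore \<open>0\<close>, while the matrix \<open>N\<close> of the derivative formula is the identity.
\<close>

corollary gauss_cone_scaling_identity:
  fixes S :: "real ^ 'n ^ 'n" and \<nu> :: "real ^ 'n"
  assumes c: "0 < c" "\<And>y. c * norm y \<le> norm (S *v y)"
  shows "(\<integral>y. indicator (light_cone k) y * ((S *v y - \<nu>) \<bullet> (S *v y)) * gauss S \<nu> y \<partial>lborel) =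
    real CARD('n) * (\<integral>y. indicator (light_cone k) y * gauss S \<nu> y \<partial>lborel)"
proof -
  let ?J = "lorentz_mat k :: real ^ 'n ^ 'n"
  have JJ: "?J ** ?J = mat 1"
    by (simp add: matrix_eq matrix_vector_mul_assoc[symmetric])
  have T: "transpose (2 *\<^sub>R ?J) = 2 *\<^sub>R ?J"
    by (auto simp: transpose_def vec_eq_iff lorentz_mat_def diag_mat_def)
  have N: "(1 / 2) *\<^sub>R (?J ** (2 *\<^sub>R ?J)) = mat 1"
    by (simp add: matrix_mult_scaleR_right JJ)
  have tr: "trace (mat 1 :: real ^ 'n ^ 'n) = real CARD('n)"
    by (simp add: trace_def mat_def)
  let ?I = "\<integral>y. indicator (light_cone k) y * gauss S \<nu> y \<partial>lborel"
  let ?F = "\<lambda>h. \<integral>y. indicator {y. 0 < y \<bullet> ((?J - h *\<^sub>R (2 *\<^sub>R ?J)) *v y)} y * gauss S \<nu> y \<partial>lborel"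
  have d: "(?F has_real_derivative real CARD('n) * ?I -
      (\<integral>y. indicator (light_cone k) y * ((S *v y - \<nu>) \<bullet> (S *v y)) * gauss S \<nu> y \<partial>lborel)) (at 0)"
    using has_real_derivative_gauss_cone[OF c T, of k \<nu>] unfolding N tr by simp
  have ev: "\<forall>\<^sub>F h :: real in nhds 0. h < 1 / 2"
    by (rule eventually_nhds_in_open[of "{..< 1/2}", simplified]) auto
  have "?F h = ?I" if "h < 1 / 2" for h
  proof -
    have "y \<bullet> ((?J - h *\<^sub>R (2 *\<^sub>R ?J)) *v y) = (1 - 2 * h) * (y \<bullet> (?J *v y))" for y
      by (simp add: matrix_vector_mult_diff_rdistrib scaleR_matrix_vector_assoc[symmetric] inner_diff_right algebra_simps)
    then have "{y. 0 < y \<bullet> ((?J - h *\<^sub>R (2 *\<^sub>R ?J)) *v y)} = light_cone k"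
      using that by (auto simp: light_cone_eq zero_less_mult_iff)
    then show ?thesis by simp
  qed
  with ev have "\<forall>\<^sub>F h in nhds 0. ?F h = ?I" by (auto elim: eventually_mono)
  then have "(?F has_real_derivative 0) (at 0)"
    by (subst DERIV_cong_ev[OF refl _ refl]) auto
  from DERIV_unique[OF d this] show ?thesis by simp
qed

section \<open>Gaussian masses of the cone under degenerate scaling\<close>

text \<open>
  Covers the finite and the infinite edge at once, so that convergence theorems for sequences apply.
\<close>

lemma at_edge_tendsto_sequentiallyI:
  fixes f :: "real \<Rightarrow> 'a :: first_countable_topology"
  assumes "\<And>X. filterlim X (at_edge \<rho>) sequentially \<Longrightarrow> (\<lambda>m. f (X m)) \<longlonglongrightarrow> L"
  shows "(f \<longlongrightarrow> L) (at_edge \<rho>)"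
proof (cases "\<rho> = \<infinity>")
  case True
  then show ?thesis
    using assms by (auto simp: at_edge_def intro!: tendsto_at_topI_sequentially)
next
  case False
  let ?a = "real_of_ereal \<rho>"
  show ?thesis
    using False unfolding at_edge_def
  proof (simp, unfold tendsto_at_iff_sequentially, intro allI impI)
    fix X :: "nat \<Rightarrow> real"
    assume X: "\<forall>i. X i \<in> {..<?a} - {?a}" "X \<longlonglongrightarrow> ?a"
    then have "filterlim X (at_left ?a) sequentially"
      unfolding filterlim_at by (auto intro!: always_eventually simp: less_le)
    with False show "(f \<circ> X) \<longlonglongrightarrow> L"
      using assms[of X] by (simp add: at_edge_def comp_def)
  qed
qed

lemma integral_tendsto_dominated_at_edge:
  fixes f :: "real \<Rightarrow> 'a \<Rightarrow> real"
  assumes lim: "\<And>x. x \<in> space M \<Longrightarrow> ((\<lambda>r. f r x) \<longlongrightarrow> g x) (at_edge \<rho>)"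
    and bound: "\<forall>\<^sub>F r in at_edge \<rho>. \<forall>x\<in>space M. \<bar>f r x\<bar> \<le> w x"
    and meas: "\<And>r. f r \<in> borel_measurable M" "g \<in> borel_measurable M"
    and w: "integrable M w"
  shows "((\<lambda>r. \<integral>x. f r x \<partial>M) \<longlongrightarrow> (\<integral>x. g x \<partial>M)) (at_edge \<rho>)"
proof (rule at_edge_tendsto_sequentiallyI)
  fix X assume X: "filterlim X (at_edge \<rho>) sequentially"
  from eventually_compose_filterlim[OF bound X]
  obtain N where N: "\<And>m. N \<le> m \<Longrightarrow> \<forall>x\<in>space M. \<bar>f (X m) x\<bar> \<le> w x"
    by (auto simp: eventually_sequentially)
  show "(\<lambda>m. \<integral>x. f (X m) x \<partial>M) \<longlonglongrightarrow> (\<integral>x. g x \<partial>M)"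
  proof (rule LIMSEQ_offset, rule integral_dominated_convergence)
    show "AE x in M. (\<lambda>m. f (X (m + N)) x) \<longlonglongrightarrow> g x"
    proof (rule AE_I2)
      fix x assume "x \<in> space M"
      from filterlim_compose[OF lim[OF this] X]
      show "(\<lambda>m. f (X (m + N)) x) \<longlonglongrightarrow> g x"
        by (rule LIMSEQ_ignore_initial_segment)
    qed
    show "AE x in M. norm (f (X (m + N)) x) \<le> w x" for m
      using N[of "m + N"] by auto
  qed (use meas w in auto)
qed

lemma norm_vec_sum: "(norm (y :: real ^ 'n))\<^sup>2 = (\<Sum>i\<in>UNIV. (y $ i)\<^sup>2)"
  by (simp add: norm_vec_def L2_set_def sum_nonneg)

lemma measurable_vec_component [measurable]:
  "(\<lambda>y :: real ^ 'n. y $ i) \<in> borel_measurable borel"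
  by (intro borel_measurable_continuous_onI continuous_intros)

definition coordinate_reflection :: "'n \<Rightarrow> real ^ 'n ^ 'n" where
  "coordinate_reflection i = diag_mat (\<chi> j. if j = i then - 1 else 1)"

lemma coordinate_reflection_nth [simp]:
  "(coordinate_reflection i *v y) $ j = (if j = i then - y $ j else y $ j)"
  by (simp add: coordinate_reflection_def)

lemma norm_coordinate_reflection [simp]: "norm (coordinate_reflection i *v y) = norm y"
  by (rule power2_eq_imp_eq) (auto simp: norm_vec_sum intro!: sum.cong)

lemma integral_coordinate_reflection:
  fixes f :: "real ^ 'n \<Rightarrow> real"
  assumes "f \<in> borel_measurable borel"
  shows "(\<integral>y. f y \<partial>lborel) = (\<integral>y. f (coordinate_reflection i *v y) \<partial>lborel)"
proof -
  have "det (coordinate_reflection i :: real ^ 'n ^ 'n) = (\<Prod>j\<in>UNIV. if j = i then - 1 else 1)"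
    unfolding coordinate_reflection_def by (subst det_diagonal) (auto simp: diag_mat_def)
  then have "det (coordinate_reflection i :: real ^ 'n ^ 'n) = - 1" by simp
  then show ?thesis using integral_linear_change(2)[OF assms, of "coordinate_reflection i"] by simp
qed

lemma coordinate_reflection_light_cone: "coordinate_reflection i *v y \<in> light_cone k \<longleftrightarrow> y \<in> light_cone k"
proof -
  have "(\<Sum>j\<in>UNIV - {k}. ((coordinate_reflection i *v y) $ j)\<^sup>2) = (\<Sum>j\<in>UNIV - {k}. (y $ j)\<^sup>2)"
    by (rule sum.cong) auto
  then show ?thesis by (simp add: light_cone_def)
qed

lemma diag_mat_coercive:
  fixes s :: "real ^ 'n"
  assumes "\<And>i. 0 < s $ i"
  obtains c where "0 < c" "\<And>y. c * norm y \<le> norm (diag_mat s *v y)"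
proof
  define c where "c = Min (range (\<lambda>i. s $ i))"
  show c0: "0 < c" using assms by (simp add: c_def)
  have c: "c \<le> s $ i" for i by (simp add: c_def)
  fix y :: "real ^ 'n"
  have "(c * norm y)\<^sup>2 = (\<Sum>i\<in>UNIV. c\<^sup>2 * (y $ i)\<^sup>2)"
    by (simp add: power_mult_distrib norm_vec_sum sum_distrib_left)
  also have "\<dots> \<le> (\<Sum>i\<in>UNIV. (s $ i)\<^sup>2 * (y $ i)\<^sup>2)"
    using c c0 by (intro sum_mono mult_right_mono power_mono) auto
  also have "\<dots> = (norm (diag_mat s *v y))\<^sup>2"
    by (simp add: norm_vec_sum power_mult_distrib)
  finally show "c * norm y \<le> norm (diag_mat s *v y)"
    by (rule power2_le_imp_le) simp
qed

lemma integrable_weighted_gauss: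
  assumes c: "0 < c" "\<And>y. c * norm y \<le> norm (S *v y)" and C[measurable]: "C \<in> sets borel"
    and w[measurable]: "w \<in> borel_measurable borel" and K: "\<And>y. \<bar>w y\<bar> \<le> K * (1 + norm y)\<^sup>2"
  shows "integrable lborel (\<lambda>y :: real ^ 'n. indicator C y * w y * gauss S \<nu> y)"
proof (rule Bochner_Integration.integrable_bound)
  show "integrable lborel (\<lambda>y :: real ^ 'n. (K * exp ((norm \<nu>)\<^sup>2 / 2)) * ((1 + norm y)\<^sup>2 * exp (- (c\<^sup>2 / 4 * (norm y)\<^sup>2))))"
    using integrable_one_plus_norm_square_exp[of "c\<^sup>2 / 4", where 'n = 'n] c by (intro integrable_mult_right) auto
  show "AE y in lborel. norm (indicator C y * w y * gauss S \<nu> y) \<le>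
      norm ((K * exp ((norm \<nu>)\<^sup>2 / 2)) * ((1 + norm y)\<^sup>2 * exp (- (c\<^sup>2 / 4 * (norm y)\<^sup>2))))"
  proof (rule AE_I2)
    fix y :: "real ^ 'n"
    have "norm (indicator C y * w y * gauss S \<nu> y) \<le> \<bar>w y\<bar> * gauss S \<nu> y"
      by (auto simp: indicator_def abs_mult gauss_nonneg)
    also have "\<dots> \<le> (K * (1 + norm y)\<^sup>2) * (exp ((norm \<nu>)\<^sup>2 / 2) * exp (- (c\<^sup>2 / 4 * (norm y)\<^sup>2)))"
      using K[of y] gauss_le[OF c(2), of \<nu> y] c(1) abs_ge_zero[of "w y"]
      by (intro mult_mono) (auto simp: gauss_nonneg intro: order_trans)
    also have "\<dots> \<le> norm ((K * exp ((norm \<nu>)\<^sup>2 / 2)) * ((1 + norm y)\<^sup>2 * exp (- (c\<^sup>2 / 4 * (norm y)\<^sup>2))))"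
      by (simp add: mult_ac)
    finally show "norm (indicator C y * w y * gauss S \<nu> y) \<le>
      norm ((K * exp ((norm \<nu>)\<^sup>2 / 2)) * ((1 + norm y)\<^sup>2 * exp (- (c\<^sup>2 / 4 * (norm y)\<^sup>2))))" .
  qed
qed measurable

definition cone_gauss_mass :: "'n :: finite \<Rightarrow> real \<Rightarrow> real" where
  "cone_gauss_mass k a = (\<integral>y. indicator (light_cone k) y * exp (- (y $ k - a)\<^sup>2 / 2) \<partial>(lborel :: (real ^ 'n) measure))"

text \<open>
  On the cone the whole norm is controlled by the distinguished coordinate.  This keeps the Gaussian
  weights integrable when they lose their decay in all the other directions.
\<close>

lemma light_cone_norm_le:
  assumes "y \<in> light_cone k"
  shows "(norm y)\<^sup>2 \<le> 2 * (y $ k)\<^sup>2"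
  using assms by (simp add: light_cone_def norm_vec_sum sum.remove[of UNIV k])

text \<open>
  The factor on the left removes the part of the exponent that neither depends on \<open>y\<close> nor converges; what
  remains besides the one-dimensional weight tends to \<open>1\<close> when \<open>s $ i\<close> tends to \<open>0\<close> for all \<open>i \<noteq> k\<close>.
\<close>

lemma gauss_diag_mat_factor:
  fixes s \<nu> y :: "real ^ 'n"
  assumes "s $ k = 1"
  shows "exp ((\<Sum>i\<in>UNIV - {k}. (\<nu> $ i)\<^sup>2) / 2) * gauss (diag_mat s) \<nu> y =
    exp (- (y $ k - \<nu> $ k)\<^sup>2 / 2) *
    exp (- (\<Sum>i\<in>UNIV - {k}. (s $ i)\<^sup>2 * (y $ i)\<^sup>2 - 2 * (s $ i * \<nu> $ i * y $ i)) / 2)"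
proof -
  have "(norm (diag_mat s *v y - \<nu>))\<^sup>2 = (y $ k - \<nu> $ k)\<^sup>2 + (\<Sum>i\<in>UNIV - {k}. (s $ i * y $ i - \<nu> $ i)\<^sup>2)"
    by (simp add: norm_vec_sum sum.remove[of UNIV k] assms)
  moreover have "(\<Sum>i\<in>UNIV - {k}. (s $ i * y $ i - \<nu> $ i)\<^sup>2) =
      (\<Sum>i\<in>UNIV - {k}. (s $ i)\<^sup>2 * (y $ i)\<^sup>2 - 2 * (s $ i * \<nu> $ i * y $ i)) + (\<Sum>i\<in>UNIV - {k}. (\<nu> $ i)\<^sup>2)"
    unfolding sum.distrib[symmetric] by (rule sum.cong) (auto simp: power2_eq_square algebra_simps)
  ultimately show ?thesis
    unfolding gauss_def exp_add[symmetric] by (simp add: field_simps)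
qed

text \<open>
  The scales collapse in all directions except \<open>k\<close>, and of the mean vector only the component in
  direction \<open>k\<close> is assumed to converge; the others are merely bounded and are compensated by
  \<open>normalizer\<close>.
\<close>

locale cone_limit =
  fixes k :: "'n :: finite" and \<rho> :: ereal and s \<nu> :: "real \<Rightarrow> real ^ 'n" and B a :: real
  assumes s0: "\<And>i. i \<noteq> k \<Longrightarrow> ((\<lambda>r. s r $ i) \<longlongrightarrow> 0) (at_edge \<rho>)"
    and sk: "\<forall>\<^sub>F r in at_edge \<rho>. s r $ k = 1"
    and spos: "\<forall>\<^sub>F r in at_edge \<rho>. \<forall>i. 0 < s r $ i"
    and \<nu>B: "\<forall>\<^sub>F r in at_edge \<rho>. norm (\<nu> r) \<le> B"
    and \<nu>k: "((\<lambda>r. \<nu> r $ k) \<longlongrightarrow> a) (at_edge \<rho>)"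
begin

definition normalizer :: "real \<Rightarrow> real" where
  "normalizer r = exp ((\<Sum>i\<in>UNIV - {k}. (\<nu> r $ i)\<^sup>2) / 2)"

lemma normalizer_gauss_tendsto:
  "((\<lambda>r. normalizer r * gauss (diag_mat (s r)) (\<nu> r) y) \<longlongrightarrow> exp (- (y $ k - a)\<^sup>2 / 2)) (at_edge \<rho>)"
proof -
  have sn: "((\<lambda>r. s r $ i * \<nu> r $ i) \<longlongrightarrow> 0) (at_edge \<rho>)" if "i \<noteq> k" for i
  proof (rule Lim_null_comparison)
    show "\<forall>\<^sub>F r in at_edge \<rho>. norm (s r $ i * \<nu> r $ i) \<le> \<bar>s r $ i\<bar> * B"
      using \<nu>B
    proof eventually_elim
      case (elim r)
      have "\<bar>\<nu> r $ i\<bar> \<le> B" using component_le_norm_cart[of "\<nu> r" i] elim by linarith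
      then show ?case by (simp add: abs_mult mult_left_mono)
    qed
    show "((\<lambda>r. \<bar>s r $ i\<bar> * B) \<longlongrightarrow> 0) (at_edge \<rho>)"
      by (intro tendsto_mult_left_zero tendsto_rabs_zero s0 that)
  qed
  have "((\<lambda>r. exp (- (y $ k - \<nu> r $ k)\<^sup>2 / 2) *
      exp (- (\<Sum>i\<in>UNIV - {k}. (s r $ i)\<^sup>2 * (y $ i)\<^sup>2 - 2 * (s r $ i * \<nu> r $ i * y $ i)) / 2)) \<longlongrightarrow>
      exp (- (y $ k - a)\<^sup>2 / 2) * exp (- (\<Sum>i\<in>UNIV - {k}. 0\<^sup>2 * (y $ i)\<^sup>2 - 2 * (0 * y $ i)) / 2)) (at_edge \<rho>)"
    by (intro tendsto_intros \<nu>k s0 sn) auto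
  moreover have "\<forall>\<^sub>F r in at_edge \<rho>. exp (- (y $ k - \<nu> r $ k)\<^sup>2 / 2) *
      exp (- (\<Sum>i\<in>UNIV - {k}. (s r $ i)\<^sup>2 * (y $ i)\<^sup>2 - 2 * (s r $ i * \<nu> r $ i * y $ i)) / 2) =
      normalizer r * gauss (diag_mat (s r)) (\<nu> r) y"
    using sk by eventually_elim (simp add: normalizer_def gauss_diag_mat_factor)
  ultimately show ?thesis
    by (simp add: tendsto_cong)
qed

lemma normalizer_gauss_bound:
  "\<forall>\<^sub>F r in at_edge \<rho>. \<forall>y\<in>light_cone k.
     normalizer r * gauss (diag_mat (s r)) (\<nu> r) y \<le> exp (B\<^sup>2) * exp (- (1 / 8 * (norm y)\<^sup>2))"
  using sk \<nu>B
proof eventually_elim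
  case (elim r)
  show ?case
  proof
    fix y :: "real ^ 'n" assume y: "y \<in> light_cone k"
    have n: "(norm (\<nu> r))\<^sup>2 \<le> B\<^sup>2" using elim by (intro power_mono) auto
    have split: "(norm (\<nu> r))\<^sup>2 = (\<nu> r $ k)\<^sup>2 + (\<Sum>i\<in>UNIV - {k}. (\<nu> r $ i)\<^sup>2)"
      by (simp add: norm_vec_sum sum.remove[of UNIV k])
    have nk: "(\<nu> r $ k)\<^sup>2 \<le> B\<^sup>2"
      using n split sum_nonneg[of "UNIV - {k}" "\<lambda>i. (\<nu> r $ i)\<^sup>2"] by simp
    have "(y $ k - \<nu> r $ k)\<^sup>2 \<le> (norm (diag_mat (s r) *v y - \<nu> r))\<^sup>2"
      using sum_nonneg[of "UNIV - {k}" "\<lambda>i. (s r $ i * y $ i - \<nu> r $ i)\<^sup>2"] elim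
      by (simp add: norm_vec_sum sum.remove[of UNIV k])
    moreover have "(y $ k)\<^sup>2 / 2 - (\<nu> r $ k)\<^sup>2 \<le> (y $ k - \<nu> r $ k)\<^sup>2"
      using norm_diff_square_ge[of "y $ k" "\<nu> r $ k"] by simp
    ultimately have "(norm y)\<^sup>2 / 4 - (\<nu> r $ k)\<^sup>2 \<le> (norm (diag_mat (s r) *v y - \<nu> r))\<^sup>2"
      using light_cone_norm_le[OF y] by simp
    then have "(\<Sum>i\<in>UNIV - {k}. (\<nu> r $ i)\<^sup>2) / 2 + - (norm (diag_mat (s r) *v y - \<nu> r))\<^sup>2 / 2 \<le> B\<^sup>2 + - (1 / 8 * (norm y)\<^sup>2)"
      using n split nk zero_le_power2[of B] by linarith
    then show "normalizer r * gauss (diag_mat (s r)) (\<nu> r) y \<le> exp (B\<^sup>2) * exp (- (1 / 8 * (norm y)\<^sup>2))"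
      unfolding normalizer_def gauss_def exp_add[symmetric] by simp
  qed
qed

lemma weighted_cone_integral_tendsto:
  assumes w: "\<And>y. ((\<lambda>r. w r y) \<longlongrightarrow> W y) (at_edge \<rho>)"
    and bound: "\<forall>\<^sub>F r in at_edge \<rho>. \<forall>y. \<bar>w r y\<bar> \<le> K * (1 + norm y)\<^sup>2"
    and [measurable]: "\<And>r. w r \<in> borel_measurable borel" "W \<in> borel_measurable borel"
  shows "((\<lambda>r. normalizer r * (\<integral>y. indicator (light_cone k) y * w r y * gauss (diag_mat (s r)) (\<nu> r) y \<partial>lborel))
     \<longlongrightarrow> (\<integral>y. indicator (light_cone k) y * W y * exp (- (y $ k - a)\<^sup>2 / 2) \<partial>lborel)) (at_edge \<rho>)"
proof -
  let ?w = "\<lambda>y :: real ^ 'n. (K * exp (B\<^sup>2)) * ((1 + norm y)\<^sup>2 * exp (- (1 / 8 * (norm y)\<^sup>2)))"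
  have "((\<lambda>r. \<integral>y. indicator (light_cone k) y * w r y * (normalizer r * gauss (diag_mat (s r)) (\<nu> r) y) \<partial>lborel)
     \<longlongrightarrow> (\<integral>y. indicator (light_cone k) y * W y * exp (- (y $ k - a)\<^sup>2 / 2) \<partial>lborel)) (at_edge \<rho>)"
  proof (rule integral_tendsto_dominated_at_edge[where w = ?w])
    show "integrable lborel ?w"
      using integrable_one_plus_norm_square_exp[of "1 / 8", where 'n = 'n] by (intro integrable_mult_right) auto
    show "((\<lambda>r. indicator (light_cone k) y * w r y * (normalizer r * gauss (diag_mat (s r)) (\<nu> r) y)) \<longlongrightarrow>
        indicator (light_cone k) y * W y * exp (- (y $ k - a)\<^sup>2 / 2)) (at_edge \<rho>)" for y
      by (intro tendsto_mult tendsto_const w normalizer_gauss_tendsto)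
    show "\<forall>\<^sub>F r in at_edge \<rho>. \<forall>y\<in>space lborel.
        \<bar>indicator (light_cone k) y * w r y * (normalizer r * gauss (diag_mat (s r)) (\<nu> r) y)\<bar> \<le> ?w y"
      using bound normalizer_gauss_bound
    proof eventually_elim
      case (elim r)
      show ?case
      proof
        fix y :: "real ^ 'n"
        have K: "0 \<le> K * (1 + norm y)\<^sup>2" using elim(1) abs_ge_zero order_trans by blast
        show "\<bar>indicator (light_cone k) y * w r y * (normalizer r * gauss (diag_mat (s r)) (\<nu> r) y)\<bar> \<le> ?w y"
        proof (cases "y \<in> light_cone k")
          case True
          have g: "normalizer r * gauss (diag_mat (s r)) (\<nu> r) y \<le> exp (B\<^sup>2) * exp (- (1 / 8 * (norm y)\<^sup>2))"
            using elim(2) True by blast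
          have "\<bar>w r y\<bar> * (normalizer r * gauss (diag_mat (s r)) (\<nu> r) y) \<le>
              (K * (1 + norm y)\<^sup>2) * (exp (B\<^sup>2) * exp (- (1 / 8 * (norm y)\<^sup>2)))"
            using elim(1) K by (intro mult_mono g) (auto simp: normalizer_def gauss_nonneg)
          then show ?thesis
            using True by (simp add: abs_mult normalizer_def gauss_nonneg mult_ac)
        next
          case False
          then show ?thesis
            using mult_nonneg_nonneg[OF K, of "exp (B\<^sup>2) * exp (- (1 / 8 * (norm y)\<^sup>2))"] by (simp add: mult_ac)
        qed
      qed
    qed
  qed measurable
  then show ?thesis
    by (simp add: mult.left_commute[of _ "normalizer _"])
qed

lemma cone_mass_tendsto:
  "((\<lambda>r. normalizer r * (\<integral>y. indicator (light_cone k) y * gauss (diag_mat (s r)) (\<nu> r) y \<partial>lborel))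
     \<longlongrightarrow> cone_gauss_mass k a) (at_edge \<rho>)"
  using weighted_cone_integral_tendsto[of "\<lambda>_ _. 1" "\<lambda>_. 1" 1]
  by (simp add: cone_gauss_mass_def)

text \<open>
  The building blocks of the quadratic integrand in the derivative of the cone mass.
\<close>

definition moment :: "'n \<Rightarrow> 'n \<Rightarrow> real \<Rightarrow> real" where
  "moment i j r = (\<integral>y. indicator (light_cone k) y * ((s r $ i * y $ i - \<nu> r $ i) * (s r $ i * y $ j)) *
     gauss (diag_mat (s r)) (\<nu> r) y \<partial>lborel)"

lemma moment_weight_bound:
  fixes y :: "real ^ 'n"
  assumes "\<bar>s r $ i\<bar> \<le> 1" "norm (\<nu> r) \<le> B"
  shows "\<bar>(s r $ i * y $ i - \<nu> r $ i) * (s r $ i * y $ j)\<bar> \<le> (1 + B) * (1 + norm y)\<^sup>2"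
proof -
  have B: "0 \<le> B" using assms(2) norm_ge_zero order_trans by blast
  have c: "\<bar>y $ l\<bar> \<le> norm y" for l using component_le_norm_cart by blast
  have "\<bar>\<nu> r $ i\<bar> \<le> B" using component_le_norm_cart[of "\<nu> r" i] assms(2) by linarith
  moreover have s: "\<bar>s r $ i\<bar> * \<bar>y $ l\<bar> \<le> 1 * norm y" for l
    using assms(1) c by (intro mult_mono) auto
  ultimately have "\<bar>s r $ i * y $ i - \<nu> r $ i\<bar> \<le> norm y + B"
    using s[of i] abs_triangle_ineq4[of "s r $ i * y $ i" "\<nu> r $ i"]
    unfolding abs_mult by linarith
  then have "\<bar>s r $ i * y $ i - \<nu> r $ i\<bar> * \<bar>s r $ i * y $ j\<bar> \<le> (norm y + B) * norm y"
    using s[of j] B by (intro mult_mono) (auto simp: abs_mult)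
  also have "\<dots> \<le> (1 + B) * (1 + norm y)\<^sup>2"
    using B mult_nonneg_nonneg[OF B zero_le_power2[of "norm y"]] mult_nonneg_nonneg[OF B norm_ge_zero[of y]]
    by (simp add: power2_eq_square algebra_simps)
  finally show ?thesis by (simp add: abs_mult)
qed

lemma eventually_s_le_1: "\<forall>\<^sub>F r in at_edge \<rho>. \<bar>s r $ i\<bar> \<le> 1"
proof (cases "i = k")
  case True
  then show ?thesis using sk by (auto elim: eventually_mono)
next
  case False
  from order_tendstoD(2)[OF tendsto_rabs[OF s0[OF False]], of 1] show ?thesis
    by (auto elim: eventually_mono)
qed

text \<open>
  If \<open>i \<noteq> k\<close> the integrand carries the vanishing factor \<open>s r $ i\<close>.  If \<open>i = k\<close> and \<open>j \<noteq> k\<close>, the limiting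
  integrand is odd in the coordinate \<open>j\<close>.
\<close>

lemma moment_tendsto_0:
  assumes "i \<noteq> k \<or> j \<noteq> k"
  shows "((\<lambda>r. normalizer r * moment i j r) \<longlongrightarrow> 0) (at_edge \<rho>)"
proof -
  have bound: "\<forall>\<^sub>F r in at_edge \<rho>. \<forall>y. \<bar>(s r $ i * y $ i - \<nu> r $ i) * (s r $ i * y $ j)\<bar> \<le> (1 + B) * (1 + norm y)\<^sup>2"
    using eventually_s_le_1[of i] \<nu>B by eventually_elim (blast intro: moment_weight_bound)
  show ?thesis
  proof (cases "i = k")
    case False
    have "((\<lambda>r. (s r $ i * y $ i - \<nu> r $ i) * (s r $ i * y $ j)) \<longlongrightarrow> 0) (at_edge \<rho>)" for y
    proof (rule Lim_null_comparison)
      show "\<forall>\<^sub>F r in at_edge \<rho>. norm ((s r $ i * y $ i - \<nu> r $ i) * (s r $ i * y $ j)) \<le> \<bar>s r $ i\<bar> * ((norm y + B) * norm y)"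
        using eventually_s_le_1[of i] \<nu>B
      proof eventually_elim
        case (elim r)
        have "\<bar>\<nu> r $ i\<bar> \<le> B" using component_le_norm_cart[of "\<nu> r" i] elim(2) by linarith
        moreover have "\<bar>s r $ i * y $ i\<bar> \<le> 1 * norm y"
          unfolding abs_mult using elim(1) component_le_norm_cart by (intro mult_mono) auto
        ultimately have "\<bar>s r $ i * y $ i - \<nu> r $ i\<bar> \<le> norm y + B"
          using abs_triangle_ineq4[of "s r $ i * y $ i" "\<nu> r $ i"] by linarith
        moreover have "0 \<le> norm y + B"
          using elim(2) norm_ge_zero[of y] norm_ge_zero[of "\<nu> r"] by linarith
        ultimately have "\<bar>s r $ i * y $ i - \<nu> r $ i\<bar> * \<bar>y $ j\<bar> \<le> (norm y + B) * norm y"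
          using component_le_norm_cart by (intro mult_mono) auto
        then have "\<bar>s r $ i\<bar> * (\<bar>s r $ i * y $ i - \<nu> r $ i\<bar> * \<bar>y $ j\<bar>) \<le> \<bar>s r $ i\<bar> * ((norm y + B) * norm y)"
          by (rule mult_left_mono) simp
        then show ?case by (simp add: abs_mult mult_ac)
      qed
      show "((\<lambda>r. \<bar>s r $ i\<bar> * ((norm y + B) * norm y)) \<longlongrightarrow> 0) (at_edge \<rho>)"
        by (intro tendsto_mult_left_zero tendsto_rabs_zero s0 False)
    qed
    from weighted_cone_integral_tendsto[OF this bound] show ?thesis
      unfolding moment_def by simp
  next
    case True
    with assms have j: "j \<noteq> k" by simp
    have "((\<lambda>r. (s r $ i * y $ i - \<nu> r $ i) * (s r $ i * y $ j)) \<longlongrightarrow> (1 * y $ k - a) * (1 * y $ j)) (at_edge \<rho>)" for y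
      unfolding True by (intro tendsto_intros tendsto_eventually[OF sk] \<nu>k)
    from weighted_cone_integral_tendsto[OF this bound]
    have "((\<lambda>r. normalizer r * moment i j r) \<longlongrightarrow>
        (\<integral>y. indicator (light_cone k) y * ((1 * y $ k - a) * (1 * y $ j)) * exp (- (y $ k - a)\<^sup>2 / 2) \<partial>lborel)) (at_edge \<rho>)"
      unfolding moment_def by simp
    moreover have "(\<integral>y. indicator (light_cone k) y * ((1 * y $ k - a) * (1 * y $ j)) * exp (- (y $ k - a)\<^sup>2 / 2) \<partial>lborel) = 0"
      (is "integral\<^sup>L lborel ?f = 0")
    proof -
      have refl: "?f (coordinate_reflection j *v y) = - ?f y" for y
        using j by (simp add: indicator_def coordinate_reflection_light_cone)
      have "integral\<^sup>L lborel ?f = (\<integral>y. ?f (coordinate_reflection j *v y) \<partial>lborel)"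
        by (rule integral_coordinate_reflection) measurable
      also have "\<dots> = - integral\<^sup>L lborel ?f" unfolding refl by simp
      finally show ?thesis by simp
    qed
    ultimately show ?thesis by simp
  qed
qed

end

text \<open>
  The asymptotic ratio of the density to the tail probability at the edge, as a function of the rescaled
  form \<open>G\<close> of the denominator.  The Jacobian factor of the saddlepoint density has the same leading term, so
  it cancels from the quotient and needs no limit of its own.
\<close>

definition edge_rate :: "'n :: finite \<Rightarrow> real ^ 'n ^ 'n \<Rightarrow> real" where
  "edge_rate k G = ((real CARD('n) - 1) * G $ k $ k + (\<Sum>i\<in>UNIV - {k}. G $ i $ i)) / 2"

lemma psd_entry_le:
  fixes G :: "real ^ 'n ^ 'n"
  assumes G: "transpose G = G" and psd: "\<And>x. 0 \<le> x \<bullet> (G *v x)"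
  shows "0 \<le> G $ i $ i" "2 * \<bar>G $ i $ j\<bar> \<le> G $ i $ i + G $ j $ j"
proof -
  have sym: "G $ j $ i = G $ i $ j" for i j
    using G by (auto simp: transpose_def vec_eq_iff)
  have q: "(axis i 1 + c *\<^sub>R axis j 1) \<bullet> (G *v (axis i 1 + c *\<^sub>R axis j 1)) = G $ i $ i + 2 * c * G $ i $ j + c\<^sup>2 * G $ j $ j" for c i j
    by (simp add: matrix_vector_right_distrib matrix_vector_mult_scaleR matrix_vector_mult_basis column_def
        inner_add_left inner_axis' sym power2_eq_square algebra_simps)
  show "0 \<le> G $ i $ i" using psd[of "axis i 1 + 0 *\<^sub>R axis i 1"] unfolding q by simp
  show "2 * \<bar>G $ i $ j\<bar> \<le> G $ i $ i + G $ j $ j"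
    using psd[of "axis i 1 + 1 *\<^sub>R axis j 1"] psd[of "axis i 1 + (- 1) *\<^sub>R axis j 1"] unfolding q by simp
qed

text \<open>
  All entries of \<open>G\<close> are of order \<open>edge_rate k G\<close>.  So the entries, divided by the rate, stay
  bounded along any family of such forms.
\<close>

lemma psd_entry_le_edge_rate:
  fixes G :: "real ^ 'n ^ 'n"
  assumes n: "2 \<le> CARD('n)" and G: "transpose G = G" and psd: "\<And>x. 0 \<le> x \<bullet> (G *v x)"
  shows "\<bar>G $ i $ j\<bar> \<le> 2 * edge_rate k G"
proof -
  note nn = psd_entry_le(1)[OF G psd]
  have d: "G $ i $ i \<le> 2 * edge_rate k G" for i
  proof (cases "i = k")
    case True
    have "1 * G $ k $ k \<le> (real CARD('n) - 1) * G $ k $ k"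
      using n nn by (intro mult_right_mono) auto
    then show ?thesis
      using True sum_nonneg[of "UNIV - {k}" "\<lambda>i. G $ i $ i"] nn by (simp add: edge_rate_def)
  next
    case False
    have "G $ i $ i \<le> (\<Sum>i\<in>UNIV - {k}. G $ i $ i)"
      using False nn by (intro member_le_sum) auto
    moreover have "0 \<le> (real CARD('n) - 1) * G $ k $ k" using n nn by simp
    ultimately show ?thesis by (simp add: edge_rate_def)
  qed
  show ?thesis using psd_entry_le(2)[OF G psd, of i j] d[of i] d[of j] by linarith
qed

context cone_limit
begin

text \<open>
  Expand the integrand into the moments.  Those other than \<open>(k, k)\<close> vanish in the limit, and by
  \<open>gauss_cone_scaling_identity\<close> all diagonal moments together sum to \<open>n\<close> times the cone mass.  So the
  \<open>(k, k)\<close> moment behaves like \<open>n\<close> times the mass, and the coefficient that is left over is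
  \<open>trace N - n N\<^sub>k\<^sub>k = - edge_rate k G\<close>.
\<close>

lemma cone_derivative_tendsto:
  fixes G :: "real \<Rightarrow> real ^ 'n ^ 'n"
  assumes n: "2 \<le> CARD('n)"
    and G: "\<forall>\<^sub>F r in at_edge \<rho>. transpose (G r) = G r \<and> (\<forall>x. 0 \<le> x \<bullet> (G r *v x)) \<and> 0 < edge_rate k (G r)"
  defines "N \<equiv> \<lambda>r. (1 / 2) *\<^sub>R (lorentz_mat k ** G r)"
    and "S \<equiv> \<lambda>r. diag_mat (s r)"
  shows "((\<lambda>r. normalizer r *
      (trace (N r) * (\<integral>y. indicator (light_cone k) y * gauss (S r) (\<nu> r) y \<partial>lborel) -
       (\<integral>y. indicator (light_cone k) y * ((S r *v y - \<nu> r) \<bullet> (S r *v (N r *v y))) * gauss (S r) (\<nu> r) y \<partial>lborel))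
      / edge_rate k (G r)) \<longlongrightarrow> - cone_gauss_mass k a) (at_edge \<rho>)"
proof -
  define I where "I r = (\<integral>y. indicator (light_cone k) y * gauss (S r) (\<nu> r) y \<partial>lborel)" for r
  define Q where "Q r = (\<integral>y. indicator (light_cone k) y * ((S r *v y - \<nu> r) \<bullet> (S r *v (N r *v y))) * gauss (S r) (\<nu> r) y \<partial>lborel)" for r
  define n' where "n' r i j = N r $ i $ j / edge_rate k (G r)" for r i j
  let ?D = "\<lambda>r. edge_rate k (G r)"
  have N: "N r $ i $ j = (if i = k then G r $ i $ j / 2 else - G r $ i $ j / 2)" for r i j
    by (simp add: N_def matrix_matrix_mult_def lorentz_mat_def diag_mat_def if_distrib[of "\<lambda>u. u * _"] cong: if_cong)
  \<comment> \<open>this is where \<open>edge_rate\<close> comes from\<close>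
  have tr: "trace (N r) = real CARD('n) * N r $ k $ k - ?D r" for r
  proof -
    have "trace (N r) = N r $ k $ k + (\<Sum>i\<in>UNIV - {k}. N r $ i $ i)"
      by (simp add: trace_def sum.remove[of UNIV k])
    also have "(\<Sum>i\<in>UNIV - {k}. N r $ i $ i) = - (\<Sum>i\<in>UNIV - {k}. G r $ i $ i) / 2"
      by (simp add: N sum_divide_distrib sum_negf)
    finally show ?thesis by (simp add: N edge_rate_def field_simps)
  qed
  have s1: "\<forall>\<^sub>F r in at_edge \<rho>. \<forall>i. \<bar>s r $ i\<bar> \<le> 1"
    by (intro eventually_all_finite eventually_s_le_1)
  have key: "\<forall>\<^sub>F r in at_edge \<rho>. normalizer r * (trace (N r) * I r - Q r) / ?D r =
      - (normalizer r * I r) + (\<Sum>i\<in>UNIV - {k}. n' r k k * (normalizer r * moment i i r)) -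
      (\<Sum>i\<in>UNIV. \<Sum>j\<in>UNIV. if i = k \<and> j = k then 0 else n' r i j * (normalizer r * moment i j r))"
    using spos G \<nu>B s1
  proof eventually_elim
    case (elim r)
    obtain c where c: "0 < c" "\<And>y. c * norm y \<le> norm (S r *v y)"
      unfolding S_def by (rule diag_mat_coercive[of "s r"]) (use elim in auto)
    have int: "integrable lborel (\<lambda>y. indicator (light_cone k) y * ((s r $ i * y $ i - \<nu> r $ i) * (s r $ i * y $ j)) * gauss (S r) (\<nu> r) y)" for i j
      by (rule integrable_weighted_gauss[OF c, where K = "1 + B"])
        (use elim in \<open>auto intro!: moment_weight_bound\<close>)
    have sumT: "(\<Sum>i\<in>UNIV. moment i i r) = real CARD('n) * I r"
    proof -
      have "(\<Sum>i\<in>UNIV. moment i i r) = (\<integral>y. (\<Sum>i\<in>UNIV. indicator (light_cone k) y * ((s r $ i * y $ i - \<nu> r $ i) * (s r $ i * y $ i)) * gauss (S r) (\<nu> r) y) \<partial>lborel)"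
        unfolding moment_def using int by (simp add: S_def)
      also have "\<dots> = (\<integral>y. indicator (light_cone k) y * ((S r *v y - \<nu> r) \<bullet> (S r *v y)) * gauss (S r) (\<nu> r) y \<partial>lborel)"
      proof (intro Bochner_Integration.integral_cong refl)
        fix y :: "real ^ 'n"
        show "(\<Sum>i\<in>UNIV. indicator (light_cone k) y * ((s r $ i * y $ i - \<nu> r $ i) * (s r $ i * y $ i)) * gauss (S r) (\<nu> r) y) =
            indicator (light_cone k) y * ((S r *v y - \<nu> r) \<bullet> (S r *v y)) * gauss (S r) (\<nu> r) y"
          by (cases "y \<in> light_cone k") (simp_all add: inner_vec_def S_def sum_distrib_right)
      qed
      also have "\<dots> = real CARD('n) * I r"
        unfolding I_def by (rule gauss_cone_scaling_identity[OF c])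
      finally show ?thesis .
    qed
    have Q: "Q r = (\<Sum>i\<in>UNIV. \<Sum>j\<in>UNIV. N r $ i $ j * moment i j r)"
    proof -
      have "(\<Sum>i\<in>UNIV. \<Sum>j\<in>UNIV. N r $ i $ j * moment i j r) =
          (\<integral>y. (\<Sum>i\<in>UNIV. \<Sum>j\<in>UNIV. N r $ i $ j * (indicator (light_cone k) y * ((s r $ i * y $ i - \<nu> r $ i) * (s r $ i * y $ j)) * gauss (S r) (\<nu> r) y)) \<partial>lborel)"
        unfolding moment_def using int by (simp add: S_def)
      also have "\<dots> = Q r"
        unfolding Q_def
      proof (intro Bochner_Integration.integral_cong refl)
        fix y :: "real ^ 'n"
        have "(S r *v y - \<nu> r) \<bullet> (S r *v (N r *v y)) =
            (\<Sum>i\<in>UNIV. \<Sum>j\<in>UNIV. N r $ i $ j * ((s r $ i * y $ i - \<nu> r $ i) * (s r $ i * y $ j)))"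
          unfolding inner_vec_def
          by (intro sum.cong refl) (simp add: S_def matrix_vector_mult_def[of "N r"] sum_distrib_left mult_ac)
        then show "(\<Sum>i\<in>UNIV. \<Sum>j\<in>UNIV. N r $ i $ j * (indicator (light_cone k) y * ((s r $ i * y $ i - \<nu> r $ i) * (s r $ i * y $ j)) * gauss (S r) (\<nu> r) y)) =
            indicator (light_cone k) y * ((S r *v y - \<nu> r) \<bullet> (S r *v (N r *v y))) * gauss (S r) (\<nu> r) y"
          by (cases "y \<in> light_cone k") (simp_all add: sum_distrib_left sum_distrib_right mult_ac)
      qed
      finally show ?thesis ..
    qed
    have Q2: "Q r = N r $ k $ k * moment k k r + (\<Sum>i\<in>UNIV. \<Sum>j\<in>UNIV. if i = k \<and> j = k then 0 else N r $ i $ j * moment i j r)"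
    proof -
      have "Q r = (\<Sum>i\<in>UNIV. \<Sum>j\<in>UNIV. (if i = k then if j = k then N r $ k $ k * moment k k r else 0 else 0) +
          (if i = k \<and> j = k then 0 else N r $ i $ j * moment i j r))"
        unfolding Q by (intro sum.cong refl) auto
      also have "\<dots> = (\<Sum>i\<in>UNIV. if i = k then N r $ k $ k * moment k k r else 0) + (\<Sum>i\<in>UNIV. \<Sum>j\<in>UNIV. if i = k \<and> j = k then 0 else N r $ i $ j * moment i j r)"
        unfolding sum.distrib by (intro arg_cong2[of _ _ _ _ "(+)"] sum.cong refl) auto
      finally show ?thesis by simp
    qed
    have Tkk: "moment k k r = real CARD('n) * I r - (\<Sum>i\<in>UNIV - {k}. moment i i r)"
      using sumT by (simp add: sum.remove[of UNIV k])
    have E: "trace (N r) * I r - Q r = - ?D r * I r + N r $ k $ k * (\<Sum>i\<in>UNIV - {k}. moment i i r) -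
        (\<Sum>i\<in>UNIV. \<Sum>j\<in>UNIV. if i = k \<and> j = k then 0 else N r $ i $ j * moment i j r)"
      unfolding Q2 tr Tkk by (simp add: algebra_simps)
    have D: "?D r \<noteq> 0" using elim by auto
    have 1: "normalizer r * (- ?D r * I r) / ?D r = - (normalizer r * I r)" using D by simp
    have 2: "normalizer r * (N r $ k $ k * (\<Sum>i\<in>UNIV - {k}. moment i i r)) / ?D r = (\<Sum>i\<in>UNIV - {k}. n' r k k * (normalizer r * moment i i r))"
      by (simp add: n'_def sum_distrib_left sum_divide_distrib mult_ac)
    have 3: "normalizer r * (\<Sum>i\<in>UNIV. \<Sum>j\<in>UNIV. if i = k \<and> j = k then 0 else N r $ i $ j * moment i j r) / ?D r =
        (\<Sum>i\<in>UNIV. \<Sum>j\<in>UNIV. if i = k \<and> j = k then 0 else n' r i j * (normalizer r * moment i j r))"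
      unfolding sum_distrib_left sum_divide_distrib by (intro sum.cong refl) (simp add: n'_def mult_ac)
    show ?case
      unfolding E right_diff_distrib distrib_left diff_divide_distrib add_divide_distrib 1 2 3 ..
  qed
  \<comment> \<open>relative to the rate, the coefficients are bounded although \<open>G\<close> may be unbounded\<close>
  have n'1: "\<forall>\<^sub>F r in at_edge \<rho>. \<bar>n' r i j\<bar> \<le> 1" for i j
    using G
  proof eventually_elim
    case (elim r)
    then have "\<bar>N r $ i $ j\<bar> \<le> ?D r"
      using psd_entry_le_edge_rate[OF n, of "G r" i j k] by (auto simp: N)
    then show ?case using elim by (simp add: n'_def abs_divide)
  qed
  have t: "((\<lambda>r. n' r i j * (normalizer r * moment p q r)) \<longlongrightarrow> 0) (at_edge \<rho>)" if "p \<noteq> k \<or> q \<noteq> k" for i j p q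
  proof (rule Lim_null_comparison)
    show "\<forall>\<^sub>F r in at_edge \<rho>. norm (n' r i j * (normalizer r * moment p q r)) \<le> \<bar>normalizer r * moment p q r\<bar>"
      using n'1[of i j] by eventually_elim (simp add: abs_mult mult_left_le_one_le)
    show "((\<lambda>r. \<bar>normalizer r * moment p q r\<bar>) \<longlongrightarrow> 0) (at_edge \<rho>)"
      by (intro tendsto_rabs_zero moment_tendsto_0 that)
  qed
  have "((\<lambda>r. - (normalizer r * I r) + (\<Sum>i\<in>UNIV - {k}. n' r k k * (normalizer r * moment i i r)) -
      (\<Sum>i\<in>UNIV. \<Sum>j\<in>UNIV. if i = k \<and> j = k then 0 else n' r i j * (normalizer r * moment i j r))) \<longlongrightarrow>
      - cone_gauss_mass k a + (\<Sum>i\<in>UNIV - {k}. 0) - (\<Sum>i\<in>(UNIV :: 'n set). \<Sum>j\<in>(UNIV :: 'n set). 0)) (at_edge \<rho>)"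
  proof (intro tendsto_intros)
    show "((\<lambda>r. normalizer r * I r) \<longlongrightarrow> cone_gauss_mass k a) (at_edge \<rho>)"
      unfolding I_def S_def by (rule cone_mass_tendsto)
    show "((\<lambda>r. n' r k k * (normalizer r * moment i i r)) \<longlongrightarrow> 0) (at_edge \<rho>)" if "i \<in> UNIV - {k}" for i
      using that by (intro t) auto
    show "((\<lambda>r. if i = k \<and> j = k then 0 else n' r i j * (normalizer r * moment i j r)) \<longlongrightarrow> 0) (at_edge \<rho>)" for i j
      using t[of i j i j] by (cases "i = k \<and> j = k") auto
  qed
  then show ?thesis
    unfolding I_def[symmetric] Q_def[symmetric] by (simp add: tendsto_cong[OF key])
qed

end

section \<open>The limiting cone mass as a hypergeometric series\<close>

lemma nn_integral_abs_power_gauss: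
  "(\<integral>\<^sup>+z. ennreal (\<bar>z\<bar> ^ p * exp (- z\<^sup>2 / 2)) \<partial>lborel) =
    ennreal (2 powr (real (p + 1) / 2) * Gamma (real (p + 1) / 2))"
proof -
  have e: "\<bar>z\<bar> ^ p * exp (- z\<^sup>2 / 2) = sqrt (2 * pi) * (std_normal_density z * \<bar>z\<bar> ^ p)" for z :: real
    by (simp add: std_normal_density_def)
  have "has_bochner_integral lborel (\<lambda>z. std_normal_density z * \<bar>z\<bar> ^ p)
      (2 powr (real (p + 1) / 2) * Gamma (real (p + 1) / 2) / sqrt (2 * pi))"
  proof (cases "even p")
    case True
    then obtain q where q: "p = 2 * q" by blast
    have G: "Gamma (1 / 2 + real q) = pochhammer (1 / 2) q * sqrt pi"
    proof -
      have "(1 / 2 :: real) \<notin> \<int>\<^sub>\<le>\<^sub>0" by (auto dest: nonpos_Ints_nonpos)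
      from pochhammer_Gamma[OF this, of q] show ?thesis by (simp add: Gamma_one_half_real)
    qed
    have ex: "real (p + 1) / 2 = 1 / 2 + real q" by (simp add: q field_simps)
    have "2 powr (real (p + 1) / 2) * Gamma (real (p + 1) / 2) / sqrt (2 * pi) = 2 ^ q * pochhammer (1 / 2) q"
      unfolding ex G by (simp add: powr_add powr_realpow powr_half_sqrt real_sqrt_mult)
    also have "\<dots> = fact (2 * q) / ((2 / 1\<^sup>2) ^ q * fact q)"
    proof -
      have "(2 :: real) ^ (2 * q) = 2 ^ q * 2 ^ q" by (simp add: mult_2 power_add)
      then show ?thesis by (simp add: fact_double)
    qed
    finally have c: "2 powr (real (p + 1) / 2) * Gamma (real (p + 1) / 2) / sqrt (2 * pi) = fact (2 * q) / ((2 / 1\<^sup>2) ^ q * fact q)" .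
    have "\<bar>z\<bar> ^ p = (z - 0) ^ (2 * q)" for z :: real by (simp add: q power_even_abs)
    then show ?thesis unfolding c using normal_moment_even[of 1 0 q] by simp
  next
    case False
    then obtain q where q: "p = 2 * q + 1" using oddE by blast
    have ex: "real (p + 1) / 2 = real (Suc q)" by (simp add: q field_simps)
    have "2 powr (real (p + 1) / 2) * Gamma (real (p + 1) / 2) / sqrt (2 * pi) = 2 ^ Suc q * fact q / sqrt (2 * pi)"
      unfolding ex using powr_realpow[of 2 "Suc q"] Gamma_fact[of q, where ?'a = real] by (simp add: add.commute)
    also have "\<dots> = 2 ^ q * 1 ^ (2 * q + 1) * fact q * sqrt (2 / pi)"
      by (simp add: real_sqrt_mult real_sqrt_divide field_simps)
    finally show ?thesis
      using normal_moment_abs_odd[of 1 0 q] by (simp add: q)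
  qed
  from has_bochner_integral_mult_right[OF this, of "sqrt (2 * pi)"]
  have h: "has_bochner_integral lborel (\<lambda>z. \<bar>z\<bar> ^ p * exp (- z\<^sup>2 / 2)) (2 powr (real (p + 1) / 2) * Gamma (real (p + 1) / 2))"
    unfolding e by simp
  show ?thesis
    using nn_integral_eq_integral[of lborel "\<lambda>z. \<bar>z\<bar> ^ p * exp (- z\<^sup>2 / 2)"] has_bochner_integral_integral_eq[OF h]
      integrable.intros[OF h] by simp
qed

text \<open>
  The boundary sphere is negligible: the open ball is exhausted by the closed balls of smaller radius.
\<close>

lemma emeasure_open_ball_PiM:
  assumes "finite A" "0 < r"
  shows "emeasure (Pi\<^sub>M A (\<lambda>_. lborel)) ({f. (\<Sum>i\<in>A. (f i)\<^sup>2) < r\<^sup>2} \<inter> space (Pi\<^sub>M A (\<lambda>_. lborel))) =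
    ennreal (unit_ball_vol (real (card A)) * r ^ card A)"
proof (rule antisym)
  let ?P = "Pi\<^sub>M A (\<lambda>_. lborel) :: ('a \<Rightarrow> real) measure"
  let ?V = "unit_ball_vol (real (card A))"
  let ?O = "{f. (\<Sum>i\<in>A. (f i)\<^sup>2) < r\<^sup>2} \<inter> space ?P"
  have m: "?O \<in> sets ?P"
  proof -
    have "{f \<in> space ?P. (\<Sum>i\<in>A. (f i)\<^sup>2) < r\<^sup>2} \<in> sets ?P" by measurable
    also have "{f \<in> space ?P. (\<Sum>i\<in>A. (f i)\<^sup>2) < r\<^sup>2} = ?O" by auto
    finally show ?thesis .
  qed
  have mc: "{f. sqrt (\<Sum>i\<in>A. (f i)\<^sup>2) \<le> t} \<inter> space ?P \<in> sets ?P" for t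
  proof -
    have "{f \<in> space ?P. sqrt (\<Sum>i\<in>A. (f i)\<^sup>2) \<le> t} \<in> sets ?P" by measurable
    also have "{f \<in> space ?P. sqrt (\<Sum>i\<in>A. (f i)\<^sup>2) \<le> t} = {f. sqrt (\<Sum>i\<in>A. (f i)\<^sup>2) \<le> t} \<inter> space ?P" by auto
    finally show ?thesis .
  qed
  have "emeasure ?P ?O \<le> emeasure ?P ({f. sqrt (\<Sum>i\<in>A. (f i)\<^sup>2) \<le> r} \<inter> space ?P)"
    using assms mc by (intro emeasure_mono) (auto intro!: real_le_lsqrt sum_nonneg)
  then show "emeasure ?P ?O \<le> ennreal (?V * r ^ card A)"
    using emeasure_cball_aux[OF assms] by simp
  have le: "ennreal (?V * t ^ card A) \<le> emeasure ?P ?O" if "0 < t" "t < r" for t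
  proof -
    have "emeasure ?P ({f. sqrt (\<Sum>i\<in>A. (f i)\<^sup>2) \<le> t} \<inter> space ?P) \<le> emeasure ?P ?O"
    proof (rule emeasure_mono[OF _ m], safe)
      fix f :: "'a \<Rightarrow> real" assume "sqrt (\<Sum>i\<in>A. (f i)\<^sup>2) \<le> t"
      then have "(\<Sum>i\<in>A. (f i)\<^sup>2) \<le> t\<^sup>2" by (rule sqrt_le_D)
      also have "t\<^sup>2 < r\<^sup>2" using that by (intro power_strict_mono) auto
      finally show "(\<Sum>i\<in>A. (f i)\<^sup>2) < r\<^sup>2" .
    qed
    then show ?thesis using emeasure_cball_aux[OF assms(1) that(1)] by simp
  qed
  have "((\<lambda>t. ennreal (?V * t ^ card A)) \<longlongrightarrow> ennreal (?V * r ^ card A)) (at_left r)"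
    by (intro tendsto_intros)
  moreover have "\<forall>\<^sub>F t in at_left r. ennreal (?V * t ^ card A) \<le> emeasure ?P ?O"
    using eventually_at_left_real[OF assms(2)] by eventually_elim (auto intro: le)
  ultimately show "ennreal (?V * r ^ card A) \<le> emeasure ?P ?O"
    by (rule tendsto_upperbound) simp
qed

text \<open>
  The slice of the cone at height \<open>z\<close> is an open ball of radius \<open>\<bar>z\<bar>\<close> in dimension \<open>n - 1\<close>.
\<close>

lemma nn_integral_light_cone:
  fixes g :: "real \<Rightarrow> ennreal" and k :: "'n :: finite"
  assumes n: "2 \<le> CARD('n)" and [measurable]: "g \<in> borel_measurable borel"
  shows "(\<integral>\<^sup>+y. indicator (light_cone k) y * g (y $ k) \<partial>(lborel :: (real ^ 'n) measure)) =
    ennreal (unit_ball_vol (real (CARD('n) - 1))) * (\<integral>\<^sup>+z. ennreal (\<bar>z\<bar> ^ (CARD('n) - 1)) * g z \<partial>lborel)"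
proof -
  let ?P = "Pi\<^sub>M (UNIV - {k}) (\<lambda>_. lborel) :: ('n \<Rightarrow> real) measure"
  let ?V = "unit_ball_vol (real (CARD('n) - 1))"
  have card: "card (UNIV - {k}) = CARD('n) - 1" by (simp add: card_Diff_singleton)
  have "(\<integral>\<^sup>+y. indicator (light_cone k) y * g (y $ k) \<partial>lborel) =
      (\<integral>\<^sup>+z. \<integral>\<^sup>+y. indicator (light_cone k) (\<chi> i. if i = k then z else y i) * g (((\<chi> i. if i = k then z else y i) :: real ^ 'n) $ k) \<partial>?P \<partial>lborel)"
    by (rule nn_integral_vec_split_coordinate) measurable
  also have "\<dots> = (\<integral>\<^sup>+z. ennreal ?V * (ennreal (\<bar>z\<bar> ^ (CARD('n) - 1)) * g z) \<partial>lborel)"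
  proof (rule nn_integral_cong)
    fix z :: real
    let ?O = "{f. (\<Sum>i\<in>UNIV - {k}. (f i)\<^sup>2) < \<bar>z\<bar>\<^sup>2} \<inter> space ?P"
    have m[measurable]: "?O \<in> sets ?P"
    proof -
      have "{f \<in> space ?P. (\<Sum>i\<in>UNIV - {k}. (f i)\<^sup>2) < \<bar>z\<bar>\<^sup>2} \<in> sets ?P" by measurable
      also have "{f \<in> space ?P. (\<Sum>i\<in>UNIV - {k}. (f i)\<^sup>2) < \<bar>z\<bar>\<^sup>2} = ?O" by auto
      finally show ?thesis .
    qed
    have in_cone: "(\<chi> i. if i = k then z else y i) \<in> light_cone k \<longleftrightarrow> (\<Sum>i\<in>UNIV - {k}. (y i)\<^sup>2) < \<bar>z\<bar>\<^sup>2" for y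
    proof -
      have "(\<Sum>i\<in>UNIV - {k}. (if i = k then z else y i)\<^sup>2) = (\<Sum>i\<in>UNIV - {k}. (y i)\<^sup>2)"
        by (rule sum.cong) auto
      then show ?thesis by (simp add: light_cone_def)
    qed
    have "(\<integral>\<^sup>+y. indicator (light_cone k) (\<chi> i. if i = k then z else y i) * g (((\<chi> i. if i = k then z else y i) :: real ^ 'n) $ k) \<partial>?P) =
        (\<integral>\<^sup>+y. indicator ?O y * g z \<partial>?P)"
      by (rule nn_integral_cong) (auto simp: indicator_def in_cone)
    also have "\<dots> = emeasure ?P ?O * g z"
      by (simp add: nn_integral_multc)
    also have "emeasure ?P ?O = ennreal (?V * \<bar>z\<bar> ^ (CARD('n) - 1))"
    proof (cases "z = 0")
      case True
      have "\<not> (\<Sum>i\<in>UNIV - {k}. (f i)\<^sup>2) < (0 :: real)" for f :: "'n \<Rightarrow> real"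
        by (simp add: not_less sum_nonneg)
      with True have "?O = {}" by auto
      then show ?thesis using True n by (simp add: power_0_left)
    next
      case False
      then show ?thesis using emeasure_open_ball_PiM[of "UNIV - {k}" "\<bar>z\<bar>"] unfolding card by simp
    qed
    finally show "(\<integral>\<^sup>+y. indicator (light_cone k) (\<chi> i. if i = k then z else y i) * g (((\<chi> i. if i = k then z else y i) :: real ^ 'n) $ k) \<partial>?P) =
        ennreal ?V * (ennreal (\<bar>z\<bar> ^ (CARD('n) - 1)) * g z)"
      by (simp add: ennreal_mult' mult_ac)
  qed
  also have "\<dots> = ennreal ?V * (\<integral>\<^sup>+z. ennreal (\<bar>z\<bar> ^ (CARD('n) - 1)) * g z \<partial>lborel)"
    by (rule nn_integral_cmult) measurable
  finally show ?thesis .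
qed

lemma cosh_sums_even: "(\<lambda>j. x ^ (2 * j) / fact (2 * j)) sums cosh (x :: real)"
proof -
  have "(\<lambda>j. if even (2 * j) then x ^ (2 * j) /\<^sub>R fact (2 * j) else 0) sums cosh x"
    using cosh_converges[of x]
    by (subst sums_mono_reindex[of "\<lambda>j. 2 * j" "\<lambda>n. if even n then x ^ n /\<^sub>R fact n else 0"])
      (auto simp: strict_mono_def elim!: evenE)
  then show ?thesis by (simp add: field_simps)
qed

text \<open>
  Symmetry under \<open>z \<mapsto> - z\<close> replaces \<open>exp (a z)\<close> by \<open>cosh (a z)\<close>, whose power series has nonnegative terms
  and may be integrated term by term.
\<close>

lemma nn_integral_abs_power_shifted_gauss:
  "(\<integral>\<^sup>+z. ennreal (\<bar>z\<bar> ^ p * exp (- (z - a)\<^sup>2 / 2)) \<partial>lborel) =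
    (\<Sum>j. ennreal (exp (- a\<^sup>2 / 2) * 2 powr (real (p + 1) / 2) * Gamma (real (p + 1) / 2) *
       (pochhammer (real (p + 1) / 2) j / (pochhammer (1 / 2) j * fact j) * (a\<^sup>2 / 2) ^ j)))"
proof -
  let ?g = "\<lambda>z :: real. \<bar>z\<bar> ^ p * exp (- z\<^sup>2 / 2) * exp (- a\<^sup>2 / 2)"
  let ?X = "\<integral>\<^sup>+z. ennreal (?g z * exp (a * z)) \<partial>lborel"
  let ?Y = "\<integral>\<^sup>+z. ennreal (?g z * cosh (a * z)) \<partial>lborel"
  have "\<bar>z\<bar> ^ p * exp (- (z - a)\<^sup>2 / 2) = ?g z * exp (a * z)" for z
  proof -
    have "- (z - a)\<^sup>2 / 2 = - z\<^sup>2 / 2 + - a\<^sup>2 / 2 + a * z" by (simp add: power2_eq_square field_simps)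
    then show ?thesis by (simp only: exp_add mult.assoc)
  qed
  then have "(\<integral>\<^sup>+z. ennreal (\<bar>z\<bar> ^ p * exp (- (z - a)\<^sup>2 / 2)) \<partial>lborel) = ?X" by (simp only:)
  also have "?X = ?Y"
  proof -
    have refl: "?X = (\<integral>\<^sup>+z. ennreal (?g z * exp (- (a * z))) \<partial>lborel)"
      by (subst nn_integral_real_affine[where c = "- 1" and t = 0]) auto
    have "?X + ?X = (\<integral>\<^sup>+z. ennreal (?g z * exp (a * z)) + ennreal (?g z * exp (- (a * z))) \<partial>lborel)"
      by (subst (2) refl, rule nn_integral_add[symmetric]) auto
    also have "\<dots> = (\<integral>\<^sup>+z. 2 * ennreal (?g z * cosh (a * z)) \<partial>lborel)"
    proof (rule nn_integral_cong)
      fix z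
      have "ennreal (?g z * exp (a * z)) + ennreal (?g z * exp (- (a * z))) = ennreal (2 * (?g z * cosh (a * z)))"
      proof -
        have "2 * (?g z * cosh (a * z)) = ?g z * exp (a * z) + ?g z * exp (- (a * z))"
          by (simp add: cosh_def distrib_left)
        then show ?thesis by (simp only:) (subst ennreal_plus, auto)
      qed
      then show "ennreal (?g z * exp (a * z)) + ennreal (?g z * exp (- (a * z))) = 2 * ennreal (?g z * cosh (a * z))"
        by (simp add: ennreal_mult')
    qed
    also have "\<dots> = 2 * ?Y"
      by (rule nn_integral_cmult) (simp add: cosh_def)
    finally have "2 * ?X = 2 * ?Y" by (simp add: mult_2)
    then show ?thesis by (simp add: ennreal_mult_cancel_left)
  qed
  also have "?Y = (\<integral>\<^sup>+z. (\<Sum>j. ennreal (exp (- a\<^sup>2 / 2) * a ^ (2 * j) / fact (2 * j)) * ennreal (\<bar>z\<bar> ^ (p + 2 * j) * exp (- z\<^sup>2 / 2))) \<partial>lborel)"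
  proof (rule nn_integral_cong)
    fix z :: real
    have s: "(\<lambda>j. ?g z * ((a * z) ^ (2 * j) / fact (2 * j))) sums (?g z * cosh (a * z))"
      by (rule sums_mult[OF cosh_sums_even])
    have "ennreal (?g z * cosh (a * z)) = (\<Sum>j. ennreal (?g z * ((a * z) ^ (2 * j) / fact (2 * j))))"
    proof (rule suminf_ennreal_eq[symmetric, OF _ s])
      fix j
      have "0 \<le> (a * z) ^ (2 * j)" by (rule zero_le_even_power') 
      then show "0 \<le> ?g z * ((a * z) ^ (2 * j) / fact (2 * j))"
        by (intro mult_nonneg_nonneg divide_nonneg_nonneg) auto
    qed
    also have "(\<lambda>j. ?g z * ((a * z) ^ (2 * j) / fact (2 * j))) =
        (\<lambda>j. (exp (- a\<^sup>2 / 2) * a ^ (2 * j) / fact (2 * j)) * (\<bar>z\<bar> ^ (p + 2 * j) * exp (- z\<^sup>2 / 2)))"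
    proof
      fix j
      have "z ^ (2 * j) = \<bar>z\<bar> ^ (2 * j)" by (simp add: power_mult)
      then show "?g z * ((a * z) ^ (2 * j) / fact (2 * j)) = (exp (- a\<^sup>2 / 2) * a ^ (2 * j) / fact (2 * j)) * (\<bar>z\<bar> ^ (p + 2 * j) * exp (- z\<^sup>2 / 2))"
        by (simp add: power_mult_distrib power_add)
    qed
    finally have eq: "ennreal (?g z * cosh (a * z)) = (\<Sum>j. ennreal ((exp (- a\<^sup>2 / 2) * a ^ (2 * j) / fact (2 * j)) * (\<bar>z\<bar> ^ (p + 2 * j) * exp (- z\<^sup>2 / 2))))" .
    show "ennreal (?g z * cosh (a * z)) = (\<Sum>j. ennreal (exp (- a\<^sup>2 / 2) * a ^ (2 * j) / fact (2 * j)) * ennreal (\<bar>z\<bar> ^ (p + 2 * j) * exp (- z\<^sup>2 / 2)))"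
    proof -
      have "ennreal (exp (- a\<^sup>2 / 2) * a ^ (2 * j) / fact (2 * j) * x) = ennreal (exp (- a\<^sup>2 / 2) * a ^ (2 * j) / fact (2 * j)) * ennreal x" for j x
        by (rule ennreal_mult') (auto intro!: divide_nonneg_nonneg mult_nonneg_nonneg zero_le_even_power')
      with eq show ?thesis by (simp only:)
    qed
  qed
  also have "\<dots> = (\<Sum>j. \<integral>\<^sup>+z. ennreal (exp (- a\<^sup>2 / 2) * a ^ (2 * j) / fact (2 * j)) * ennreal (\<bar>z\<bar> ^ (p + 2 * j) * exp (- z\<^sup>2 / 2)) \<partial>lborel)"
    by (rule nn_integral_suminf) measurable
  also have "\<dots> = (\<Sum>j. ennreal (exp (- a\<^sup>2 / 2) * 2 powr (real (p + 1) / 2) * Gamma (real (p + 1) / 2) *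
       (pochhammer (real (p + 1) / 2) j / (pochhammer (1 / 2) j * fact j) * (a\<^sup>2 / 2) ^ j)))"
  proof (rule suminf_cong)
    fix j
    have ex: "real (p + 2 * j + 1) / 2 = real (p + 1) / 2 + real j" by (simp add: field_simps)
    have G: "Gamma (real (p + 2 * j + 1) / 2) = pochhammer (real (p + 1) / 2) j * Gamma (real (p + 1) / 2)"
    proof -
      have "Gamma (x + real j) = pochhammer x j * Gamma x" if "0 < x" for x :: real
      proof -
        have "x \<notin> \<int>\<^sub>\<le>\<^sub>0" using that nonpos_Ints_nonpos by force
        from pochhammer_Gamma[OF this, of j] Gamma_real_pos[OF that] show ?thesis by simp
      qed
      from this[of "real (p + 1) / 2"] show ?thesis unfolding ex by simp
    qed
    have P: "2 powr (real (p + 2 * j + 1) / 2) = 2 powr (real (p + 1) / 2) * 2 ^ j"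
      unfolding ex by (simp add: powr_add powr_realpow)
    have ph: "pochhammer (1 / 2 :: real) j > 0" by (simp add: pochhammer_pos)
    have "exp (- a\<^sup>2 / 2) * a ^ (2 * j) / fact (2 * j) * (2 powr (real (p + 2 * j + 1) / 2) * Gamma (real (p + 2 * j + 1) / 2)) =
       exp (- a\<^sup>2 / 2) * 2 powr (real (p + 1) / 2) * Gamma (real (p + 1) / 2) *
       (pochhammer (real (p + 1) / 2) j / (pochhammer (1 / 2) j * fact j) * (a\<^sup>2 / 2) ^ j)"
    proof -
      have "a ^ (2 * j) / fact (2 * j) * 2 ^ j = (a\<^sup>2 / 2) ^ j / (pochhammer (1 / 2) j * fact j)"
      proof -
        have "(2 :: real) ^ (2 * j) = 2 ^ j * 2 ^ j" by (simp add: mult_2 power_add)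
        then have F: "fact (2 * j) = (2 ^ j * 2 ^ j) * (pochhammer (1 / 2) j * fact j :: real)"
          by (simp add: fact_double)
        have A: "a ^ (2 * j) = (a\<^sup>2) ^ j" by (simp add: power_mult)
        show ?thesis unfolding F A power_divide by simp
      qed
      moreover have "x * y / f * (t * p2 * (q * g)) = x * t * g * (q / d * w)" if "y / f * p2 = w / d" for x y f t p2 q g d w :: real
      proof -
        have "x * y / f * (t * p2 * (q * g)) = (y / f * p2) * (x * t * q * g)" by simp
        also have "\<dots> = x * t * g * (q / d * w)" unfolding that by simp
        finally show ?thesis .
      qed
      ultimately show ?thesis unfolding G P by blast
    qed
    moreover have "(\<integral>\<^sup>+z. ennreal (exp (- a\<^sup>2 / 2) * a ^ (2 * j) / fact (2 * j)) * ennreal (\<bar>z\<bar> ^ (p + 2 * j) * exp (- z\<^sup>2 / 2)) \<partial>lborel) =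
        ennreal (exp (- a\<^sup>2 / 2) * a ^ (2 * j) / fact (2 * j)) * ennreal (2 powr (real (p + 2 * j + 1) / 2) * Gamma (real (p + 2 * j + 1) / 2))"
      unfolding nn_integral_abs_power_gauss[symmetric] by (rule nn_integral_cmult) measurable
    ultimately show "(\<integral>\<^sup>+z. ennreal (exp (- a\<^sup>2 / 2) * a ^ (2 * j) / fact (2 * j)) * ennreal (\<bar>z\<bar> ^ (p + 2 * j) * exp (- z\<^sup>2 / 2)) \<partial>lborel) =
       ennreal (exp (- a\<^sup>2 / 2) * 2 powr (real (p + 1) / 2) * Gamma (real (p + 1) / 2) *
       (pochhammer (real (p + 1) / 2) j / (pochhammer (1 / 2) j * fact j) * (a\<^sup>2 / 2) ^ j))"
      by (simp add: ennreal_mult'[symmetric])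
  qed
  finally show ?thesis .
qed

lemma integrable_cone_gauss:
  "integrable lborel (\<lambda>y :: real ^ 'n. indicator (light_cone k) y * exp (- (y $ k - a)\<^sup>2 / 2))"
proof (rule Bochner_Integration.integrable_bound)
  show "integrable lborel (\<lambda>y :: real ^ 'n. exp (a\<^sup>2 / 2) * exp (- (1 / 8 * (norm y)\<^sup>2)))"
    using integrable_exp_neg_norm_square[of "1 / 8", where 'n = 'n] by (intro integrable_mult_right) auto
  show "AE y :: real ^ 'n in lborel. norm (indicator (light_cone k) y * exp (- (y $ k - a)\<^sup>2 / 2)) \<le>
      norm (exp (a\<^sup>2 / 2) * exp (- (1 / 8 * (norm y)\<^sup>2)))"
  proof (rule AE_I2)
    fix y :: "real ^ 'n"
    show "norm (indicator (light_cone k) y * exp (- (y $ k - a)\<^sup>2 / 2)) \<le> norm (exp (a\<^sup>2 / 2) * exp (- (1 / 8 * (norm y)\<^sup>2)))"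
    proof (cases "y \<in> light_cone k")
      case True
      have "(y $ k)\<^sup>2 / 2 - a\<^sup>2 \<le> (y $ k - a)\<^sup>2"
        using norm_diff_square_ge[of "y $ k" a] by simp
      then have "- (y $ k - a)\<^sup>2 / 2 \<le> a\<^sup>2 / 2 + - (1 / 8 * (norm y)\<^sup>2)"
        using light_cone_norm_le[OF True] by simp
      then show ?thesis using True unfolding exp_add[symmetric] by simp
    qed simp
  qed
qed measurable

text \<open>
  Slicing reduces the mass to an absolute moment of order \<open>n - 1\<close> of a shifted normal variable.
\<close>

proposition cone_gauss_mass_eq:
  fixes k :: "'n :: finite"
  assumes n: "2 \<le> CARD('n)"
  shows "cone_gauss_mass k a = unit_ball_vol (real (CARD('n) - 1)) * 2 powr (real CARD('n) / 2) *
    Gamma (real CARD('n) / 2) * exp (- a\<^sup>2 / 2) * hyp1F1 (real CARD('n) / 2) (1 / 2) (a\<^sup>2 / 2)"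
proof -
  define V where "V = unit_ball_vol (real (CARD('n) - 1))"
  define c where "c j = pochhammer (real CARD('n) / 2) j / (pochhammer (1 / 2) j * fact j) * (a\<^sup>2 / 2) ^ j" for j
  define E where "E = exp (- a\<^sup>2 / 2) * 2 powr (real CARD('n) / 2) * Gamma (real CARD('n) / 2)"
  have n1: "CARD('n) - 1 + 1 = CARD('n)" using n by simp
  have V: "0 < V" by (simp add: V_def)
  have E: "0 < E" using n by (auto simp: E_def intro!: mult_pos_pos Gamma_real_pos)
  have c: "0 \<le> c j" for j
    by (auto simp: c_def intro!: mult_nonneg_nonneg divide_nonneg_nonneg pochhammer_nonneg)
  have hyp: "hyp1F1 (real CARD('n) / 2) (1 / 2) (a\<^sup>2 / 2) = (\<Sum>j. c j)"
    by (simp add: hyp1F1_def eval_fps_def c_def)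
  have "ennreal (cone_gauss_mass k a) = (\<integral>\<^sup>+y. ennreal (indicator (light_cone k) y * exp (- (y $ k - a)\<^sup>2 / 2)) \<partial>(lborel :: (real ^ 'n) measure))"
    unfolding cone_gauss_mass_def by (rule nn_integral_eq_integral[symmetric, OF integrable_cone_gauss]) simp
  also have "\<dots> = (\<integral>\<^sup>+y. indicator (light_cone k) y * ennreal (exp (- (y $ k - a)\<^sup>2 / 2)) \<partial>(lborel :: (real ^ 'n) measure))"
    by (intro nn_integral_cong) (auto simp: indicator_def)
  also have "\<dots> = ennreal V * (\<integral>\<^sup>+z. ennreal (\<bar>z\<bar> ^ (CARD('n) - 1)) * ennreal (exp (- (z - a)\<^sup>2 / 2)) \<partial>lborel)"
    unfolding V_def by (rule nn_integral_light_cone[OF n]) measurable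
  also have "(\<integral>\<^sup>+z. ennreal (\<bar>z\<bar> ^ (CARD('n) - 1)) * ennreal (exp (- (z - a)\<^sup>2 / 2)) \<partial>lborel) =
      (\<integral>\<^sup>+z. ennreal (\<bar>z\<bar> ^ (CARD('n) - 1) * exp (- (z - a)\<^sup>2 / 2)) \<partial>lborel)"
    by (simp add: ennreal_mult')
  also have "\<dots> = (\<Sum>j. ennreal (E * c j))"
    unfolding nn_integral_abs_power_shifted_gauss n1 E_def c_def ..
  finally have eq: "ennreal (cone_gauss_mass k a) = ennreal V * (\<Sum>j. ennreal (E * c j))" .
  have "(\<Sum>j. ennreal (E * c j)) \<noteq> top"
  proof
    assume "(\<Sum>j. ennreal (E * c j)) = top"
    with eq V show False by (simp add: ennreal_mult_top)
  qed
  then have s: "summable (\<lambda>j. E * c j)"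
    using E c by (intro summable_suminf_not_top) auto
  then have "(\<Sum>j. ennreal (E * c j)) = ennreal (\<Sum>j. E * c j)"
    using E c by (intro suminf_ennreal2) auto
  with eq have eq2: "ennreal (cone_gauss_mass k a) = ennreal (V * (\<Sum>j. E * c j))"
    using V by (simp add: ennreal_mult')
  have pos: "0 \<le> cone_gauss_mass k a"
    unfolding cone_gauss_mass_def by (intro integral_nonneg_AE) auto
  have sc: "summable c" using s E by (simp add: summable_cmult_iff)
  have "cone_gauss_mass k a = V * (\<Sum>j. E * c j)"
    using eq2 pos E V c s by (subst (asm) ennreal_inj) (auto intro!: mult_nonneg_nonneg suminf_nonneg)
  also have "(\<Sum>j. E * c j) = E * (\<Sum>j. c j)"
    using sc by (rule suminf_mult)
  finally have m: "cone_gauss_mass k a = V * (E * (\<Sum>j. c j))" .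
  show "cone_gauss_mass k a = unit_ball_vol (real (CARD('n) - 1)) * 2 powr (real CARD('n) / 2) *
    Gamma (real CARD('n) / 2) * exp (- a\<^sup>2 / 2) * hyp1F1 (real CARD('n) / 2) (1 / 2) (a\<^sup>2 / 2)"
    unfolding m hyp by (simp add: V_def E_def mult_ac)
qed

lemma cone_gauss_mass_normalized:
  fixes k :: "'n :: finite"
  assumes n: "2 \<le> CARD('n)"
  shows "(2 * pi) powr (- real CARD('n) / 2) * cone_gauss_mass k a =
    exp (- a\<^sup>2 / 2) * hyp1F1 (real CARD('n) / 2) (1 / 2) (a\<^sup>2 / 2) /
    (Beta (1 / 2) ((real CARD('n) + 1) / 2) * (real CARD('n) / 2))"
proof -
  define N where "N = real CARD('n)"
  have N: "2 \<le> N" using n by (simp add: N_def)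
  have n1: "real (CARD('n) - 1) = N - 1" using n by (simp add: N_def of_nat_diff)
  have G1: "Gamma (N / 2 + 1) = N / 2 * Gamma (N / 2)"
    using N by (intro Gamma_plus1) (auto dest: nonpos_Ints_nonpos)
  have pos: "0 < Gamma (N / 2)" "0 < Gamma ((N + 1) / 2)" using N by (auto intro!: Gamma_real_pos)
  have b: "Beta (1 / 2) ((N + 1) / 2) * (N / 2) = sqrt pi * Gamma ((N + 1) / 2) / Gamma (N / 2)"
  proof -
    have "1 / 2 + (N + 1) / 2 = N / 2 + 1" by (simp add: field_simps)
    then show ?thesis using N pos by (simp add: Beta_def Gamma_one_half_real G1)
  qed
  have v: "unit_ball_vol (N - 1) = pi powr ((N - 1) / 2) / Gamma ((N + 1) / 2)"
  proof -
    have "(N - 1) / 2 + 1 = (N + 1) / 2" by (simp add: field_simps)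
    then show ?thesis by (simp only: unit_ball_vol_def)
  qed
  have "(2 * pi) powr (- N / 2) * (pi powr ((N - 1) / 2) * 2 powr (N / 2)) = pi powr (- 1 / 2)"
  proof -
    have "(2 * pi) powr (- N / 2) * (pi powr ((N - 1) / 2) * 2 powr (N / 2)) =
        (2 powr (- N / 2) * 2 powr (N / 2)) * (pi powr (- N / 2) * pi powr ((N - 1) / 2))"
      by (simp add: powr_mult mult_ac)
    also have "\<dots> = pi powr (- N / 2 + (N - 1) / 2)"
      by (simp add: powr_add[symmetric])
    also have "- N / 2 + (N - 1) / 2 = - 1 / 2" by (simp add: field_simps)
    finally show ?thesis .
  qed
  also have "pi powr (- 1 / 2) = 1 / sqrt pi"
    using powr_minus[of pi "1 / 2"] by (simp add: powr_half_sqrt inverse_eq_divide)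
  finally have k1: "(2 * pi) powr (- N / 2) * (pi powr ((N - 1) / 2) * 2 powr (N / 2)) = 1 / sqrt pi" .
  have "(2 * pi) powr (- N / 2) * cone_gauss_mass k a =
      ((2 * pi) powr (- N / 2) * (pi powr ((N - 1) / 2) * 2 powr (N / 2))) * (Gamma (N / 2) / Gamma ((N + 1) / 2)) *
      (exp (- a\<^sup>2 / 2) * hyp1F1 (N / 2) (1 / 2) (a\<^sup>2 / 2))"
  proof -
    have "q * (x / d * t * g * e * w) = q * (x * t) * (g / d) * (e * w)" for q x d t g e w :: real by simp
    then show ?thesis unfolding cone_gauss_mass_eq[OF n] n1 v N_def[symmetric] by (simp only:)
  qed
  also have "\<dots> = exp (- a\<^sup>2 / 2) * hyp1F1 (N / 2) (1 / 2) (a\<^sup>2 / 2) / (Beta (1 / 2) ((N + 1) / 2) * (N / 2))"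
  proof -
    have "1 / p * (g / d) * e = e / (p * d / g)" for p g d e :: real by simp
    then show ?thesis unfolding k1 b by (simp only:)
  qed
  finally show ?thesis unfolding N_def .
qed

section \<open>Cumulant generating function and saddlepoint of a quadratic form\<close>

text \<open>
  The convergence region of the moment generating function.
\<close>

definition mgf_domain :: "real ^ 'n \<Rightarrow> real set" where
  "mgf_domain d = {s. \<forall>i. 0 < 1 - 2 * s * d $ i}"

lemma open_mgf_domain: "open (mgf_domain d)"
proof -
  have "open {s. 0 < 1 - 2 * s * d $ i}" for i
    by (intro open_Collect_less continuous_intros)
  moreover have "mgf_domain d = (\<Inter>i\<in>UNIV. {s. 0 < 1 - 2 * s * d $ i})" by (auto simp: mgf_domain_def)
  ultimately show ?thesis by (simp add: open_INT)
qed

lemma qf_mgf_pos: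
  assumes "s \<in> mgf_domain d"
  shows "0 < qf_mgf d v s"
proof -
  have "2 * s * d $ i \<noteq> 1" for i using assms by (auto simp: mgf_domain_def dest!: spec[of _ i])
  then show ?thesis by (auto simp: qf_mgf_def intro!: mult_pos_pos prod_pos)
qed

lemma qf_cgf_eq:
  assumes "s \<in> mgf_domain d"
  shows "qf_cgf d v s = (\<Sum>i\<in>UNIV. - (1 / 2) * ln (1 - 2 * s * d $ i) + s * (d $ i * (v $ i)\<^sup>2 / (1 - 2 * s * d $ i)))"
proof -
  have p: "0 < 1 - 2 * s * d $ i" for i using assms by (simp add: mgf_domain_def)
  then have p1: "2 * s * d $ i \<noteq> 1" for i by (metis diff_self less_irrefl)
  have "qf_cgf d v s = ln (\<Prod>i\<in>UNIV. (1 - 2 * s * d $ i) powr (- 1 / 2)) + s * (\<Sum>i\<in>UNIV. d $ i * (v $ i)\<^sup>2 / (1 - 2 * s * d $ i))"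
    unfolding qf_cgf_def qf_mgf_def using p1 by (subst ln_mult_pos) (auto intro!: prod_pos)
  also have "ln (\<Prod>i\<in>UNIV. (1 - 2 * s * d $ i) powr (- 1 / 2)) = (\<Sum>i\<in>UNIV. - (1 / 2) * ln (1 - 2 * s * d $ i))"
    using p1 by (subst ln_prod) (auto simp: ln_powr)
  finally show ?thesis by (simp only: sum.distrib sum_distrib_left)
qed

definition cgf_deriv :: "real ^ 'n \<Rightarrow> real ^ 'n \<Rightarrow> real \<Rightarrow> real" where
  "cgf_deriv d v s = (\<Sum>i\<in>UNIV. d $ i / (1 - 2 * s * d $ i) + d $ i * (v $ i)\<^sup>2 / (1 - 2 * s * d $ i)\<^sup>2)"

definition cgf_deriv2 :: "real ^ 'n \<Rightarrow> real ^ 'n \<Rightarrow> real \<Rightarrow> real" where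
  "cgf_deriv2 d v s = (\<Sum>i\<in>UNIV. 2 * (d $ i)\<^sup>2 / (1 - 2 * s * d $ i)\<^sup>2 + 4 * (d $ i)\<^sup>2 * (v $ i)\<^sup>2 / (1 - 2 * s * d $ i) ^ 3)"

lemma has_real_derivative_qf_cgf:
  assumes s: "s \<in> mgf_domain d"
  shows "(qf_cgf d v has_real_derivative cgf_deriv d v s) (at s)"
proof -
  have "((\<lambda>s. \<Sum>i\<in>UNIV. - (1 / 2) * ln (1 - 2 * s * d $ i) + s * (d $ i * (v $ i)\<^sup>2 / (1 - 2 * s * d $ i)))
      has_real_derivative cgf_deriv d v s) (at s)"
    unfolding cgf_deriv_def
  proof (rule DERIV_sum)
    fix i
    define q where "q = 1 - 2 * s * d $ i"
    have q: "0 < q" using s by (simp add: mgf_domain_def q_def)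
    have 1: "((\<lambda>s. 1 - 2 * s * d $ i) has_real_derivative - 2 * d $ i) (at s)"
      by (auto intro!: derivative_eq_intros)
    have "((\<lambda>s. - (1 / 2) * ln (1 - 2 * s * d $ i) + s * (d $ i * (v $ i)\<^sup>2 / (1 - 2 * s * d $ i))) has_real_derivative
        - (1 / 2) * (1 / q * (- 2 * d $ i)) + (1 * (d $ i * (v $ i)\<^sup>2 / q) + (0 * q - (d $ i * (v $ i)\<^sup>2) * (- 2 * d $ i)) / (q * q) * s)) (at s)"
      unfolding q_def using q[unfolded q_def]
      by (intro DERIV_add DERIV_cmult DERIV_mult DERIV_ident DERIV_divide 1 DERIV_const DERIV_chain2[OF DERIV_ln_divide])
         auto
    moreover have "- (1 / 2) * (1 / q * (- 2 * d $ i)) + (1 * (d $ i * (v $ i)\<^sup>2 / q) + (0 * q - (d $ i * (v $ i)\<^sup>2) * (- 2 * d $ i)) / (q * q) * s) =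
        d $ i / q + d $ i * (v $ i)\<^sup>2 / q\<^sup>2"
    proof -
      have "d $ i * (v $ i)\<^sup>2 / q = d $ i * (v $ i)\<^sup>2 * q / q\<^sup>2" using q by (simp add: power2_eq_square)
      then have "(1 * (d $ i * (v $ i)\<^sup>2 / q) + (0 * q - (d $ i * (v $ i)\<^sup>2) * (- 2 * d $ i)) / (q * q) * s) =
          d $ i * (v $ i)\<^sup>2 * (q + 2 * s * d $ i) / q\<^sup>2"
        by (simp add: power2_eq_square add_divide_distrib algebra_simps)
      also have "q + 2 * s * d $ i = 1" by (simp add: q_def)
      finally show ?thesis by simp
    qed
    ultimately show "((\<lambda>s. - (1 / 2) * ln (1 - 2 * s * d $ i) + s * (d $ i * (v $ i)\<^sup>2 / (1 - 2 * s * d $ i))) has_real_derivative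
        d $ i / (1 - 2 * s * d $ i) + d $ i * (v $ i)\<^sup>2 / (1 - 2 * s * d $ i)\<^sup>2) (at s)"
      by (simp only: q_def)
  qed
  then show ?thesis
    by (rule has_field_derivative_transform_within_open[OF _ open_mgf_domain s]) (simp add: qf_cgf_eq)
qed

lemma has_real_derivative_cgf_deriv:
  assumes s: "s \<in> mgf_domain d"
  shows "(cgf_deriv d v has_real_derivative cgf_deriv2 d v s) (at s)"
  unfolding cgf_deriv_def[abs_def] cgf_deriv2_def
proof (rule DERIV_sum)
  fix i
  define q where "q = 1 - 2 * s * d $ i"
  have q: "0 < q" using s by (simp add: mgf_domain_def q_def)
  have 1: "((\<lambda>s. 1 - 2 * s * d $ i) has_real_derivative - 2 * d $ i) (at s)"
    by (auto intro!: derivative_eq_intros)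
  have 2: "((\<lambda>s. (1 - 2 * s * d $ i)\<^sup>2) has_real_derivative 2 * q * (- 2 * d $ i)) (at s)"
    by (auto intro!: derivative_eq_intros simp: q_def)
  have "((\<lambda>s. d $ i / (1 - 2 * s * d $ i) + d $ i * (v $ i)\<^sup>2 / (1 - 2 * s * d $ i)\<^sup>2) has_real_derivative
      (0 * q - d $ i * (- 2 * d $ i)) / (q * q) + (0 * q\<^sup>2 - (d $ i * (v $ i)\<^sup>2) * (2 * q * (- 2 * d $ i))) / (q\<^sup>2 * q\<^sup>2)) (at s)"
    unfolding q_def using q[unfolded q_def]
    by (intro DERIV_add DERIV_divide 1 2[unfolded q_def] DERIV_const) auto
  moreover have "(0 * q - d $ i * (- 2 * d $ i)) / (q * q) + (0 * q\<^sup>2 - (d $ i * (v $ i)\<^sup>2) * (2 * q * (- 2 * d $ i))) / (q\<^sup>2 * q\<^sup>2) =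
      2 * (d $ i)\<^sup>2 / q\<^sup>2 + 4 * (d $ i)\<^sup>2 * (v $ i)\<^sup>2 / q ^ 3"
    using q by (simp add: power2_eq_square power3_eq_cube mult_ac)
  ultimately show "((\<lambda>s. d $ i / (1 - 2 * s * d $ i) + d $ i * (v $ i)\<^sup>2 / (1 - 2 * s * d $ i)\<^sup>2) has_real_derivative
      2 * (d $ i)\<^sup>2 / (1 - 2 * s * d $ i)\<^sup>2 + 4 * (d $ i)\<^sup>2 * (v $ i)\<^sup>2 / (1 - 2 * s * d $ i) ^ 3) (at s)"
    by (simp only: q_def)
qed

lemma deriv_qf_cgf: "s \<in> mgf_domain d \<Longrightarrow> deriv (qf_cgf d v) s = cgf_deriv d v s"
  by (rule DERIV_imp_deriv[OF has_real_derivative_qf_cgf])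

lemma deriv2_qf_cgf:
  assumes s: "s \<in> mgf_domain d"
  shows "(deriv ^^ 2) (qf_cgf d v) s = cgf_deriv2 d v s"
proof -
  have "(deriv (qf_cgf d v) has_real_derivative cgf_deriv2 d v s) (at s)"
    by (rule has_field_derivative_transform_within_open[OF has_real_derivative_cgf_deriv[OF s] open_mgf_domain s])
      (simp add: deriv_qf_cgf)
  then show ?thesis by (simp add: numeral_2_eq_2 DERIV_imp_deriv)
qed

lemma cgf_deriv2_pos:
  assumes s: "s \<in> mgf_domain d" and k: "d $ k \<noteq> 0"
  shows "0 < cgf_deriv2 d v s"
  unfolding cgf_deriv2_def
proof (rule sum_pos2[of _ k])
  have p: "0 < 1 - 2 * s * d $ i" for i using s by (simp add: mgf_domain_def)
  show "0 < 2 * (d $ k)\<^sup>2 / (1 - 2 * s * d $ k)\<^sup>2 + 4 * (d $ k)\<^sup>2 * (v $ k)\<^sup>2 / (1 - 2 * s * d $ k) ^ 3"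
    using p[of k] k by (intro add_pos_nonneg divide_pos_pos divide_nonneg_pos) auto
  show "0 \<le> 2 * (d $ i)\<^sup>2 / (1 - 2 * s * d $ i)\<^sup>2 + 4 * (d $ i)\<^sup>2 * (v $ i)\<^sup>2 / (1 - 2 * s * d $ i) ^ 3" for i
    using p[of i] by (intro add_nonneg_nonneg divide_nonneg_pos) auto
qed auto

lemma saddlepoint_interval_subset:
  fixes d :: "real ^ ('n :: {finite, linorder})"
  assumes mono: "mono (\<lambda>i. d $ i)" and neg: "d $ Min UNIV < 0" and pos: "0 < d $ Max UNIV"
    and s: "1 / (2 * d $ Min UNIV) < s" "s < 1 / (2 * d $ Max UNIV)"
  shows "s \<in> mgf_domain d"
  unfolding mgf_domain_def
proof (clarify)
  fix i :: 'n
  have mn: "d $ Min UNIV \<le> d $ i" and mx: "d $ i \<le> d $ Max UNIV"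
    using mono by (auto simp: mono_def)
  show "0 < 1 - 2 * s * d $ i"
  proof (cases "0 \<le> s")
    case True
    have "s * d $ i \<le> s * d $ Max UNIV" using True mx by (intro mult_left_mono) auto
    moreover have "s * d $ Max UNIV < 1 / 2" using s(2) pos by (simp add: field_simps)
    ultimately show ?thesis by simp
  next
    case False
    have "s * d $ i \<le> s * d $ Min UNIV" using False mn by (intro mult_left_mono_neg) auto
    moreover have "s * d $ Min UNIV < 1 / 2" using s(1) neg by (simp add: field_simps)
    ultimately show ?thesis by simp
  qed
qed

text \<open>
  The derivative of the cumulant generating function is strictly increasing, so any root in the
  interval is the saddlepoint.
\<close>

lemma saddlepoint_eqI:
  fixes d :: "real ^ ('n :: {finite, linorder})"
  assumes mono: "mono (\<lambda>i. d $ i)" and neg: "d $ Min UNIV < 0" and pos: "0 < d $ Max UNIV"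
    and s: "1 / (2 * d $ Min UNIV) < s" "s < 1 / (2 * d $ Max UNIV)" "cgf_deriv d v s = 0"
  shows "saddlepoint d v = s"
  unfolding saddlepoint_def
proof (rule the_equality)
  note dom = saddlepoint_interval_subset[OF mono neg pos]
  show "1 / (2 * d $ Min UNIV) < s \<and> s < 1 / (2 * d $ Max UNIV) \<and> deriv (qf_cgf d v) s = 0"
    using s dom[OF s(1,2)] by (simp add: deriv_qf_cgf)
  have inc: "cgf_deriv d v a < cgf_deriv d v b"
    if "1 / (2 * d $ Min UNIV) < a" "a < b" "b < 1 / (2 * d $ Max UNIV)" for a b
  proof (rule DERIV_pos_imp_increasing[OF that(2)])
    fix x assume "a \<le> x" "x \<le> b"
    then have x: "x \<in> mgf_domain d" using that by (intro dom) auto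
    show "\<exists>y. (cgf_deriv d v has_real_derivative y) (at x) \<and> 0 < y"
      using has_real_derivative_cgf_deriv[OF x] cgf_deriv2_pos[OF x, of "Max UNIV"] pos by auto
  qed
  fix s' assume s': "1 / (2 * d $ Min UNIV) < s' \<and> s' < 1 / (2 * d $ Max UNIV) \<and> deriv (qf_cgf d v) s' = 0"
  then have "cgf_deriv d v s' = 0" using dom[of s'] by (simp add: deriv_qf_cgf)
  then show "s' = s"
    using inc[of s s'] inc[of s' s] s s' by (cases s s' rule: linorder_cases) auto
qed

text \<open>
  The third property is the quadratic equation for \<open>1 - 2 t\<^sub>0\<close> of which \<open>edge_t\<close> is the explicit root.
\<close>

lemma edge_t_props:
  fixes n :: nat and \<nu>0 :: real
  assumes n: "2 \<le> n"
  defines "y \<equiv> 1 - 2 * edge_t n \<nu>0"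
  shows "0 < edge_t n \<nu>0" "edge_t n \<nu>0 < 1 / 2" "real n * y\<^sup>2 + (\<nu>0\<^sup>2 - 1) * y - \<nu>0\<^sup>2 = 0"
proof -
  define N where "N = real n"
  define w where "w = \<nu>0\<^sup>2"
  have N: "2 \<le> N" using n by (simp add: N_def)
  have w: "0 \<le> w" by (simp add: w_def)
  define \<Delta> where "\<Delta> = (w - 1)\<^sup>2 + 4 * N * w"
  have \<Delta>: "(w + 2 * N - 1)\<^sup>2 - (2 * N - 1)\<^sup>2 + 1 = \<Delta>"
    by (simp add: \<Delta>_def power2_eq_square algebra_simps)
  have t: "edge_t n \<nu>0 = 1 / (4 * N) * (2 * N - 1 + w - sqrt \<Delta>)"
    unfolding edge_t_def N_def[symmetric] w_def[symmetric] \<Delta> ..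
  have y: "2 * N * y = 1 - w + sqrt \<Delta>"
    unfolding y_def t using N by (simp add: field_simps)
  have \<Delta>0: "0 \<le> \<Delta>" using N w by (simp add: \<Delta>_def)
  have "(2 * N * y - (1 - w))\<^sup>2 = \<Delta>" unfolding y using \<Delta>0 by simp
  then have "4 * N * (N * y\<^sup>2 + (w - 1) * y - w) = 0"
    by (simp add: \<Delta>_def power2_eq_square algebra_simps)
  then show "real n * y\<^sup>2 + (\<nu>0\<^sup>2 - 1) * y - \<nu>0\<^sup>2 = 0"
    using N by (simp add: N_def w_def)
  have "sqrt \<Delta> < 2 * N - 1 + w"
  proof (rule real_less_lsqrt)
    have "1 < (2 * N - 1)\<^sup>2" using N by (intro one_less_power) auto
    then show "\<Delta> < (2 * N - 1 + w)\<^sup>2" unfolding \<Delta>[symmetric] by (simp add: algebra_simps)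
  qed (use N w in auto)
  then show "0 < edge_t n \<nu>0" unfolding t using N by simp
  have "w - 1 < sqrt \<Delta>"
  proof (cases "w < 1")
    case True
    then show ?thesis using \<Delta>0 by (meson diff_less_0_iff_less less_le_trans real_sqrt_ge_zero)
  next
    case False
    then show ?thesis using N by (intro real_less_rsqrt) (simp add: \<Delta>_def)
  qed
  then have "0 < 2 * N * y" unfolding y by simp
  then have "0 < y" using N by (simp add: zero_less_mult_iff)
  then show "edge_t n \<nu>0 < 1 / 2" by (simp add: y_def)
qed

text \<open>
  The limit of \<open>s K'(s)\<close> at \<open>s = t / \<lambda>\<^sub>n\<close>: the top eigenvalue contributes the two fractions, and each of the
  other eigenvalues contributes \<open>- 1 / 2\<close>.
\<close>

definition edge_equation :: "nat \<Rightarrow> real \<Rightarrow> real \<Rightarrow> real" where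
  "edge_equation n \<nu>0 t = t / (1 - 2 * t) + \<nu>0\<^sup>2 * t / (1 - 2 * t)\<^sup>2 - (real n - 1) / 2"

lemma edge_equation_root:
  assumes n: "2 \<le> n"
  shows "edge_equation n \<nu>0 (edge_t n \<nu>0) = 0"
proof -
  define t where "t = edge_t n \<nu>0"
  define y where "y = 1 - 2 * t"
  have y: "0 < y" and t: "t = (1 - y) / 2"
    using edge_t_props(2)[OF n, of \<nu>0] by (auto simp: y_def t_def)
  have "edge_equation n \<nu>0 t = ((1 - y) * y + \<nu>0\<^sup>2 * (1 - y) - (real n - 1) * y\<^sup>2) / (2 * y\<^sup>2)"
    unfolding edge_equation_def y_def[symmetric] unfolding t
    using y by (simp add: field_simps power2_eq_square)
  also have "(1 - y) * y + \<nu>0\<^sup>2 * (1 - y) - (real n - 1) * y\<^sup>2 = - (real n * y\<^sup>2 + (\<nu>0\<^sup>2 - 1) * y - \<nu>0\<^sup>2)"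
    by (simp add: algebra_simps power2_eq_square)
  also have "\<dots> = 0"
    using edge_t_props(3)[OF n, of \<nu>0] by (simp add: y_def t_def)
  finally show ?thesis by (simp add: t_def)
qed

lemma edge_equation_strict_mono:
  assumes "0 < t" "t < t'" "t' < 1 / 2"
  shows "edge_equation n \<nu>0 t < edge_equation n \<nu>0 t'"
proof -
  have "t / (1 - 2 * t) < t' / (1 - 2 * t')"
    using assms by (intro frac_less) auto
  moreover have "t / (1 - 2 * t)\<^sup>2 \<le> t' / (1 - 2 * t')\<^sup>2"
    using assms by (intro frac_le power_mono) auto
  then have "\<nu>0\<^sup>2 * (t / (1 - 2 * t)\<^sup>2) \<le> \<nu>0\<^sup>2 * (t' / (1 - 2 * t')\<^sup>2)"
    by (rule mult_left_mono) simp
  ultimately show ?thesis by (simp add: edge_equation_def)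
qed

section \<open>Mills ratio and the Jacobian factor\<close>

text \<open>
  On \<open>[w, \<infinity>)\<close> the density is at most \<open>x / w\<close> times itself, which has an elementary primitive.
\<close>

lemma mills_bound:
  assumes w: "0 < w"
  shows "0 \<le> 1 - cdf std_normal_distribution w"
    and "1 - cdf std_normal_distribution w \<le> std_normal_density w / w"
proof -
  interpret N: prob_space std_normal_distribution
    by (rule prob_space_normal_density) simp
  have sp: "space std_normal_distribution = UNIV" by simp
  have "measure std_normal_distribution (space std_normal_distribution - {..w}) = 1 - cdf std_normal_distribution w"
    unfolding cdf_def by (rule N.prob_compl) simp
  then have c: "1 - cdf std_normal_distribution w = measure std_normal_distribution {w<..}"
    unfolding sp by (simp add: Compl_eq_Diff_UNIV[symmetric])
  show "0 \<le> 1 - cdf std_normal_distribution w" unfolding c by simp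
  have "ennreal (measure std_normal_distribution {w<..}) = emeasure std_normal_distribution {w<..}"
    by (simp add: N.emeasure_eq_measure)
  also have "\<dots> = (\<integral>\<^sup>+x. ennreal (std_normal_density x) * indicator {w<..} x \<partial>lborel)"
    by (subst emeasure_density) auto
  also have "\<dots> \<le> (\<integral>\<^sup>+x. ennreal (x / w * std_normal_density x) * indicator {w..} x \<partial>lborel)"
  proof (rule nn_integral_mono)
    fix x :: real
    have "1 * std_normal_density x \<le> x / w * std_normal_density x" if "w < x"
      using that w by (intro mult_right_mono) auto
    then show "ennreal (std_normal_density x) * indicator {w<..} x \<le> ennreal (x / w * std_normal_density x) * indicator {w..} x"
      by (auto simp: indicator_def intro!: ennreal_leI)
  qed
  also have "\<dots> = ennreal (0 - (- std_normal_density w / w))"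
  proof (rule nn_integral_FTC_atLeast[where F = "\<lambda>x. - std_normal_density x / w"])
    show "((\<lambda>x. - std_normal_density x / w) has_real_derivative x / w * std_normal_density x) (at x)" if "w \<le> x" for x
      using w unfolding std_normal_density_def
      by (auto intro!: derivative_eq_intros simp: field_simps)
    show "0 \<le> x / w * std_normal_density x" if "w \<le> x" for x
      using that w by simp
    have "((\<lambda>x :: real. - (1 / sqrt (2 * pi) * exp (- x\<^sup>2 / 2)) / w) \<longlongrightarrow> - (1 / sqrt (2 * pi) * 0) / w) at_top"
    proof (intro tendsto_intros)
      have "filterlim (\<lambda>x :: real. - (x\<^sup>2 / 2)) at_bot at_top"
        unfolding filterlim_uminus_at_bot minus_minus
        by (rule filterlim_at_top_mono[OF filterlim_ident]) 
          (auto intro!: eventually_at_top_linorderI[of 2] simp: power2_eq_square)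
      then show "((\<lambda>x :: real. exp (- x\<^sup>2 / 2)) \<longlongrightarrow> 0) at_top"
        by (auto intro!: filterlim_compose[OF exp_at_bot])
    qed (use w in auto)
    then show "((\<lambda>x. - std_normal_density x / w) \<longlongrightarrow> 0) at_top"
      by (simp add: std_normal_density_def)
  qed simp
  finally have "ennreal (measure std_normal_distribution {w<..}) \<le> ennreal (std_normal_density w / w)" by simp
  then show "1 - cdf std_normal_distribution w \<le> std_normal_density w / w"
    unfolding c using w by (simp add: ennreal_le_iff)
qed

lemma mills_ratio_tendsto_0:
  assumes w: "filterlim w at_top F"
  shows "((\<lambda>r. (1 - cdf std_normal_distribution (w r)) / std_normal_density (w r)) \<longlongrightarrow> 0) F"
proof (rule Lim_null_comparison)
  show "((\<lambda>r. 1 / w r) \<longlongrightarrow> 0) F"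
    using tendsto_inverse_0_at_top[OF w] by (simp add: inverse_eq_divide)
  show "\<forall>\<^sub>F r in F. norm ((1 - cdf std_normal_distribution (w r)) / std_normal_density (w r)) \<le> 1 / w r"
    using filterlim_at_top_dense[THEN iffD1, OF w, rule_format, of 0]
  proof eventually_elim
    case (elim r)
    have p: "0 < std_normal_density (w r)" by (rule normal_density_pos) simp
    show ?case using mills_bound[OF elim] p elim by (simp add: abs_divide field_simps)
  qed
qed

lemma matrix_inv_diag_mat:
  fixes d :: "real ^ 'n"
  assumes nz: "\<And>i. d $ i \<noteq> 0"
  shows "matrix_inv (diag_mat d) = diag_mat (\<chi> i. 1 / d $ i)"
proof -
  have 1: "diag_mat d ** diag_mat (\<chi> i. 1 / d $ i) = mat 1" "diag_mat (\<chi> i. 1 / d $ i) ** diag_mat d = mat 1"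
    using nz by (simp_all add: matrix_eq matrix_vector_mul_assoc[symmetric] vec_eq_iff)
  have "diag_mat d ** matrix_inv (diag_mat d) = mat 1 \<and> matrix_inv (diag_mat d) ** diag_mat d = mat 1"
    unfolding matrix_inv_def by (rule someI[of _ "diag_mat (\<chi> i. 1 / d $ i)"]) (use 1 in blast)
  then have "diag_mat (\<chi> i. 1 / d $ i) ** (diag_mat d ** matrix_inv (diag_mat d)) = diag_mat (\<chi> i. 1 / d $ i)"
    by simp
  then show ?thesis unfolding matrix_mul_assoc 1 by simp
qed

lemma sp_J_eq:
  fixes d v :: "real ^ 'n"
  assumes s: "s \<in> mgf_domain d"
  defines "p \<equiv> \<lambda>i. 1 / (1 - 2 * s * d $ i)"
  shows "sp_J d v H s = (\<Sum>i\<in>UNIV. p i * H $ i $ i) + (\<Sum>i\<in>UNIV. \<Sum>j\<in>UNIV. v $ i * v $ j * p i * p j * H $ i $ j)"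
proof -
  have nz: "(\<chi> i. 1 - 2 * s * d $ i) $ i \<noteq> 0" for i
    using s by (auto simp: mgf_domain_def dest!: spec[of _ i])
  have "mat 1 - (2 * s) *\<^sub>R diag_mat d = diag_mat (\<chi> i. 1 - 2 * s * d $ i)"
    by (auto simp: mat_def diag_mat_def vec_eq_iff)
  then have Q: "matrix_inv (mat 1 - (2 * s) *\<^sub>R diag_mat d) = diag_mat (\<chi> i. p i)"
    using matrix_inv_diag_mat[OF nz] by (simp add: p_def)
  have m: "(diag_mat (\<chi> i. p i) ** H) $ i $ j = p i * H $ i $ j" for i j
    by (simp add: matrix_matrix_mult_def diag_mat_def if_distrib[of "\<lambda>u. u * _"] cong: if_cong)
  have "v \<bullet> ((diag_mat (\<chi> i. p i) ** H ** diag_mat (\<chi> i. p i)) *v v) =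
      (\<Sum>i\<in>UNIV. \<Sum>j\<in>UNIV. v $ i * v $ j * p i * p j * H $ i $ j)"
    unfolding matrix_vector_mul_assoc[symmetric] inner_vec_def
    by (intro sum.cong refl) (simp add: matrix_vector_mult_def[of H] sum_distrib_left mult_ac)
  then show ?thesis
    unfolding sp_J_def Let_def Q by (simp add: trace_def m)
qed

section \<open>The saddlepoint near the edge\<close>

lemma UNIV_minus_nonempty:
  assumes "2 \<le> CARD('n :: finite)"
  shows "UNIV - {k :: 'n} \<noteq> {}"
proof
  assume "UNIV - {k} = {}"
  then have "CARD('n) \<le> card {k}" by (intro card_mono) auto
  then show False using assms by simp
qed

text \<open>
  The coordinate scales that make a quadratic form with a single positive eigenvalue \<open>e $ k\<close> proportional
  to the Lorentz form.
\<close>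

definition edge_scales :: "'n :: finite \<Rightarrow> real ^ 'n \<Rightarrow> real ^ 'n" where
  "edge_scales k e = (\<chi> i. if i = k then 1 else sqrt (e $ k / - e $ i))"

lemma edge_scales_pos:
  assumes "0 < e $ k" "\<And>i. i \<noteq> k \<Longrightarrow> e $ i < 0"
  shows "0 < edge_scales k e $ i"
proof -
  have "0 < e $ k / - e $ i" if "i \<noteq> k" using assms that by (intro divide_pos_pos) auto
  then show ?thesis by (simp add: edge_scales_def)
qed

text \<open>
  The behaviour of the eigenvalues \<open>d r\<close> and noncentralities \<open>v r\<close> near the edge on which the asymptotics
  of the saddlepoint approximations rest.
\<close>

locale edge_spectrum =
  fixes \<rho> :: ereal and d v :: "real \<Rightarrow> real ^ ('n :: {finite, linorder})" and B c \<nu>0 :: real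
  assumes n2: "2 \<le> CARD('n)"
    and mono_d: "\<forall>\<^sub>F r in at_edge \<rho>. mono (\<lambda>i. d r $ i)"
    and top_pos: "\<forall>\<^sub>F r in at_edge \<rho>. 0 < d r $ Max UNIV"
    and top_lim: "((\<lambda>r. d r $ Max UNIV) \<longlongrightarrow> 0) (at_edge \<rho>)"
    and c_pos: "0 < c"
    and rest_neg: "\<forall>\<^sub>F r in at_edge \<rho>. \<forall>i. i \<noteq> Max UNIV \<longrightarrow> d r $ i \<le> - c"
    and vB: "\<forall>\<^sub>F r in at_edge \<rho>. norm (v r) \<le> B"
    and v_top: "((\<lambda>r. (v r $ Max UNIV)\<^sup>2) \<longlongrightarrow> \<nu>0\<^sup>2) (at_edge \<rho>)"
begin

abbreviation (input) k :: 'n where "k \<equiv> Max UNIV"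

definition saddle :: "real \<Rightarrow> real" where
  "saddle r = saddlepoint (d r) (v r)"

abbreviation scales :: "real \<Rightarrow> real ^ 'n::_" where
  "scales r \<equiv> edge_scales k (d r)"

text \<open>
  The common order of magnitude of the tail probability and of the moment generating function at the
  saddlepoint.
\<close>

definition edge_scale :: "real \<Rightarrow> real" where
  "edge_scale r = (\<Prod>i\<in>UNIV. scales r $ i) * exp (- (\<Sum>i\<in>UNIV - {k}. (v r $ i)\<^sup>2) / 2)"

lemma Min_neq_Max: "Min (UNIV :: 'n set) \<noteq> Max UNIV"
proof
  assume eq: "Min (UNIV :: 'n set) = Max UNIV"
  obtain i :: 'n where "i \<noteq> Max UNIV" using UNIV_minus_nonempty[OF n2, of "Max UNIV"] by blast
  then show False using eq by (metis Min_le Max_ge UNIV_I finite order_antisym)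
qed

lemma null_mult_v:
  assumes "(f \<longlongrightarrow> 0) (at_edge \<rho>)"
  shows "((\<lambda>r. (v r $ i)\<^sup>2 * f r) \<longlongrightarrow> 0) (at_edge \<rho>)"
proof (rule Lim_null_comparison)
  show "\<forall>\<^sub>F r in at_edge \<rho>. norm ((v r $ i)\<^sup>2 * f r) \<le> B\<^sup>2 * \<bar>f r\<bar>"
    using vB
  proof eventually_elim
    case (elim r)
    have "\<bar>v r $ i\<bar> \<le> B" using component_le_norm_cart[of "v r" i] elim by linarith
    then have "(v r $ i)\<^sup>2 \<le> B\<^sup>2" by (metis abs_ge_zero power2_abs power_mono)
    then show ?case by (simp add: abs_mult mult_right_mono)
  qed
  show "((\<lambda>r. B\<^sup>2 * \<bar>f r\<bar>) \<longlongrightarrow> 0) (at_edge \<rho>)"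
    using tendsto_mult_right_zero[OF tendsto_rabs_zero[OF assms]] by simp
qed

text \<open>
  The variance of the coordinate \<open>i\<close> after exponential tilting by \<open>S r\<close>.  For \<open>S r\<close> of order \<open>1 / \<lambda>\<^sub>n\<close> it
  tends to \<open>0\<close> in all directions but the top one.
\<close>

definition tilt :: "(real \<Rightarrow> real) \<Rightarrow> 'n \<Rightarrow> real \<Rightarrow> real" where
  "tilt S i r = 1 / (1 - 2 * S r * d r $ i)"

context
  fixes S :: "real \<Rightarrow> real" and t :: real
  assumes S: "((\<lambda>r. S r * d r $ k) \<longlongrightarrow> t) (at_edge \<rho>)" and t: "0 < t" "t < 1 / 2"
begin

lemma S_pos: "\<forall>\<^sub>F r in at_edge \<rho>. 0 < S r \<and> S r * d r $ k < 1 / 2 \<and> t / 2 < S r * d r $ k"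
proof -
  have "t / 2 < t" using t by simp
  from order_tendstoD(1)[OF S this] order_tendstoD(2)[OF S t(2)] top_pos show ?thesis
  proof eventually_elim
    case (elim r)
    then have "0 < S r * d r $ k" using t by simp
    then show ?case using elim by (simp add: zero_less_mult_iff)
  qed
qed

lemma S_domain: "\<forall>\<^sub>F r in at_edge \<rho>. 1 / (2 * d r $ Min UNIV) < S r \<and> S r < 1 / (2 * d r $ k) \<and> S r \<in> mgf_domain (d r)"
  using S_pos mono_d top_pos rest_neg
proof eventually_elim
  case (elim r)
  have neg: "d r $ Min UNIV < 0" using elim(4) Min_neq_Max c_pos by force
  have 1: "1 / (2 * d r $ Min UNIV) < S r"
  proof -
    have "1 / (2 * d r $ Min UNIV) < 0" using neg by (simp add: divide_less_0_iff)
    then show ?thesis using elim by linarith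
  qed
  have 2: "S r < 1 / (2 * d r $ k)" using elim by (simp add: field_simps)
  from 1 2 saddlepoint_interval_subset[OF elim(2) neg elim(3) 1 2] show ?case by simp
qed

lemma tilt_pos: "\<forall>\<^sub>F r in at_edge \<rho>. \<forall>i. 0 < tilt S i r"
  using S_domain by eventually_elim (auto simp: tilt_def mgf_domain_def)

lemma tilt_rest: 
  assumes "i \<noteq> k"
  shows "(tilt S i \<longlongrightarrow> 0) (at_edge \<rho>)"
proof (rule Lim_null_comparison)
  show "\<forall>\<^sub>F r in at_edge \<rho>. norm (tilt S i r) \<le> d r $ k / (t * c)"
    using S_pos rest_neg top_pos
  proof eventually_elim
    case (elim r)
    have "t * c / d r $ k \<le> 2 * S r * c"
    proof -
      have "t \<le> 2 * (S r * d r $ k)" using elim by simp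
      then have "t * c \<le> 2 * (S r * d r $ k) * c" using c_pos by (intro mult_right_mono) auto
      then show ?thesis using elim by (simp add: field_simps)
    qed
    also have "\<dots> \<le> 2 * S r * (- d r $ i)"
      using elim assms by (intro mult_left_mono) auto
    also have "\<dots> \<le> 1 - 2 * S r * d r $ i" by simp
    finally have "t * c / d r $ k \<le> 1 - 2 * S r * d r $ i" .
    moreover have "0 < t * c / d r $ k" using t c_pos elim by simp
    ultimately have "1 / (1 - 2 * S r * d r $ i) \<le> 1 / (t * c / d r $ k)" "0 < 1 - 2 * S r * d r $ i"
      by (auto intro!: frac_le simp del: divide_divide_eq_right)
    then show ?case by (simp add: tilt_def)
  qed
  show "((\<lambda>r. d r $ k / (t * c)) \<longlongrightarrow> 0) (at_edge \<rho>)"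
    using tendsto_divide_zero[OF top_lim, of "t * c"] .
qed

lemma tilt_top: "(tilt S k \<longlongrightarrow> 1 / (1 - 2 * t)) (at_edge \<rho>)"
proof -
  have "((\<lambda>r. 1 / (1 - 2 * (S r * d r $ k))) \<longlongrightarrow> 1 / (1 - 2 * t)) (at_edge \<rho>)"
    using t by (intro tendsto_intros S) auto
  then show ?thesis by (simp add: tilt_def[abs_def] mult.assoc)
qed

lemma S_d_tilt: "\<forall>\<^sub>F r in at_edge \<rho>. \<forall>i. S r * d r $ i * tilt S i r = (tilt S i r - 1) / 2"
  using S_domain
proof eventually_elim
  case (elim r)
  show ?case
  proof
    fix i
    define q where "q = 1 - 2 * S r * d r $ i"
    have "0 < q" using elim by (auto simp: mgf_domain_def q_def)
    moreover have "S r * d r $ i = (1 - q) / 2" by (simp add: q_def)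
    ultimately show "S r * d r $ i * tilt S i r = (tilt S i r - 1) / 2"
      by (simp add: tilt_def q_def[symmetric] diff_divide_distrib)
  qed
qed

lemma sum_split_top: "(\<Sum>i\<in>UNIV. if i = k then x else (y :: real)) = x + (real CARD('n) - 1) * y"
proof -
  have "(\<Sum>i\<in>UNIV. if i = k then x else y) = x + (\<Sum>i\<in>UNIV - {k}. y)"
    by (simp add: sum.remove[of UNIV k])
  also have "(\<Sum>i\<in>UNIV - {k}. y) = (real CARD('n) - 1) * y"
    using n2 by (simp add: card_Diff_singleton of_nat_diff)
  finally show ?thesis .
qed

text \<open>
  By \<open>S_d_tilt\<close> each summand is a polynomial in the tilted variance and the squared noncentrality.  Below
  the top coordinate the noncentralities are only bounded, but they occur with a vanishing factor.
\<close>

lemma scaled_cgf_deriv_tendsto: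
  "((\<lambda>r. S r * cgf_deriv (d r) (v r) (S r)) \<longlongrightarrow> edge_equation CARD('n) \<nu>0 t) (at_edge \<rho>)"
proof -
  have "((\<lambda>r. \<Sum>i\<in>UNIV. (tilt S i r - 1) / 2 + (v r $ i)\<^sup>2 * (tilt S i r * ((tilt S i r - 1) / 2))) \<longlongrightarrow>
      (\<Sum>i\<in>UNIV. if i = k then (1 / (1 - 2 * t) - 1) / 2 + \<nu>0\<^sup>2 * (1 / (1 - 2 * t) * ((1 / (1 - 2 * t) - 1) / 2))
         else - 1 / 2)) (at_edge \<rho>)"
  proof (rule tendsto_sum)
    fix i
    show "((\<lambda>r. (tilt S i r - 1) / 2 + (v r $ i)\<^sup>2 * (tilt S i r * ((tilt S i r - 1) / 2))) \<longlongrightarrow>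
      (if i = k then (1 / (1 - 2 * t) - 1) / 2 + \<nu>0\<^sup>2 * (1 / (1 - 2 * t) * ((1 / (1 - 2 * t) - 1) / 2))
         else - 1 / 2)) (at_edge \<rho>)"
    proof (cases "i = k")
      case True
      then show ?thesis by (simp only: if_True refl) (intro tendsto_intros tilt_top v_top, auto)
    next
      case False
      have 0: "((\<lambda>r. tilt S i r * ((tilt S i r - 1) / 2)) \<longlongrightarrow> 0 * ((0 - 1) / 2)) (at_edge \<rho>)"
        by (intro tendsto_intros tilt_rest False) auto
      have "((\<lambda>r. (tilt S i r - 1) / 2 + (v r $ i)\<^sup>2 * (tilt S i r * ((tilt S i r - 1) / 2))) \<longlongrightarrow> (0 - 1) / 2 + 0) (at_edge \<rho>)"
        using 0 by (intro tendsto_add null_mult_v tendsto_divide tendsto_diff tilt_rest False tendsto_const) auto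
      then show ?thesis using False by simp
    qed
  qed
  moreover have "(\<Sum>i\<in>UNIV. if i = k then (1 / (1 - 2 * t) - 1) / 2 + \<nu>0\<^sup>2 * (1 / (1 - 2 * t) * ((1 / (1 - 2 * t) - 1) / 2))
         else - 1 / 2) = edge_equation CARD('n) \<nu>0 t"
  proof -
    have "(1 / (1 - 2 * t) - 1) / 2 = t / (1 - 2 * t)" using t by (simp add: field_simps)
    then show ?thesis unfolding sum_split_top edge_equation_def by (simp only:) (simp add: power2_eq_square)
  qed
  moreover have "\<forall>\<^sub>F r in at_edge \<rho>. (\<Sum>i\<in>UNIV. (tilt S i r - 1) / 2 + (v r $ i)\<^sup>2 * (tilt S i r * ((tilt S i r - 1) / 2))) =
      S r * cgf_deriv (d r) (v r) (S r)"
    using S_d_tilt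
  proof eventually_elim
    case (elim r)
    have "S r * (d r $ i / (1 - 2 * S r * d r $ i) + d r $ i * (v r $ i)\<^sup>2 / (1 - 2 * S r * d r $ i)\<^sup>2) =
        (tilt S i r - 1) / 2 + (v r $ i)\<^sup>2 * (tilt S i r * ((tilt S i r - 1) / 2))" for i
    proof -
      have "S r * (d r $ i / (1 - 2 * S r * d r $ i) + d r $ i * (v r $ i)\<^sup>2 / (1 - 2 * S r * d r $ i)\<^sup>2) =
          (S r * d r $ i * tilt S i r) + (v r $ i)\<^sup>2 * (tilt S i r * (S r * d r $ i * tilt S i r))"
        by (simp add: tilt_def power2_eq_square distrib_left)
      then show ?thesis using elim by simp
    qed
    then show ?case unfolding cgf_deriv_def sum_distrib_left by simp
  qed
  ultimately show ?thesis by (simp add: tendsto_cong)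
qed

lemma scaled_cgf_deriv2_tendsto:
  "((\<lambda>r. (S r)\<^sup>2 * cgf_deriv2 (d r) (v r) (S r)) \<longlongrightarrow>
     (real CARD('n) - 1) / 2 + 2 * t\<^sup>2 / (1 - 2 * t)\<^sup>2 + 4 * \<nu>0\<^sup>2 * t\<^sup>2 / (1 - 2 * t) ^ 3) (at_edge \<rho>)"
proof -
  let ?L = "2 * ((1 / (1 - 2 * t) - 1) / 2)\<^sup>2 + \<nu>0\<^sup>2 * (4 * (1 / (1 - 2 * t)) * ((1 / (1 - 2 * t) - 1) / 2)\<^sup>2)"
  have "((\<lambda>r. \<Sum>i\<in>UNIV. 2 * ((tilt S i r - 1) / 2)\<^sup>2 + (v r $ i)\<^sup>2 * (4 * tilt S i r * ((tilt S i r - 1) / 2)\<^sup>2)) \<longlongrightarrow>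
      (\<Sum>i\<in>UNIV. if i = k then ?L else 1 / 2)) (at_edge \<rho>)"
  proof (rule tendsto_sum)
    fix i
    show "((\<lambda>r. 2 * ((tilt S i r - 1) / 2)\<^sup>2 + (v r $ i)\<^sup>2 * (4 * tilt S i r * ((tilt S i r - 1) / 2)\<^sup>2)) \<longlongrightarrow>
      (if i = k then ?L else 1 / 2)) (at_edge \<rho>)"
    proof (cases "i = k")
      case True
      then show ?thesis by (simp only: if_True refl) (intro tendsto_intros tilt_top v_top, auto)
    next
      case False
      have 0: "((\<lambda>r. 4 * tilt S i r * ((tilt S i r - 1) / 2)\<^sup>2) \<longlongrightarrow> 4 * 0 * ((0 - 1) / 2)\<^sup>2) (at_edge \<rho>)"
        by (intro tendsto_intros tilt_rest False) auto
      have "((\<lambda>r. 2 * ((tilt S i r - 1) / 2)\<^sup>2 + (v r $ i)\<^sup>2 * (4 * tilt S i r * ((tilt S i r - 1) / 2)\<^sup>2)) \<longlongrightarrow> 2 * ((0 - 1) / 2)\<^sup>2 + 0) (at_edge \<rho>)"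
        using 0 by (intro tendsto_add null_mult_v tendsto_divide tendsto_mult tendsto_power tendsto_diff tilt_rest False tendsto_const) auto
      then show ?thesis using False by (simp add: power2_eq_square)
    qed
  qed
  moreover have "(\<Sum>i\<in>UNIV. if i = k then ?L else 1 / 2) =
     (real CARD('n) - 1) / 2 + 2 * t\<^sup>2 / (1 - 2 * t)\<^sup>2 + 4 * \<nu>0\<^sup>2 * t\<^sup>2 / (1 - 2 * t) ^ 3"
  proof -
    have "(1 / (1 - 2 * t) - 1) / 2 = t / (1 - 2 * t)" using t by (simp add: field_simps)
    then show ?thesis unfolding sum_split_top by (simp only:) (simp add: power2_eq_square power3_eq_cube mult_ac)
  qed
  moreover have "\<forall>\<^sub>F r in at_edge \<rho>. (\<Sum>i\<in>UNIV. 2 * ((tilt S i r - 1) / 2)\<^sup>2 + (v r $ i)\<^sup>2 * (4 * tilt S i r * ((tilt S i r - 1) / 2)\<^sup>2)) =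
      (S r)\<^sup>2 * cgf_deriv2 (d r) (v r) (S r)"
    using S_d_tilt
  proof eventually_elim
    case (elim r)
    have "(S r)\<^sup>2 * (2 * (d r $ i)\<^sup>2 / (1 - 2 * S r * d r $ i)\<^sup>2 + 4 * (d r $ i)\<^sup>2 * (v r $ i)\<^sup>2 / (1 - 2 * S r * d r $ i) ^ 3) =
        2 * ((tilt S i r - 1) / 2)\<^sup>2 + (v r $ i)\<^sup>2 * (4 * tilt S i r * ((tilt S i r - 1) / 2)\<^sup>2)" for i
    proof -
      have "(S r)\<^sup>2 * (2 * (d r $ i)\<^sup>2 / (1 - 2 * S r * d r $ i)\<^sup>2 + 4 * (d r $ i)\<^sup>2 * (v r $ i)\<^sup>2 / (1 - 2 * S r * d r $ i) ^ 3) =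
          2 * (S r * d r $ i * tilt S i r)\<^sup>2 + (v r $ i)\<^sup>2 * (4 * tilt S i r * (S r * d r $ i * tilt S i r)\<^sup>2)"
        by (simp add: tilt_def power2_eq_square power3_eq_cube distrib_left mult_ac)
      then show ?thesis using elim by simp
    qed
    then show ?case unfolding cgf_deriv2_def sum_distrib_left by simp
  qed
  ultimately show ?thesis by (simp add: tendsto_cong)
qed

end

text \<open>
  For \<open>t1 < t\<^sub>0 < t2\<close> the scaled derivative has opposite signs at \<open>t1 / \<lambda>\<^sub>n\<close> and \<open>t2 / \<lambda>\<^sub>n\<close> near the edge, so
  the intermediate value theorem encloses the saddlepoint.
\<close>

lemma saddle_limit: "((\<lambda>r. saddle r * d r $ k) \<longlongrightarrow> edge_t CARD('n) \<nu>0) (at_edge \<rho>)"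
proof -
  let ?t0 = "edge_t CARD('n) \<nu>0"
  note t0 = edge_t_props(1,2)[OF n2, of \<nu>0]
  have key: "\<forall>\<^sub>F r in at_edge \<rho>. t1 \<le> saddle r * d r $ k \<and> saddle r * d r $ k \<le> t2"
    if t12: "0 < t1" "t1 < ?t0" "?t0 < t2" "t2 < 1 / 2" for t1 t2
  proof -
    have c: "((\<lambda>r. t / d r $ k * d r $ k) \<longlongrightarrow> t) (at_edge \<rho>)" for t
      by (rule tendsto_eventually) (use top_pos in \<open>eventually_elim, simp\<close>)
    have t1: "t1 < 1 / 2" "0 < t2" using t12 t0 by auto
    have g1: "edge_equation CARD('n) \<nu>0 t1 < 0" and g2: "0 < edge_equation CARD('n) \<nu>0 t2"
      using edge_equation_strict_mono[of t1 ?t0 "CARD('n)" \<nu>0] edge_equation_strict_mono[of ?t0 t2 "CARD('n)" \<nu>0]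
        edge_equation_root[OF n2, of \<nu>0] t12 t0 by auto
    show ?thesis
      using order_tendstoD(2)[OF scaled_cgf_deriv_tendsto[OF c[of t1] t12(1) t1(1)] g1]
        order_tendstoD(1)[OF scaled_cgf_deriv_tendsto[OF c[of t2] t1(2) t12(4)] g2]
        S_domain[OF c[of t1] t12(1) t1(1)] S_domain[OF c[of t2] t1(2) t12(4)]
        top_pos mono_d rest_neg
    proof eventually_elim
      case (elim r)
      let ?a = "t1 / d r $ k" and ?b = "t2 / d r $ k"
      have neg: "d r $ Min UNIV < 0" using elim(7) Min_neq_Max c_pos by force
      have ab: "0 < ?a" "?a \<le> ?b" "0 < ?b" using elim(5) t12 t1 by (auto intro!: divide_right_mono)
      have "cgf_deriv (d r) (v r) ?a \<le> 0" "0 \<le> cgf_deriv (d r) (v r) ?b"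
        by (metis ab(1) elim(1) less_asym mult_pos_pos not_le)
          (metis ab(3) elim(2) less_asym mult_pos_neg not_le)
      moreover have dom: "x \<in> mgf_domain (d r)" "1 / (2 * d r $ Min UNIV) < x" "x < 1 / (2 * d r $ k)"
        if "?a \<le> x" "x \<le> ?b" for x
        using saddlepoint_interval_subset[OF elim(6) neg elim(5), of x] that elim(3,4) by auto
      moreover have "continuous_on {?a..?b} (cgf_deriv (d r) (v r))"
        using dom by (intro DERIV_atLeastAtMost_imp_continuous_on) (auto intro!: exI has_real_derivative_cgf_deriv)
      ultimately obtain x where x: "?a \<le> x" "x \<le> ?b" "cgf_deriv (d r) (v r) x = 0"
        using IVT'[of "cgf_deriv (d r) (v r)" ?a 0 ?b] ab by auto
      have "saddle r = x"
        unfolding saddle_def by (rule saddlepoint_eqI[OF elim(6) neg elim(5)]) (use dom x in auto)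
      then show ?case using x elim(5) by (simp add: field_simps)
    qed
  qed
  show ?thesis
  proof (rule order_tendstoI)
    fix a assume "a < ?t0"
    then have "\<forall>\<^sub>F r in at_edge \<rho>. (max a 0 + ?t0) / 2 \<le> saddle r * d r $ k \<and> saddle r * d r $ k \<le> (?t0 + 1 / 2) / 2"
      using t0 by (intro key) auto
    then show "\<forall>\<^sub>F r in at_edge \<rho>. a < saddle r * d r $ k"
      by eventually_elim (use \<open>a < ?t0\<close> in auto)
  next
    fix a assume "?t0 < a"
    then have "\<forall>\<^sub>F r in at_edge \<rho>. ?t0 / 2 \<le> saddle r * d r $ k \<and> saddle r * d r $ k \<le> (min a (1 / 2) + ?t0) / 2"
      using t0 by (intro key) auto
    then show "\<forall>\<^sub>F r in at_edge \<rho>. saddle r * d r $ k < a"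
      by eventually_elim (use \<open>?t0 < a\<close> in auto)
  qed
qed

end

section \<open>The saddlepoint approximations near the edge\<close>

text \<open>
  The limit of \<open>M(s) / edge_scale\<close> at the saddlepoint: the top coordinate contributes the first two factors,
  each of the other \<open>n - 1\<close> coordinates contributes \<open>(2 t\<^sub>0)\<^bsup>-1/2\<^esup>\<close>.
\<close>

definition mgf_const :: "nat \<Rightarrow> real \<Rightarrow> real" where
  "mgf_const n \<nu>0 = (let t = edge_t n \<nu>0 in
     sqrt (1 / (1 - 2 * t)) * exp (\<nu>0\<^sup>2 * ((1 / (1 - 2 * t) - 1) / 2)) * sqrt (1 / (2 * t)) ^ (n - 1))"

context edge_spectrum
begin

lemmas t0_bounds = edge_t_props(1,2)[OF n2, of \<nu>0]
lemmas saddle_pos = S_pos[OF saddle_limit t0_bounds]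
lemmas saddle_domain = S_domain[OF saddle_limit t0_bounds]

abbreviation q :: "'n \<Rightarrow> real \<Rightarrow> real" where
  "q \<equiv> tilt saddle"

lemmas q_pos = tilt_pos[OF saddle_limit t0_bounds]
lemmas q_top = tilt_top[OF saddle_limit t0_bounds]
lemmas q_rest = tilt_rest[OF saddle_limit t0_bounds]
lemmas saddle_d_q = S_d_tilt[OF saddle_limit t0_bounds]

lemma prod_split_top: "(\<Prod>i\<in>(UNIV :: 'n set). if i = k then x else (y :: real)) = x * y ^ (CARD('n) - 1)"
  by (simp add: prod.remove[of UNIV k] card_Diff_singleton)

lemma scales_pos: "\<forall>\<^sub>F r in at_edge \<rho>. \<forall>i. 0 < scales r $ i"
  using top_pos rest_neg
proof eventually_elim
  case (elim r)
  have "d r $ i < 0" if "i \<noteq> k" for i using elim that c_pos by force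
  then show ?case using elim by (blast intro: edge_scales_pos)
qed

lemma scales_rest:
  assumes "i \<noteq> k"
  shows "((\<lambda>r. scales r $ i) \<longlongrightarrow> 0) (at_edge \<rho>)"
proof (rule Lim_null_comparison)
  show "\<forall>\<^sub>F r in at_edge \<rho>. norm (scales r $ i) \<le> sqrt (d r $ k / c)"
    using top_pos rest_neg scales_pos
  proof eventually_elim
    case (elim r)
    have "c \<le> - d r $ i" using elim(2) assms by force
    then have "d r $ k / - d r $ i \<le> d r $ k / c"
      using elim(1) c_pos by (intro divide_left_mono mult_pos_pos) auto
    then have "sqrt (d r $ k / - d r $ i) \<le> sqrt (d r $ k / c)" by (rule real_sqrt_le_mono)
    moreover have "0 < scales r $ i" using elim(3) by blast
    ultimately show ?case using assms by (simp add: edge_scales_def)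
  qed
  show "((\<lambda>r. sqrt (d r $ k / c)) \<longlongrightarrow> 0) (at_edge \<rho>)"
    using tendsto_real_sqrt[OF tendsto_divide_zero[OF top_lim, of c]] by simp
qed

lemma edge_scale_pos: "\<forall>\<^sub>F r in at_edge \<rho>. 0 < edge_scale r"
  using scales_pos by eventually_elim (auto simp: edge_scale_def intro!: mult_pos_pos prod_pos)

lemma edge_scale_tendsto_0: "(edge_scale \<longlongrightarrow> 0) (at_edge \<rho>)"
proof (rule Lim_null_comparison)
  show "\<forall>\<^sub>F r in at_edge \<rho>. norm (edge_scale r) \<le> (\<Prod>i\<in>UNIV. scales r $ i)"
    using scales_pos
  proof eventually_elim
    case (elim r)
    have "0 \<le> (\<Prod>i\<in>UNIV. scales r $ i)" using elim by (intro prod_nonneg) (auto intro: less_imp_le)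
    moreover have "exp (- (\<Sum>i\<in>UNIV - {k}. (v r $ i)\<^sup>2) / 2) \<le> 1"
      by (simp add: sum_nonneg)
    ultimately have "(\<Prod>i\<in>UNIV. scales r $ i) * exp (- (\<Sum>i\<in>UNIV - {k}. (v r $ i)\<^sup>2) / 2) \<le> (\<Prod>i\<in>UNIV. scales r $ i) * 1"
      by (intro mult_left_mono) auto
    then show ?case using \<open>0 \<le> (\<Prod>i\<in>UNIV. scales r $ i)\<close> by (simp add: edge_scale_def)
  qed
  have "((\<lambda>r. \<Prod>i\<in>UNIV. scales r $ i) \<longlongrightarrow> (\<Prod>i\<in>(UNIV :: 'n set). if i = k then 1 else 0)) (at_edge \<rho>)"
  proof (rule tendsto_prod)
    show "((\<lambda>r. scales r $ i) \<longlongrightarrow> (if i = k then 1 else 0)) (at_edge \<rho>)" for i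
      using scales_rest[of i] by (cases "i = k") (auto simp: edge_scales_def)
  qed
  moreover have "(\<Prod>i\<in>(UNIV :: 'n set). if i = k then 1 else 0) = (0 :: real)"
    unfolding prod_split_top using n2 by simp
  ultimately show "((\<lambda>r. \<Prod>i\<in>UNIV. scales r $ i) \<longlongrightarrow> 0) (at_edge \<rho>)" by simp
qed

lemma mgf_const_pos: "0 < mgf_const CARD('n) \<nu>0"
  using t0_bounds by (auto simp: mgf_const_def Let_def)

text \<open>
  After division by \<open>edge_scale\<close> the moment generating function is a product over the coordinates, each
  factor of which converges: \<open>s (- \<lambda>\<^sub>i)\<close> times the tilted variance tends to \<open>1 / 2\<close>, and \<open>edge_scale\<close> replaces
  \<open>- \<lambda>\<^sub>i\<close> by \<open>\<lambda>\<^sub>n\<close>.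
\<close>

lemma mgf_at_saddle_tendsto:
  "((\<lambda>r. qf_mgf (d r) (v r) (saddle r) / edge_scale r) \<longlongrightarrow> mgf_const CARD('n) \<nu>0) (at_edge \<rho>)"
proof -
  define h where "h i r = (if i = k then sqrt (q k r) * exp ((v r $ k)\<^sup>2 * ((q k r - 1) / 2))
      else sqrt (((1 - q i r) / 2) / (saddle r * d r $ k)) * exp ((v r $ i)\<^sup>2 * (q i r / 2)))" for i r
  have "((\<lambda>r. \<Prod>i\<in>UNIV. h i r) \<longlongrightarrow> (\<Prod>i\<in>(UNIV :: 'n set). if i = k then sqrt (1 / (1 - 2 * edge_t CARD('n) \<nu>0)) * exp (\<nu>0\<^sup>2 * ((1 / (1 - 2 * edge_t CARD('n) \<nu>0) - 1) / 2))
      else sqrt (1 / (2 * edge_t CARD('n) \<nu>0)))) (at_edge \<rho>)"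
  proof (rule tendsto_prod)
    fix i
    show "(h i \<longlongrightarrow> (if i = k then sqrt (1 / (1 - 2 * edge_t CARD('n) \<nu>0)) * exp (\<nu>0\<^sup>2 * ((1 / (1 - 2 * edge_t CARD('n) \<nu>0) - 1) / 2))
      else sqrt (1 / (2 * edge_t CARD('n) \<nu>0)))) (at_edge \<rho>)"
    proof (cases "i = k")
      case True
      then show ?thesis
        unfolding h_def by (simp only: if_True refl) (intro tendsto_intros q_top v_top, auto)
    next
      case False
      have "((\<lambda>r. (v r $ i)\<^sup>2 * (q i r / 2)) \<longlongrightarrow> 0) (at_edge \<rho>)"
        by (intro null_mult_v tendsto_divide_zero q_rest False)
      then have "((\<lambda>r. sqrt (((1 - q i r) / 2) / (saddle r * d r $ k)) * exp ((v r $ i)\<^sup>2 * (q i r / 2))) \<longlongrightarrow>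
          sqrt (((1 - 0) / 2) / edge_t CARD('n) \<nu>0) * exp 0) (at_edge \<rho>)"
        using t0_bounds by (intro tendsto_mult tendsto_exp tendsto_real_sqrt tendsto_divide tendsto_diff tendsto_const q_rest False saddle_limit) auto
      then show ?thesis using False by (simp add: h_def[abs_def])
    qed
  qed
  then have lim: "((\<lambda>r. \<Prod>i\<in>UNIV. h i r) \<longlongrightarrow> mgf_const CARD('n) \<nu>0) (at_edge \<rho>)"
    unfolding prod_split_top mgf_const_def Let_def .
  have "\<forall>\<^sub>F r in at_edge \<rho>. (\<Prod>i\<in>UNIV. h i r) = qf_mgf (d r) (v r) (saddle r) / edge_scale r"
    using saddle_pos q_pos saddle_d_q scales_pos top_pos rest_neg
  proof eventually_elim
    case (elim r)
    \<comment> \<open>the factor of \<open>1 / edge_scale\<close> that belongs to the coordinate \<open>i\<close>, apart from the scale\<close>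
    let ?e = "\<lambda>i. if i = k then 1 else exp ((v r $ i)\<^sup>2 / 2)"
    have qd: "1 - 2 * saddle r * d r $ i = 1 / q i r" for i by (simp add: tilt_def)
    have pw: "(1 - 2 * saddle r * d r $ i) powr (- 1 / 2) = sqrt (q i r)" for i
    proof -
      have "0 < q i r" using elim(2) by blast
      then have "(1 / q i r) powr (- (1 / 2)) = sqrt (q i r)"
        by (subst powr_minus) (simp add: powr_half_sqrt real_sqrt_divide)
      then show ?thesis unfolding qd by simp
    qed
    have ex: "saddle r * (\<Sum>i\<in>UNIV. d r $ i * (v r $ i)\<^sup>2 / (1 - 2 * saddle r * d r $ i)) =
        (\<Sum>i\<in>UNIV. (v r $ i)\<^sup>2 * ((q i r - 1) / 2))"
    proof -
      have "saddle r * (d r $ i * (v r $ i)\<^sup>2 / (1 - 2 * saddle r * d r $ i)) = (v r $ i)\<^sup>2 * (saddle r * d r $ i * q i r)" for i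
        by (simp add: tilt_def)
      then show ?thesis unfolding sum_distrib_left elim(3)[rule_format] by (intro sum.cong refl)
    qed
    have M: "qf_mgf (d r) (v r) (saddle r) = (\<Prod>i\<in>UNIV. sqrt (q i r) * exp ((v r $ i)\<^sup>2 * ((q i r - 1) / 2)))"
      unfolding qf_mgf_def pw ex prod.distrib by (subst exp_sum) simp_all
    have E: "1 / edge_scale r = (\<Prod>i\<in>UNIV. ?e i / scales r $ i)"
    proof -
      have "(\<Prod>i\<in>UNIV. ?e i) = (\<Prod>i\<in>UNIV - {k}. exp ((v r $ i)\<^sup>2 / 2))"
        by (simp add: prod.remove[of UNIV k])
      also have "\<dots> = exp ((\<Sum>i\<in>UNIV - {k}. (v r $ i)\<^sup>2) / 2)"
        by (simp add: exp_sum sum_divide_distrib)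
      finally have "(\<Prod>i\<in>UNIV. ?e i) = 1 / exp (- (\<Sum>i\<in>UNIV - {k}. (v r $ i)\<^sup>2) / 2)"
        by (simp add: exp_minus inverse_eq_divide[symmetric])
      then show ?thesis unfolding prod_dividef edge_scale_def by simp
    qed
    have "h i r = sqrt (q i r) * exp ((v r $ i)\<^sup>2 * ((q i r - 1) / 2)) * (?e i / scales r $ i)" for i
    proof (cases "i = k")
      case True
      then show ?thesis by (simp add: h_def edge_scales_def)
    next
      case False
      have neg: "0 < - d r $ i" using elim(6) False c_pos by force
      have c: "x / (L / D) = (s * D * x) / (s * L)" if "s \<noteq> 0" for x L D s :: real
        using that by (simp add: mult_ac)
      have s0: "saddle r \<noteq> 0" using elim(1) by simp
      have dq: "saddle r * (- d r $ i) * q i r = (1 - q i r) / 2"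
        using elim(3)[rule_format, of i] by (simp add: diff_divide_distrib)
      have "sqrt (q i r) / scales r $ i = sqrt (q i r / (d r $ k / - d r $ i))"
        using False unfolding edge_scales_def by (simp only: vec_lambda_beta if_False real_sqrt_divide)
      then have 1: "sqrt (q i r) / scales r $ i = sqrt (((1 - q i r) / 2) / (saddle r * d r $ k))"
        unfolding c[OF s0] dq .
      have 2: "exp ((v r $ i)\<^sup>2 * (q i r / 2)) = exp ((v r $ i)\<^sup>2 * ((q i r - 1) / 2)) * exp ((v r $ i)\<^sup>2 / 2)"
        unfolding exp_add[symmetric] by (simp add: field_simps)
      show ?thesis unfolding h_def 2 1[symmetric] using False by simp
    qed
    then have "(\<Prod>i\<in>UNIV. h i r) = qf_mgf (d r) (v r) (saddle r) * (1 / edge_scale r)"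
      unfolding M E prod.distrib[symmetric] by simp
    then show ?case by simp
  qed
  with lim show ?thesis by (simp add: tendsto_cong)
qed

lemma edge_u_pos: "0 < edge_u CARD('n) \<nu>0"
proof -
  have "0 < (real CARD('n) - 1) / 2" using n2 by simp
  moreover have "0 \<le> 2 * (edge_t CARD('n) \<nu>0)\<^sup>2 / (1 - 2 * edge_t CARD('n) \<nu>0)\<^sup>2" by simp
  moreover have "0 \<le> 4 * \<nu>0\<^sup>2 * (edge_t CARD('n) \<nu>0)\<^sup>2 / (1 - 2 * edge_t CARD('n) \<nu>0) ^ 3" using t0_bounds by simp
  ultimately have "0 < (real CARD('n) - 1) / 2 + 2 * (edge_t CARD('n) \<nu>0)\<^sup>2 / (1 - 2 * edge_t CARD('n) \<nu>0)\<^sup>2 +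
      4 * \<nu>0\<^sup>2 * (edge_t CARD('n) \<nu>0)\<^sup>2 / (1 - 2 * edge_t CARD('n) \<nu>0) ^ 3"
    by linarith
  then show ?thesis unfolding edge_u_def Let_def by (rule real_sqrt_gt_zero)
qed

lemma saddle_u_tendsto:
  "((\<lambda>r. saddle r * sqrt ((deriv ^^ 2) (qf_cgf (d r) (v r)) (saddle r))) \<longlongrightarrow> edge_u CARD('n) \<nu>0) (at_edge \<rho>)"
proof -
  have "((\<lambda>r. sqrt ((saddle r)\<^sup>2 * cgf_deriv2 (d r) (v r) (saddle r))) \<longlongrightarrow> edge_u CARD('n) \<nu>0) (at_edge \<rho>)"
    unfolding edge_u_def Let_def by (intro tendsto_real_sqrt scaled_cgf_deriv2_tendsto saddle_limit t0_bounds)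
  moreover have "\<forall>\<^sub>F r in at_edge \<rho>. sqrt ((saddle r)\<^sup>2 * cgf_deriv2 (d r) (v r) (saddle r)) =
      saddle r * sqrt ((deriv ^^ 2) (qf_cgf (d r) (v r)) (saddle r))"
    using saddle_pos saddle_domain
    by eventually_elim (simp add: deriv2_qf_cgf real_sqrt_mult)
  ultimately show ?thesis by (simp add: tendsto_cong)
qed

lemma mgf_at_saddle_tendsto_0: "((\<lambda>r. qf_mgf (d r) (v r) (saddle r)) \<longlongrightarrow> 0) (at_edge \<rho>)"
proof -
  have "((\<lambda>r. qf_mgf (d r) (v r) (saddle r) / edge_scale r * edge_scale r) \<longlongrightarrow> mgf_const CARD('n) \<nu>0 * 0) (at_edge \<rho>)"
    by (intro tendsto_mult mgf_at_saddle_tendsto edge_scale_tendsto_0)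
  moreover have "\<forall>\<^sub>F r in at_edge \<rho>. qf_mgf (d r) (v r) (saddle r) / edge_scale r * edge_scale r = qf_mgf (d r) (v r) (saddle r)"
    using edge_scale_pos by eventually_elim simp
  ultimately show ?thesis by (simp add: tendsto_cong)
qed

text \<open>
  Since \<open>\<phi>(w) = M(s) / sqrt (2 \<pi>)\<close> exactly, the tail of the approximation is this density times
  Mills' ratio minus \<open>1 / w\<close> plus \<open>1 / u\<close>, and the first two vanish as \<open>w\<close> tends to infinity.
\<close>

proposition lugannani_rice_tail_tendsto:
  assumes m: "\<forall>\<^sub>F r in at_edge \<rho>. m r \<noteq> 0"
  shows "((\<lambda>r. (1 - lr_cdf (d r) (v r) (m r)) / edge_scale r) \<longlongrightarrow> mgf_const CARD('n) \<nu>0 / (sqrt (2 * pi) * edge_u CARD('n) \<nu>0)) (at_edge \<rho>)"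
proof -
  define K where "K r = qf_cgf (d r) (v r) (saddle r)" for r
  define w where "w r = sqrt (- 2 * K r)" for r
  define u where "u r = saddle r * sqrt ((deriv ^^ 2) (qf_cgf (d r) (v r)) (saddle r))" for r
  let ?mills = "\<lambda>r. (1 - cdf std_normal_distribution (w r)) / std_normal_density (w r)"
  have mpos: "\<forall>\<^sub>F r in at_edge \<rho>. 0 < qf_mgf (d r) (v r) (saddle r)"
    using saddle_domain by eventually_elim (auto intro: qf_mgf_pos)
  have "filterlim (\<lambda>r. qf_mgf (d r) (v r) (saddle r)) (at_right 0) (at_edge \<rho>)"
    using mgf_at_saddle_tendsto_0 mpos by (auto simp: filterlim_at elim!: eventually_mono)
  from filterlim_compose[OF ln_at_0 this] have K: "filterlim K at_bot (at_edge \<rho>)"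
    by (simp add: K_def[abs_def] qf_cgf_def)
  have Kneg: "\<forall>\<^sub>F r in at_edge \<rho>. K r < 0"
    using filterlim_at_bot_dense[THEN iffD1, OF K, rule_format, of 0] .
  have w: "filterlim w at_top (at_edge \<rho>)"
  proof -
    have "filterlim (\<lambda>r. - K r) at_top (at_edge \<rho>)"
      using K by (simp add: filterlim_uminus_at_bot)
    then have "filterlim (\<lambda>r. 2 * - K r) at_top (at_edge \<rho>)"
      by (intro filterlim_tendsto_pos_mult_at_top[OF tendsto_const]) auto
    from filterlim_compose[OF sqrt_at_top this] show ?thesis by (simp add: w_def[abs_def])
  qed
  have "((\<lambda>r. qf_mgf (d r) (v r) (saddle r) / edge_scale r * (1 / sqrt (2 * pi) * (?mills r - inverse (w r) + 1 / u r))) \<longlongrightarrow>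
      mgf_const CARD('n) \<nu>0 * (1 / sqrt (2 * pi) * (0 - 0 + 1 / edge_u CARD('n) \<nu>0))) (at_edge \<rho>)"
    using edge_u_pos unfolding u_def
    by (intro tendsto_intros mgf_at_saddle_tendsto mills_ratio_tendsto_0[OF w] tendsto_inverse_0_at_top[OF w] saddle_u_tendsto) auto
  moreover have "\<forall>\<^sub>F r in at_edge \<rho>. qf_mgf (d r) (v r) (saddle r) / edge_scale r * (1 / sqrt (2 * pi) * (?mills r - inverse (w r) + 1 / u r)) =
      (1 - lr_cdf (d r) (v r) (m r)) / edge_scale r"
    using saddle_pos m Kneg mpos
  proof eventually_elim
    case (elim r)
    have sg: "sgn (saddle r) = 1" using elim by simp
    have phi: "std_normal_density (w r) = 1 / sqrt (2 * pi) * qf_mgf (d r) (v r) (saddle r)"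
    proof -
      have "- (w r)\<^sup>2 / 2 = K r" using elim(3) by (simp add: w_def)
      moreover have "exp (K r) = qf_mgf (d r) (v r) (saddle r)" using elim(4) by (simp add: K_def qf_cgf_def)
      ultimately show ?thesis unfolding std_normal_density_def by simp
    qed
    have "lr_cdf (d r) (v r) (m r) = cdf std_normal_distribution (w r) + std_normal_density (w r) * (1 / w r - 1 / u r)"
      using elim(2) sg unfolding lr_cdf_def Let_def saddle_def[symmetric] by (simp add: w_def u_def K_def)
    then have "1 - lr_cdf (d r) (v r) (m r) = (1 - cdf std_normal_distribution (w r)) - std_normal_density (w r) * (1 / w r - 1 / u r)"
      by simp
    also have "1 - cdf std_normal_distribution (w r) = std_normal_density (w r) * ?mills r"
    proof -
      have "std_normal_density (w r) \<noteq> 0" using normal_density_pos[of 1 0 "w r"] by simp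
      then show ?thesis by simp
    qed
    also have "std_normal_density (w r) * ?mills r - std_normal_density (w r) * (1 / w r - 1 / u r) =
        std_normal_density (w r) * (?mills r - inverse (w r) + 1 / u r)"
      by (simp add: right_diff_distrib distrib_left inverse_eq_divide)
    finally have "1 - lr_cdf (d r) (v r) (m r) = std_normal_density (w r) * (?mills r - inverse (w r) + 1 / u r)" .
    then show ?case unfolding phi by simp
  qed
  ultimately show ?thesis by (simp add: tendsto_cong)
qed

text \<open>
  In the rescaled coordinates \<open>s J(s)\<close> is a combination of the entries of \<open>G\<close> with converging
  coefficients: \<open>1 / 2\<close> at the lower diagonal entries and \<open>0\<close> off the diagonal.  At the top entry the limit is
  \<open>t\<^sub>0 / (1 - 2 t\<^sub>0) + \<nu>0\<^sup>2 t\<^sub>0 / (1 - 2 t\<^sub>0)\<^sup>2\<close>, which the saddlepoint equation identifies as \<open>(n - 1) / 2\<close>.  The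
  limiting combination is \<open>edge_rate k G\<close>, and the errors are small relative to it by
  \<open>psd_entry_le_edge_rate\<close>.
\<close>

lemma scaled_J_tendsto:
  assumes HG: "\<forall>\<^sub>F r in at_edge \<rho>. (\<forall>i j. G r $ i $ j = H r $ i $ j * scales r $ i * scales r $ j / d r $ k) \<and>
      transpose (G r) = G r \<and> (\<forall>x. 0 \<le> x \<bullet> (G r *v x)) \<and> 0 < edge_rate k (G r)"
  shows "((\<lambda>r. saddle r * sp_J (d r) (v r) (H r) (saddle r) / edge_rate k (G r)) \<longlongrightarrow> 1) (at_edge \<rho>)"
proof -
  define D where "D r = edge_rate k (G r)" for r
  define g where "g r i j = G r $ i $ j / D r" for r i j
  \<comment> \<open>with \<open>\<sigma>\<^sub>i = sqrt (s \<lambda>\<^sub>n) / scales $ i\<close>, these are \<open>q \<sigma>\<^sup>2\<close> and \<open>q \<sigma>\<close>; \<open>W\<close> holds the weights in \<open>edge_rate\<close>\<close>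
  define \<omega> where "\<omega> i r = (if i = k then (q i r - 1) / 2 else (1 - q i r) / 2)" for i r
  define \<tau> where "\<tau> i r = sqrt (q i r * \<omega> i r)" for i r
  define W where "W i = (if i = k then (real CARD('n) - 1) / 2 else 1 / 2)" for i
  define e where "e i r = \<omega> i r - W i + (if i = k then (v r $ k)\<^sup>2 * (\<tau> k r)\<^sup>2 else 0)" for i r
  have g2: "\<forall>\<^sub>F r in at_edge \<rho>. \<bar>g r i j\<bar> \<le> 2" for i j
    using HG
  proof eventually_elim
    case (elim r)
    then have "\<bar>G r $ i $ j\<bar> \<le> 2 * D r"
      using psd_entry_le_edge_rate[OF n2, of "G r" i j k] by (auto simp: D_def)
    moreover have "0 < D r" using elim by (simp add: D_def)
    ultimately show ?case by (simp add: g_def abs_divide divide_le_eq)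
  qed
  have \<omega>pos: "\<forall>\<^sub>F r in at_edge \<rho>. \<forall>i. 0 \<le> \<omega> i r \<and> 0 < q i r"
    using saddle_pos q_pos saddle_d_q rest_neg top_pos
  proof eventually_elim
    case (elim r)
    have "0 \<le> \<omega> i r" for i
    proof (cases "i = k")
      case True
      have "0 \<le> saddle r * d r $ k * q k r" using elim by (intro mult_nonneg_nonneg) (auto intro: less_imp_le)
      then show ?thesis using True elim(3) by (simp add: \<omega>_def)
    next
      case False
      have "d r $ i \<le> 0" using elim(4) False c_pos by force
      then have "0 \<le> saddle r * (- d r $ i) * q i r" using elim by (intro mult_nonneg_nonneg) (auto intro: less_imp_le)
      moreover have "saddle r * d r $ i * q i r = (q i r - 1) / 2" using elim(3) by blast
      ultimately show ?thesis using False by (simp add: \<omega>_def)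
    qed
    then show ?case using elim by blast
  qed
  have \<tau>0: "(\<tau> i \<longlongrightarrow> 0) (at_edge \<rho>)" if "i \<noteq> k" for i
  proof -
    have "((\<lambda>r. sqrt (q i r * ((1 - q i r) / 2))) \<longlongrightarrow> sqrt (0 * ((1 - 0) / 2))) (at_edge \<rho>)"
      by (intro tendsto_intros q_rest that) auto
    then show ?thesis using that by (simp add: \<tau>_def[abs_def] \<omega>_def)
  qed
  have \<tau>k: "(\<tau> k \<longlongrightarrow> sqrt (1 / (1 - 2 * edge_t CARD('n) \<nu>0) * ((1 / (1 - 2 * edge_t CARD('n) \<nu>0) - 1) / 2))) (at_edge \<rho>)"
    unfolding \<tau>_def \<omega>_def by (simp only: if_True refl) (intro tendsto_intros q_top, auto)
  have e0: "(e i \<longlongrightarrow> 0) (at_edge \<rho>)" for i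
  proof (cases "i = k")
    case True
    have "((\<lambda>r. (q k r - 1) / 2 - (real CARD('n) - 1) / 2 + (v r $ k)\<^sup>2 * (q k r * ((q k r - 1) / 2))) \<longlongrightarrow>
        (1 / (1 - 2 * edge_t CARD('n) \<nu>0) - 1) / 2 - (real CARD('n) - 1) / 2 + \<nu>0\<^sup>2 * (1 / (1 - 2 * edge_t CARD('n) \<nu>0) * ((1 / (1 - 2 * edge_t CARD('n) \<nu>0) - 1) / 2))) (at_edge \<rho>)"
      by (intro tendsto_intros q_top v_top) auto
    moreover have "(1 / (1 - 2 * edge_t CARD('n) \<nu>0) - 1) / 2 - (real CARD('n) - 1) / 2 + \<nu>0\<^sup>2 * (1 / (1 - 2 * edge_t CARD('n) \<nu>0) * ((1 / (1 - 2 * edge_t CARD('n) \<nu>0) - 1) / 2)) = 0"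
    proof -
      have "(1 / (1 - 2 * edge_t CARD('n) \<nu>0) - 1) / 2 = edge_t CARD('n) \<nu>0 / (1 - 2 * edge_t CARD('n) \<nu>0)" using t0_bounds by (simp add: field_simps)
      then have "\<nu>0\<^sup>2 * (1 / (1 - 2 * edge_t CARD('n) \<nu>0) * ((1 / (1 - 2 * edge_t CARD('n) \<nu>0) - 1) / 2)) =
          \<nu>0\<^sup>2 * edge_t CARD('n) \<nu>0 / (1 - 2 * edge_t CARD('n) \<nu>0)\<^sup>2"
        by (simp only:) (simp add: power2_eq_square)
      then show ?thesis
        using edge_equation_root[OF n2, of \<nu>0] \<open>_ = edge_t CARD('n) \<nu>0 / (1 - 2 * edge_t CARD('n) \<nu>0)\<close>
        unfolding edge_equation_def by linarith
    qed
    moreover have "\<forall>\<^sub>F r in at_edge \<rho>. (q k r - 1) / 2 - (real CARD('n) - 1) / 2 + (v r $ k)\<^sup>2 * (q k r * ((q k r - 1) / 2)) = e k r"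
      using \<omega>pos
    proof eventually_elim
      case (elim r)
      then have "0 \<le> q k r * \<omega> k r" by (intro mult_nonneg_nonneg) (auto intro: less_imp_le)
      then have "(\<tau> k r)\<^sup>2 = q k r * \<omega> k r" by (simp add: \<tau>_def)
      then show ?case by (simp add: e_def W_def \<omega>_def)
    qed
    ultimately show ?thesis using True by (simp add: tendsto_cong)
  next
    case False
    have "((\<lambda>r. (1 - q i r) / 2 - 1 / 2) \<longlongrightarrow> (1 - 0) / 2 - 1 / 2) (at_edge \<rho>)"
      by (intro tendsto_intros q_rest False) auto
    then show ?thesis using False by (simp add: e_def[abs_def] \<omega>_def W_def)
  qed
  have null_g: "((\<lambda>r. g r i j * f r) \<longlongrightarrow> 0) (at_edge \<rho>)" if "(f \<longlongrightarrow> 0) (at_edge \<rho>)" for f i j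
  proof (rule Lim_null_comparison)
    show "\<forall>\<^sub>F r in at_edge \<rho>. norm (g r i j * f r) \<le> 2 * \<bar>f r\<bar>"
      using g2[of i j] by eventually_elim (simp add: abs_mult mult_right_mono)
    show "((\<lambda>r. 2 * \<bar>f r\<bar>) \<longlongrightarrow> 0) (at_edge \<rho>)"
      using tendsto_mult_right_zero[OF tendsto_rabs_zero[OF that]] by simp
  qed
  have cross: "((\<lambda>r. v r $ i * v r $ j * (\<tau> i r * \<tau> j r)) \<longlongrightarrow> 0) (at_edge \<rho>)" if ij: "i \<noteq> k \<or> j \<noteq> k" for i j
  proof (rule Lim_null_comparison)
    show "\<forall>\<^sub>F r in at_edge \<rho>. norm (v r $ i * v r $ j * (\<tau> i r * \<tau> j r)) \<le> B * B * \<bar>\<tau> i r * \<tau> j r\<bar>"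
      using vB
    proof eventually_elim
      case (elim r)
      have b: "\<bar>v r $ i\<bar> \<le> B" for i using component_le_norm_cart[of "v r" i] elim by linarith
      have "\<bar>v r $ i\<bar> * \<bar>v r $ j\<bar> \<le> B * B"
        using b[of i] b[of j] by (intro mult_mono) auto
      then show ?case by (simp add: abs_mult mult_right_mono)
    qed
    have \<tau>l: "\<exists>L. (\<tau> i \<longlongrightarrow> L) (at_edge \<rho>) \<and> (i \<noteq> k \<longrightarrow> L = 0)" for i
      using \<tau>0[of i] \<tau>k by (cases "i = k") auto
    obtain L1 L2 where L: "(\<tau> i \<longlongrightarrow> L1) (at_edge \<rho>)" "(\<tau> j \<longlongrightarrow> L2) (at_edge \<rho>)" "L1 * L2 = 0"
      using \<tau>l[of i] \<tau>l[of j] ij by force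
    from tendsto_mult[OF L(1,2)] have "((\<lambda>r. \<bar>\<tau> i r * \<tau> j r\<bar>) \<longlongrightarrow> 0) (at_edge \<rho>)"
      unfolding L(3) by (rule tendsto_rabs_zero)
    then show "((\<lambda>r. B * B * \<bar>\<tau> i r * \<tau> j r\<bar>) \<longlongrightarrow> 0) (at_edge \<rho>)"
      by (rule tendsto_mult_right_zero)
  qed
  have "((\<lambda>r. 1 + (\<Sum>i\<in>UNIV. g r i i * e i r) +
      (\<Sum>i\<in>UNIV. \<Sum>j\<in>UNIV. if i = k \<and> j = k then 0 else g r i j * (v r $ i * v r $ j * (\<tau> i r * \<tau> j r)))) \<longlongrightarrow>
      1 + (\<Sum>i\<in>(UNIV :: 'n set). 0) + (\<Sum>i\<in>(UNIV :: 'n set). \<Sum>j\<in>(UNIV :: 'n set). 0)) (at_edge \<rho>)"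
  proof (intro tendsto_intros)
    show "((\<lambda>r. g r i i * e i r) \<longlongrightarrow> 0) (at_edge \<rho>)" for i by (rule null_g[OF e0])
    show "((\<lambda>r. if i = k \<and> j = k then 0 else g r i j * (v r $ i * v r $ j * (\<tau> i r * \<tau> j r))) \<longlongrightarrow> 0) (at_edge \<rho>)" for i j
      using null_g[OF cross[of i j], of i j] by (cases "i = k \<and> j = k") auto
  qed
  moreover have "\<forall>\<^sub>F r in at_edge \<rho>. 1 + (\<Sum>i\<in>UNIV. g r i i * e i r) +
      (\<Sum>i\<in>UNIV. \<Sum>j\<in>UNIV. if i = k \<and> j = k then 0 else g r i j * (v r $ i * v r $ j * (\<tau> i r * \<tau> j r))) =
      saddle r * sp_J (d r) (v r) (H r) (saddle r) / D r"
    using HG saddle_pos saddle_domain saddle_d_q \<omega>pos scales_pos top_pos rest_neg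
  proof eventually_elim
    case (elim r)
    have D0: "D r \<noteq> 0" using elim(1) by (simp add: D_def)
    define \<sigma> where "\<sigma> i = sqrt (saddle r * d r $ k) / scales r $ i" for i
    have sH: "saddle r * H r $ i $ j = G r $ i $ j * \<sigma> i * \<sigma> j" for i j
    proof -
      have "scales r $ i \<noteq> 0" "scales r $ j \<noteq> 0" using elim(6) by (metis less_irrefl)+
      moreover have "G r $ i $ j = H r $ i $ j * scales r $ i * scales r $ j / d r $ k" using elim(1) by blast
      moreover have "sqrt (saddle r * d r $ k) * sqrt (saddle r * d r $ k) = saddle r * d r $ k"
        using elim(2) elim(7) by simp
      ultimately show ?thesis using elim(7) by (simp add: \<sigma>_def)
    qed
    have \<omega>: "q i r * (\<sigma> i)\<^sup>2 = \<omega> i r" for i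
    proof (cases "i = k")
      case True
      have "0 \<le> saddle r * d r $ k" using elim(2,7) by simp
      moreover have "saddle r * d r $ k * q k r = (q k r - 1) / 2" using elim(4) by blast
      ultimately show ?thesis using True by (simp add: \<sigma>_def edge_scales_def \<omega>_def mult.commute)
    next
      case False
      have neg: "0 < - d r $ i" using elim(8) False c_pos by force
      have pos: "0 \<le> d r $ k / - d r $ i" using elim(7) neg by (intro divide_nonneg_pos) auto
      have pos': "0 \<le> saddle r * d r $ k" using elim(2,7) by simp
      have c: "x * L / (L / D) = x * D" if "L \<noteq> 0" for x L D :: real
        using that by simp
      have "d r $ k \<noteq> 0" using elim(7) by simp
      have "(\<sigma> i)\<^sup>2 = saddle r * d r $ k / (d r $ k / - d r $ i)"
        using False unfolding \<sigma>_def edge_scales_def power_divide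
        by (simp only: vec_lambda_beta if_False real_sqrt_pow2[OF pos] real_sqrt_pow2[OF pos'])
      also have "\<dots> = saddle r * (- d r $ i)" by (rule c) fact
      finally have "q i r * (\<sigma> i)\<^sup>2 = - (saddle r * d r $ i * q i r)" by simp
      also have "\<dots> = (1 - q i r) / 2" using elim(4) by (simp add: field_simps)
      finally show ?thesis using False by (simp add: \<omega>_def)
    qed
    have \<tau>: "q i r * \<sigma> i = \<tau> i r" for i
    proof -
      have "0 \<le> \<sigma> i" using elim(2,6,7) by (auto simp: \<sigma>_def intro!: divide_nonneg_nonneg intro: less_imp_le)
      then have "0 \<le> q i r * \<sigma> i" using elim(5) by (intro mult_nonneg_nonneg) (auto intro: less_imp_le)
      then have "sqrt ((q i r * \<sigma> i)\<^sup>2) = q i r * \<sigma> i" by simp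
      moreover have "(q i r * \<sigma> i)\<^sup>2 = q i r * \<omega> i r" unfolding \<omega>[symmetric] by (simp add: power2_eq_square)
      ultimately show ?thesis by (simp add: \<tau>_def)
    qed
    have "saddle r * sp_J (d r) (v r) (H r) (saddle r) =
        (\<Sum>i\<in>UNIV. q i r * (saddle r * H r $ i $ i)) + (\<Sum>i\<in>UNIV. \<Sum>j\<in>UNIV. v r $ i * v r $ j * q i r * q j r * (saddle r * H r $ i $ j))"
    proof -
      have dom: "saddle r \<in> mgf_domain (d r)" using elim(3) by simp
      have "sp_J (d r) (v r) (H r) (saddle r) =
          (\<Sum>i\<in>UNIV. q i r * H r $ i $ i) + (\<Sum>i\<in>UNIV. \<Sum>j\<in>UNIV. v r $ i * v r $ j * q i r * q j r * H r $ i $ j)"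
        unfolding tilt_def by (rule sp_J_eq[OF dom])
      then show ?thesis by (simp add: distrib_left sum_distrib_left mult_ac)
    qed
    also have "\<dots> = (\<Sum>i\<in>UNIV. G r $ i $ i * \<omega> i r) + (\<Sum>i\<in>UNIV. \<Sum>j\<in>UNIV. G r $ i $ j * (v r $ i * v r $ j * (\<tau> i r * \<tau> j r)))"
      unfolding sH \<omega>[symmetric] \<tau>[symmetric] by (simp add: power2_eq_square mult_ac)
    finally have J: "saddle r * sp_J (d r) (v r) (H r) (saddle r) / D r =
        (\<Sum>i\<in>UNIV. g r i i * \<omega> i r) + (\<Sum>i\<in>UNIV. \<Sum>j\<in>UNIV. g r i j * (v r $ i * v r $ j * (\<tau> i r * \<tau> j r)))"
      by (simp add: g_def add_divide_distrib sum_divide_distrib)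
    have 1: "(\<Sum>i\<in>UNIV. g r i i * W i) = 1"
    proof -
      have "(\<Sum>i\<in>UNIV. g r i i * W i) = ((real CARD('n) - 1) * G r $ k $ k + (\<Sum>i\<in>UNIV - {k}. G r $ i $ i)) / 2 / D r"
        by (simp add: sum.remove[of UNIV k] g_def W_def sum_divide_distrib add_divide_distrib mult_ac)
      also have "\<dots> = 1" using D0 by (simp add: D_def edge_rate_def)
      finally show ?thesis .
    qed
    have cr: "(\<Sum>i\<in>UNIV. \<Sum>j\<in>UNIV. g r i j * (v r $ i * v r $ j * (\<tau> i r * \<tau> j r))) =
        g r k k * ((v r $ k)\<^sup>2 * (\<tau> k r)\<^sup>2) +
        (\<Sum>i\<in>UNIV. \<Sum>j\<in>UNIV. if i = k \<and> j = k then 0 else g r i j * (v r $ i * v r $ j * (\<tau> i r * \<tau> j r)))"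
    proof -
      have "(\<Sum>i\<in>UNIV. \<Sum>j\<in>UNIV. g r i j * (v r $ i * v r $ j * (\<tau> i r * \<tau> j r))) =
          (\<Sum>i\<in>UNIV. \<Sum>j\<in>UNIV. (if i = k then if j = k then g r k k * ((v r $ k)\<^sup>2 * (\<tau> k r)\<^sup>2) else 0 else 0) +
            (if i = k \<and> j = k then 0 else g r i j * (v r $ i * v r $ j * (\<tau> i r * \<tau> j r))))"
        by (intro sum.cong refl) (auto simp: power2_eq_square)
      also have "\<dots> = (\<Sum>i\<in>(UNIV :: 'n set). if i = k then g r k k * ((v r $ k)\<^sup>2 * (\<tau> k r)\<^sup>2) else 0) +
          (\<Sum>i\<in>UNIV. \<Sum>j\<in>UNIV. if i = k \<and> j = k then 0 else g r i j * (v r $ i * v r $ j * (\<tau> i r * \<tau> j r)))"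
        unfolding sum.distrib by (intro arg_cong2[of _ _ _ _ "(+)"] sum.cong refl) auto
      finally show ?thesis by simp
    qed
    have ee: "(\<Sum>i\<in>UNIV. g r i i * e i r) = (\<Sum>i\<in>UNIV. g r i i * \<omega> i r) - 1 + g r k k * ((v r $ k)\<^sup>2 * (\<tau> k r)\<^sup>2)"
    proof -
      have "(\<Sum>i\<in>UNIV. g r i i * e i r) = (\<Sum>i\<in>UNIV. g r i i * \<omega> i r - g r i i * W i + (if i = k then g r k k * ((v r $ k)\<^sup>2 * (\<tau> k r)\<^sup>2) else 0))"
        by (rule sum.cong) (auto simp: e_def distrib_left right_diff_distrib)
      then show ?thesis unfolding sum.distrib sum_subtractf 1 by simp
    qed
    show ?case unfolding J cr ee by simp
  qed
  ultimately show ?thesis unfolding D_def by (simp add: tendsto_cong)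
qed

proposition sp_density_tendsto:
  assumes HG: "\<forall>\<^sub>F r in at_edge \<rho>. (\<forall>i j. G r $ i $ j = H r $ i $ j * scales r $ i * scales r $ j / d r $ k) \<and>
      transpose (G r) = G r \<and> (\<forall>x. 0 \<le> x \<bullet> (G r *v x)) \<and> 0 < edge_rate k (G r)"
  shows "((\<lambda>r. sp_density (d r) (v r) (H r) / (edge_rate k (G r) * edge_scale r)) \<longlongrightarrow> mgf_const CARD('n) \<nu>0 / (sqrt (2 * pi) * edge_u CARD('n) \<nu>0)) (at_edge \<rho>)"
proof -
  let ?u = "\<lambda>r. saddle r * sqrt ((deriv ^^ 2) (qf_cgf (d r) (v r)) (saddle r))"
  have "((\<lambda>r. (saddle r * sp_J (d r) (v r) (H r) (saddle r) / edge_rate k (G r)) / (sqrt (2 * pi) * ?u r) *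
      (qf_mgf (d r) (v r) (saddle r) / edge_scale r)) \<longlongrightarrow> 1 / (sqrt (2 * pi) * edge_u CARD('n) \<nu>0) * mgf_const CARD('n) \<nu>0) (at_edge \<rho>)"
    using edge_u_pos by (intro tendsto_intros scaled_J_tendsto[OF HG] saddle_u_tendsto mgf_at_saddle_tendsto) auto
  moreover have "\<forall>\<^sub>F r in at_edge \<rho>. (saddle r * sp_J (d r) (v r) (H r) (saddle r) / edge_rate k (G r)) / (sqrt (2 * pi) * ?u r) *
      (qf_mgf (d r) (v r) (saddle r) / edge_scale r) = sp_density (d r) (v r) (H r) / (edge_rate k (G r) * edge_scale r)"
    using saddle_pos
    by eventually_elim (simp add: sp_density_def Let_def saddle_def[symmetric] real_sqrt_mult)
  ultimately show ?thesis by (simp add: tendsto_cong)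
qed

end

text \<open>
  Only \<open>\<bar>\<nu>0\<bar>\<close> appears because the cone is symmetric in the sign of its axis.
\<close>

lemma edge_limit_eq:
  fixes k :: "'n :: finite"
  assumes n: "2 \<le> CARD('n)"
  shows "(2 * pi) powr (- real CARD('n) / 2) * cone_gauss_mass k \<bar>\<nu>0\<bar> /
      (mgf_const CARD('n) \<nu>0 / (sqrt (2 * pi) * edge_u CARD('n) \<nu>0)) = edge_limit CARD('n) \<nu>0"
proof -
  define t where "t = edge_t CARD('n) \<nu>0"
  define F where "F = hyp1F1 (real CARD('n) / 2) (1 / 2) (\<nu>0\<^sup>2 / 2)"
  define b where "b = Beta (1 / 2) ((real CARD('n) + 1) / 2) * (real CARD('n) / 2)"
  define u where "u = edge_u CARD('n) \<nu>0"
  have t: "0 < t" "t < 1 / 2" using edge_t_props(1,2)[OF n, of \<nu>0] by (simp_all add: t_def)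
  have ex: "exp (- \<nu>0\<^sup>2 / 2) / exp (\<nu>0\<^sup>2 * ((1 / (1 - 2 * t) - 1) / 2)) = exp (- edge_eta CARD('n) \<nu>0)"
  proof -
    have "edge_eta CARD('n) \<nu>0 = \<nu>0\<^sup>2 * (1 / (1 - 2 * t)) / 2"
      by (simp add: edge_eta_def t_def[symmetric] mult_ac)
    then have "- \<nu>0\<^sup>2 / 2 - \<nu>0\<^sup>2 * ((1 / (1 - 2 * t) - 1) / 2) = - edge_eta CARD('n) \<nu>0"
      by (simp add: right_diff_distrib diff_divide_distrib)
    then show ?thesis by (simp add: exp_diff[symmetric])
  qed
  have sq: "1 / sqrt (1 / (2 * t)) ^ (CARD('n) - 1) = (2 * t) powr ((real CARD('n) - 1) / 2)"
  proof -
    have "1 / sqrt (1 / (2 * t)) ^ (CARD('n) - 1) = sqrt (2 * t) ^ (CARD('n) - 1)"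
      by (simp add: real_sqrt_divide power_divide)
    also have "\<dots> = ((2 * t) powr (1 / 2)) powr real (CARD('n) - 1)"
    proof -
      have "0 < sqrt (2 * t)" using t by simp
      from powr_realpow[OF this, of "CARD('n) - 1"] show ?thesis
        unfolding powr_half_sqrt[OF less_imp_le[OF mult_pos_pos[OF zero_less_numeral t(1)]]] ..
    qed
    also have "\<dots> = (2 * t) powr ((real CARD('n) - 1) / 2)"
      using n by (simp add: powr_powr of_nat_diff)
    finally show ?thesis .
  qed
  have s1: "1 / sqrt (1 / (1 - 2 * t)) = sqrt (1 - 2 * t)"
    by (simp add: real_sqrt_divide)
  have alg: "E / b * F / (s * X * y / (p * u)) = (p * (1 / s)) * (1 / y) * u * (E / X) / b * F" for E s X y p :: real
    by (simp add: mult_ac)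
  have "(2 * pi) powr (- real CARD('n) / 2) * cone_gauss_mass k \<bar>\<nu>0\<bar> = exp (- \<nu>0\<^sup>2 / 2) / b * F"
    unfolding cone_gauss_mass_normalized[OF n] by (simp add: F_def b_def)
  then have "(2 * pi) powr (- real CARD('n) / 2) * cone_gauss_mass k \<bar>\<nu>0\<bar> / (mgf_const CARD('n) \<nu>0 / (sqrt (2 * pi) * u)) =
      (sqrt (2 * pi) * sqrt (1 - 2 * t)) * (2 * t) powr ((real CARD('n) - 1) / 2) * u * exp (- edge_eta CARD('n) \<nu>0) / b * F"
    unfolding mgf_const_def Let_def t_def[symmetric] by (simp only: alg ex sq s1)
  then show ?thesis
    unfolding edge_limit_def Let_def t_def[symmetric] u_def[symmetric] b_def[symmetric] F_def[symmetric]
    by (simp add: real_sqrt_mult)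
qed

section \<open>Ordered eigenvalues and quadratic forms\<close>

lemma orthogonal_matrix_mult_cancel:
  fixes P :: "real ^ 'n ^ 'n"
  assumes "orthogonal_matrix P"
  shows "transpose P *v (P *v x) = x" "P *v (transpose P *v x) = x"
  using assms by (simp_all add: orthogonal_matrix_def matrix_vector_mul_assoc del: transpose_matrix_vector)

lemma orthogonal_matrix_inner:
  fixes P :: "real ^ 'n ^ 'n"
  assumes "orthogonal_matrix P"
  shows "(P *v x) \<bullet> (P *v y) = x \<bullet> y"
  using orthogonal_matrix_mult_cancel(1)[OF assms, of y]
  by (metis dot_lmul_matrix transpose_matrix_vector inner_commute)

lemma inner_transpose_mult: "x \<bullet> (transpose T *v y) = (T *v x) \<bullet> (y :: real ^ 'm)"
  by (metis dot_lmul_matrix inner_commute transpose_matrix_vector)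

lemma spectral_qform:
  fixes P :: "real ^ 'n ^ 'n"
  assumes "S = transpose P ** diag_mat e ** P"
  shows "x \<bullet> (S *v x) = (\<Sum>i\<in>UNIV. e $ i * ((P *v x) $ i)\<^sup>2)"
proof -
  have "x \<bullet> (S *v x) = (P *v x) \<bullet> (diag_mat e *v (P *v x))"
    unfolding assms matrix_vector_mul_assoc[symmetric] by (rule inner_transpose_mult)
  then show ?thesis by (simp add: inner_vec_def power2_eq_square mult_ac)
qed

lemma eigenspace_dim:
  fixes P :: "real ^ 'n ^ 'n"
  assumes P: "orthogonal_matrix P" and S: "S = transpose P ** diag_mat e ** P"
  shows "dim {x. S *v x = c *\<^sub>R x} = card {i. e $ i = c}"
proof -
  let ?D = "{y :: real ^ 'n. \<forall>i. i \<notin> {i. e $ i = c} \<longrightarrow> y $ i = 0}"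
  note cancel = orthogonal_matrix_mult_cancel[OF P]
  have Sx: "S *v x = transpose P *v (diag_mat e *v (P *v x))" for x
    unfolding S matrix_vector_mul_assoc[symmetric] ..
  have D: "diag_mat e *v y = c *\<^sub>R y \<longleftrightarrow> y \<in> ?D" for y
    by (auto simp: vec_eq_iff)
  have "S *v x = c *\<^sub>R x \<longleftrightarrow> P *v x \<in> ?D" for x
  proof -
    have "S *v x = c *\<^sub>R x \<longleftrightarrow> diag_mat e *v (P *v x) = c *\<^sub>R (P *v x)"
      unfolding Sx by (metis cancel matrix_vector_mult_scaleR)
    then show ?thesis unfolding D .
  qed
  then have eq: "{x. S *v x = c *\<^sub>R x} = (*v) (transpose P) ` ?D"
    using cancel by (auto simp: image_iff) metis+
  have "inj ((*v) (transpose P))" by (metis cancel(2) injI)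
  then have "dim ((*v) (transpose P) ` ?D) = dim ?D"
    by (intro dim_image_eq matrix_vector_mul_linear) (auto intro: inj_on_subset)
  then show ?thesis unfolding eq dim_vec_eq[symmetric]
    by (rule trans[OF _ dim_substandard_cart])
qed

lemma sorted_arrangement:
  fixes e :: "'n :: {finite, linorder} \<Rightarrow> real"
  obtains d :: "'n \<Rightarrow> real" where "mono d" "\<And>c. card {i. d i = c} = card {i. e i = c}"
proof -
  define xs where "xs = sorted_list_of_set (UNIV :: 'n set)"
  define ys where "ys = sort (map e xs)"
  have xs: "sorted xs" "distinct xs" "set xs = UNIV" by (auto simp: xs_def)
  have len: "length ys = length xs" by (simp add: ys_def)
  define d where "d i = the (map_of (zip xs ys) i)" for i
  have d: "d (xs ! a) = ys ! a" if "a < length xs" for a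
    using that len xs by (simp add: d_def map_of_zip_nth)
  have map: "map d xs = ys"
    by (rule nth_equalityI) (auto simp: len d)
  have cnt: "count (mset (map f xs)) c = card {i. f i = c}" for f :: "'n \<Rightarrow> real" and c
  proof -
    have "mset (map f xs) = image_mset f (mset_set UNIV)"
      using mset_set_set[OF xs(2)] xs(3) by simp
    then show ?thesis by (simp add: count_image_mset vimage_def)
  qed
  show thesis
  proof (rule that)
    show "mono d"
    proof (rule monoI)
      fix i j :: 'n assume ij: "i \<le> j"
      obtain a b where ab: "a < length xs" "xs ! a = i" "b < length xs" "xs ! b = j"
        using xs(3) by (metis UNIV_I in_set_conv_nth)
      have "a \<le> b"
      proof (rule ccontr)
        assume "\<not> a \<le> b"
        then have "xs ! b \<le> xs ! a" using xs(1) ab by (auto intro: sorted_nth_mono)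
        then have "xs ! a = xs ! b" using ij ab by simp
        then show False using nth_eq_iff_index_eq[OF xs(2) ab(1,3)] \<open>\<not> a \<le> b\<close> by simp
      qed
      then have "ys ! a \<le> ys ! b" using ab len by (intro sorted_nth_mono) (auto simp: ys_def)
      then show "d i \<le> d j" using d ab by metis
    qed
    show "card {i. d i = c} = card {i. e i = c}" for c
      unfolding cnt[symmetric] map ys_def by simp
  qed
qed

text \<open>
  Equal multiplicities give equal counting functions \<open>card {i. d i \<le> x}\<close>, and a monotone family is
  determined by its counting function.
\<close>

lemma mono_eq_of_equal_multiplicities:
  fixes d d' :: "'n :: {finite, linorder} \<Rightarrow> real"
  assumes d: "mono d" "mono d'" and card: "\<And>c. card {i. d i = c} = card {i. d' i = c}"
  shows "d = d'"
proof -
  have le: "card {i. d i \<le> x} = card {i. d' i \<le> x}" for x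
  proof -
    have "card {i. f i \<le> x} = (\<Sum>c\<in>{c \<in> range d \<union> range d'. c \<le> x}. card {i. f i = c})"
      if "f = d \<or> f = d'" for f
    proof -
      have "{i. f i \<le> x} = (\<Union>c\<in>{c \<in> range d \<union> range d'. c \<le> x}. {i. f i = c})" using that by auto
      then show ?thesis by (subst card_UN_disjoint[symmetric]) auto
    qed
    from this[of d] this[of d'] show ?thesis using card by simp
  qed
  have "f i \<le> g i" if "mono f" "mono g" "\<And>x. card {i. f i \<le> x} = card {i. g i \<le> x}" for f g :: "'n \<Rightarrow> real" and i
  proof (rule ccontr)
    assume c: "\<not> f i \<le> g i"
    have "{j. f j \<le> g i} \<subset> {j. g j \<le> g i}"
    proof
      show "{j. f j \<le> g i} \<subseteq> {j. g j \<le> g i}"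
      proof clarify
        fix j assume "f j \<le> g i"
        then have "j < i" using c that(1) by (metis linorder_not_less monoD order_trans)
        then show "g j \<le> g i" using that(2) by (simp add: monoD)
      qed
      show "{j. f j \<le> g i} \<noteq> {j. g j \<le> g i}" using c by blast
    qed
    then have "card {j. f j \<le> g i} < card {j. g j \<le> g i}" by (intro psubset_card_mono) auto
    with that(3)[of "g i"] show False by simp
  qed
  from this[OF d le] this[OF d(2,1) le[symmetric]] show ?thesis by (simp add: fun_eq_iff order_antisym)
qed

text \<open>
  A sorted arrangement of the diagonal has the multiplicities of the eigenspaces and is the only monotone
  family which does; thus the definite description of \<open>eigvals\<close> denotes it.
\<close>

proposition mono_eigvals:
  fixes S :: "real ^ ('n :: {finite, linorder}) ^ 'n::_"
  assumes P: "orthogonal_matrix P" and S: "S = transpose P ** diag_mat e ** P"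
  shows "mono (\<lambda>i. eigvals S $ i)"
proof -
  obtain d :: "'n \<Rightarrow> real" where d: "mono d" "\<And>c. card {i. d i = c} = card {i. e $ i = c}"
    by (rule sorted_arrangement[of "\<lambda>i. e $ i"]) blast
  have "mono (\<lambda>i. eigvals S $ i) \<and> (\<forall>c. card {i. eigvals S $ i = c} = dim {x. S *v x = c *\<^sub>R x})"
    unfolding eigvals_def
  proof (rule theI[of _ "\<chi> i. d i"])
    show "mono (\<lambda>i. (\<chi> i. d i) $ i) \<and> (\<forall>c. card {i. (\<chi> i. d i) $ i = c} = dim {x. S *v x = c *\<^sub>R x})"
      using d eigenspace_dim[OF P S] by simp
    fix d' :: "real ^ 'n::_"
    assume "mono (\<lambda>i. d' $ i) \<and> (\<forall>c. card {i. d' $ i = c} = dim {x. S *v x = c *\<^sub>R x})"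
    then have "(\<lambda>i. d' $ i) = d"
      using d eigenspace_dim[OF P S] by (intro mono_eq_of_equal_multiplicities) auto
    then show "d' = (\<chi> i. d i)" by (auto simp: vec_eq_iff)
  qed
  then show ?thesis ..
qed

text \<open>
  The Courant-Fischer argument: the span of the eigenvectors \<open>i\<close> and \<open>Max UNIV\<close> meets the hyperplane
  orthogonal to \<open>z\<close> in a nonzero vector, and on this span the form is at least \<open>e $ i\<close> times the squared
  norm.
\<close>

lemma lower_eigenvalues_le:
  fixes P :: "real ^ ('n :: {finite, linorder}) ^ 'n::_"
  assumes P: "orthogonal_matrix P" and S: "S = transpose P ** diag_mat e ** P"
    and mono: "mono (\<lambda>i. e $ i)"
    and z: "\<And>x. x \<bullet> z = 0 \<Longrightarrow> x \<bullet> (S *v x) \<le> - c * (norm x)\<^sup>2"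
    and i: "i \<noteq> Max UNIV"
  shows "e $ i \<le> - c"
proof -
  let ?k = "Max UNIV :: 'n"
  define w where "w = P *v z"
  \<comment> \<open>a nonzero combination of the two eigenvectors orthogonal to \<open>z\<close>, also when both are orthogonal to it\<close>
  define a where "a = (if w $ i = 0 \<and> w $ ?k = 0 then 1 else - w $ ?k)"
  define b where "b = (if w $ i = 0 \<and> w $ ?k = 0 then 0 else w $ i)"
  define y :: "real ^ 'n::_" where "y = a *\<^sub>R axis i 1 + b *\<^sub>R axis ?k 1"
  define x where "x = transpose P *v y"
  have Px: "P *v x = y" unfolding x_def by (rule orthogonal_matrix_mult_cancel(2)[OF P])
  have ab: "0 < a\<^sup>2 + b\<^sup>2"
    by (auto simp: a_def b_def sum_power2_gt_zero_iff)
  have yn: "y $ i = a" "y $ ?k = b" using i by (auto simp: y_def axis_def)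
  have y0: "y $ j = 0" if "j \<noteq> i" "j \<noteq> ?k" for j using that by (simp add: y_def axis_def)
  have sumy: "(\<Sum>j\<in>UNIV. f j * (y $ j)\<^sup>2) = f i * a\<^sup>2 + f ?k * b\<^sup>2" for f :: "'n \<Rightarrow> real"
  proof -
    have "(\<Sum>j\<in>UNIV. f j * (y $ j)\<^sup>2) = (\<Sum>j\<in>{i, ?k}. f j * (y $ j)\<^sup>2)"
      by (rule sum.mono_neutral_right) (auto simp: y0)
    then show ?thesis using i yn by simp
  qed
  have "x \<bullet> z = y \<bullet> w"
    unfolding w_def using orthogonal_matrix_inner[OF P, of x z] Px by simp
  also have "\<dots> = a * w $ i + b * w $ ?k"
    by (simp add: y_def inner_add_left inner_axis')
  also have "\<dots> = 0" by (simp add: a_def b_def)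
  finally have "x \<bullet> (S *v x) \<le> - c * (norm x)\<^sup>2" by (rule z)
  moreover have "x \<bullet> (S *v x) = e $ i * a\<^sup>2 + e $ ?k * b\<^sup>2"
    unfolding spectral_qform[OF S] Px by (rule sumy)
  moreover have "e $ i * b\<^sup>2 \<le> e $ ?k * b\<^sup>2"
    using mono by (intro mult_right_mono) (auto simp: mono_def)
  moreover have "(norm x)\<^sup>2 = a\<^sup>2 + b\<^sup>2"
  proof -
    have "norm x = norm y" using orthogonal_matrix_inner[OF P, of x x] Px by (simp add: norm_eq_sqrt_inner)
    then show ?thesis using sumy[of "\<lambda>_. 1"] by (simp add: norm_vec_sum)
  qed
  ultimately have "e $ i * (a\<^sup>2 + b\<^sup>2) \<le> - c * (a\<^sup>2 + b\<^sup>2)"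
    by (simp add: distrib_left)
  then show ?thesis by (rule mult_right_le_imp_le[OF _ ab])
qed

text \<open>
  Otherwise a small step from \<open>x\<close> in the direction \<open>S x\<close> would make the form positive.
\<close>

lemma neg_semidef_null:
  fixes S :: "real ^ 'n ^ 'n"
  assumes sym: "transpose S = S" and neg: "\<And>x. x \<bullet> (S *v x) \<le> 0" and x: "x \<bullet> (S *v x) = 0"
  shows "S *v x = 0"
proof (rule ccontr)
  define w where "w = S *v x"
  assume "S *v x \<noteq> 0"
  then have w: "0 < w \<bullet> w" by (simp add: w_def)
  \<comment> \<open>a step length for which the quadratic term cannot outweigh the linear one\<close>
  define t where "t = w \<bullet> w / (\<bar>w \<bullet> (S *v w)\<bar> + 1)"
  have t: "0 < t" using w by (simp add: t_def)
  have xw: "x \<bullet> (S *v w) = w \<bullet> w"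
    using inner_transpose_mult[of x S w] sym by (simp add: w_def)
  have "(x + t *\<^sub>R w) \<bullet> (S *v (x + t *\<^sub>R w)) = x \<bullet> (S *v x) + 2 * t * (w \<bullet> w) + t * t * (w \<bullet> (S *v w))"
    unfolding matrix_vector_right_distrib matrix_vector_mult_scaleR inner_add_left inner_add_right
      inner_scaleR_left inner_scaleR_right xw by (simp add: w_def[symmetric] algebra_simps)
  then have "2 * t * (w \<bullet> w) + t * t * (w \<bullet> (S *v w)) \<le> 0"
    using neg[of "x + t *\<^sub>R w"] x by simp
  then have "t * (2 * (w \<bullet> w) + t * (w \<bullet> (S *v w))) \<le> 0" by (simp add: algebra_simps)
  then have "2 * (w \<bullet> w) + t * (w \<bullet> (S *v w)) \<le> 0" using t by (simp add: mult_le_0_iff)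
  moreover have "t * \<bar>w \<bullet> (S *v w)\<bar> \<le> w \<bullet> w"
    using w by (simp add: t_def field_simps)
  then have "- (w \<bullet> w) \<le> t * (w \<bullet> (S *v w))" using t by (simp add: abs_mult_pos' abs_le_iff[of "t * _"] flip: abs_mult_pos)
  ultimately show False using w by linarith
qed

text \<open>
  A second null direction orthogonal to \<open>x0\<close> would raise the dimension of the null space to two, so the
  form is negative on the orthogonal complement, and uniformly so by compactness of the sphere.
\<close>

lemma simple_null_neg_on_complement:
  fixes S :: "real ^ 'n ^ 'n"
  assumes sym: "transpose S = S" and neg: "\<And>x. x \<bullet> (S *v x) \<le> 0"
    and dim: "dim {x. S *v x = 0} = 1" and x0: "norm x0 = 1" "S *v x0 = 0"
  obtains c where "0 < c" "\<And>x. x \<bullet> x0 = 0 \<Longrightarrow> x \<bullet> (S *v x) \<le> - c * (norm x)\<^sup>2"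
proof -
  let ?K = "{x. x \<bullet> x0 = 0} \<inter> sphere 0 1"
  have strict: "x \<bullet> (S *v x) < 0" if "x \<bullet> x0 = 0" "x \<noteq> 0" for x
  proof (rule ccontr)
    assume "\<not> x \<bullet> (S *v x) < 0"
    then have "x \<bullet> (S *v x) = 0" using neg[of x] by simp
    then have "S *v x = 0" by (rule neg_semidef_null[OF sym neg])
    then have sub: "{x, x0} \<subseteq> {x. S *v x = 0}" using x0 by simp
    have "x \<noteq> x0" using that x0 by auto
    have "pairwise orthogonal {x, x0}" using that(1) by (auto simp: pairwise_def orthogonal_def inner_commute)
    moreover have "0 \<notin> {x, x0}" using that x0 by auto
    ultimately have "independent {x, x0}" by (rule pairwise_orthogonal_independent)
    then have "card {x, x0} \<le> dim {x. S *v x = 0}" using sub by (intro independent_card_le_dim)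
    then show False using dim \<open>x \<noteq> x0\<close> by simp
  qed
  have comp: "compact ?K"
    by (intro closed_Int_compact compact_sphere closed_Collect_eq continuous_intros)
  have cont: "continuous_on ?K (\<lambda>x. x \<bullet> (S *v x))"
    by (intro continuous_on_inner continuous_on_id linear_continuous_on linear_conv_bounded_linear[THEN iffD1] matrix_vector_mul_linear)
  obtain c where c: "0 < c" "\<And>x. x \<in> ?K \<Longrightarrow> x \<bullet> (S *v x) \<le> - c"
  proof (cases "?K = {}")
    case True
    show ?thesis by (rule that[of 1]) (simp_all only: True empty_iff zero_less_one)
  next
    case False
    from continuous_attains_sup[OF comp False cont] obtain m where m: "m \<in> ?K" "\<And>x. x \<in> ?K \<Longrightarrow> x \<bullet> (S *v x) \<le> m \<bullet> (S *v m)" by blast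
    then have "m \<bullet> (S *v m) < 0" by (intro strict) auto
    then show ?thesis using that[of "- (m \<bullet> (S *v m))"] m by auto
  qed
  show thesis
  proof (rule that[OF c(1)])
    fix x assume x: "x \<bullet> x0 = 0"
    show "x \<bullet> (S *v x) \<le> - c * (norm x)\<^sup>2"
    proof (cases "x = 0")
      case False
      let ?y = "(1 / norm x) *\<^sub>R x"
      have "?y \<in> ?K" using x False by simp
      then have "?y \<bullet> (S *v ?y) \<le> - c" by (rule c(2))
      then show ?thesis using False by (simp add: matrix_vector_mult_scaleR power2_eq_square field_simps)
    qed simp
  qed
qed

section \<open>Gaussian moments and the change to rescaled eigencoordinates\<close>

text \<open>
  The mass of the whole space is invariant under the maps \<open>1 + h N\<close>, hence its derivative vanishes.
\<close>

lemma gauss_stein_identity: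
  fixes N :: "real ^ 'n ^ 'n"
  shows "(\<integral>y. ((y - \<nu>) \<bullet> (N *v y)) * gauss (mat 1) \<nu> y \<partial>lborel) = trace N * (\<integral>y. gauss (mat 1) \<nu> y \<partial>lborel)"
proof -
  have c: "0 < (1 :: real)" "\<And>y :: real ^ 'n. 1 * norm y \<le> norm (mat 1 *v y)" by auto
  let ?L = "\<lambda>h. mat 1 + h *\<^sub>R N + h\<^sup>2 *\<^sub>R (0 :: real ^ 'n ^ 'n)"
  let ?F = "\<lambda>h. \<bar>det (?L h)\<bar> * (\<integral>y. indicator UNIV y * gauss (mat 1) \<nu> (?L h *v y) \<partial>lborel)"
  have "(?F has_real_derivative trace N * (\<integral>y. indicator UNIV y * gauss (mat 1) \<nu> y \<partial>lborel) -
           (\<integral>y. indicator UNIV y * ((mat 1 *v y - \<nu>) \<bullet> (mat 1 *v (N *v y))) * gauss (mat 1) \<nu> y \<partial>lborel)) (at 0)"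
    by (rule has_real_derivative_transported_gauss_integral[OF c]) simp
  moreover have "\<forall>\<^sub>F h in nhds 0. ?F h = (\<integral>y. gauss (mat 1) \<nu> y \<partial>lborel)"
    using eventually_det_near_identity_pos[of N 0]
  proof eventually_elim
    case (elim h)
    then show ?case using integral_linear_change(2)[of "gauss (mat 1) \<nu>" "?L h"] by simp
  qed
  then have "(?F has_real_derivative 0) (at 0)"
    by (subst DERIV_cong_ev[OF refl _ refl]) auto
  ultimately show ?thesis using DERIV_unique by fastforce
qed

lemma integrable_id_gauss:
  assumes "w \<in> borel_measurable borel" "\<And>y. \<bar>w y\<bar> \<le> K * (1 + norm y)\<^sup>2"
  shows "integrable lborel (\<lambda>y :: real ^ 'n. w y * gauss (mat 1) \<nu> y)"
  using integrable_weighted_gauss[of 1 "mat 1" UNIV w K \<nu>] assms by simp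

lemma gauss_first_moment:
  fixes \<nu> :: "real ^ 'n"
  shows "(\<integral>y. (y $ i - \<nu> $ i) * gauss (mat 1) \<nu> y \<partial>lborel) = 0"
proof -
  let ?f = "\<lambda>z :: real ^ 'n. z $ i * exp (- (norm z)\<^sup>2 / 2)"
  have "(\<integral>y. (y $ i - \<nu> $ i) * gauss (mat 1) \<nu> y \<partial>lborel) =
      (\<integral>y. (y $ i - \<nu> $ i) * gauss (mat 1) \<nu> y \<partial>distr lborel borel ((+) \<nu>))"
    by (simp add: lborel_distr_plus)
  also have "\<dots> = (\<integral>z. ?f z \<partial>lborel)"
    by (subst integral_distr) (auto simp: gauss_def)
  finally have 1: "(\<integral>y. (y $ i - \<nu> $ i) * gauss (mat 1) \<nu> y \<partial>lborel) = (\<integral>z. ?f z \<partial>lborel)" .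
  have "(\<integral>z. ?f z \<partial>lborel) = (\<integral>z. ?f (coordinate_reflection i *v z) \<partial>lborel)"
    by (rule integral_coordinate_reflection) measurable
  also have "\<dots> = - (\<integral>z. ?f z \<partial>lborel)"
    by simp
  finally show ?thesis using 1 by simp
qed

text \<open>
  The Stein identity for the matrix with the single entry \<open>(i, i)\<close>.
\<close>

lemma gauss_second_moment:
  fixes \<nu> :: "real ^ 'n"
  shows "(\<integral>y. (y $ i)\<^sup>2 * gauss (mat 1) \<nu> y \<partial>lborel) = (1 + (\<nu> $ i)\<^sup>2) * (\<integral>y. gauss (mat 1) \<nu> y \<partial>lborel)"
    and integrable_second_moment: "integrable lborel (\<lambda>y. (y $ i)\<^sup>2 * gauss (mat 1) \<nu> y)"
proof -
  define N :: "real ^ 'n ^ 'n" where "N = (\<chi> p q. if p = i \<and> q = i then 1 else 0)"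
  have Ny: "N *v y = axis i (y $ i)" for y
  proof -
    have "(\<Sum>q\<in>UNIV. (if p = i \<and> q = i then 1 else 0) * y $ q) = (\<Sum>q\<in>UNIV. if q = i then (if p = i then y $ i else 0) else 0)" for p
      by (intro sum.cong) auto
    then show ?thesis by (auto simp: N_def matrix_vector_mult_def vec_eq_iff axis_def)
  qed
  have tr: "trace N = 1" by (simp add: trace_def N_def)
  let ?Z = "\<integral>y. gauss (mat 1) \<nu> y \<partial>lborel"
  have c1: "\<bar>y $ i\<bar> \<le> 1 + norm y" for y :: "real ^ 'n" using component_le_norm_cart[of y i] by linarith
  have nu: "\<bar>y $ i - \<nu> $ i\<bar> \<le> (1 + \<bar>\<nu> $ i\<bar>) * (1 + norm y)" for y :: "real ^ 'n"
  proof -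
    have "\<bar>y $ i - \<nu> $ i\<bar> \<le> norm y + \<bar>\<nu> $ i\<bar>" using component_le_norm_cart[of y i] by linarith
    also have "\<dots> \<le> (1 + \<bar>\<nu> $ i\<bar>) * (1 + norm y)"
      using mult_nonneg_nonneg[of "\<bar>\<nu> $ i\<bar>" "norm y"] by (simp add: distrib_left distrib_right)
    finally show ?thesis .
  qed
  have i1: "integrable lborel (\<lambda>y. ((y $ i - \<nu> $ i) * y $ i) * gauss (mat 1) \<nu> y)"
  proof (rule integrable_id_gauss[where K = "1 + \<bar>\<nu> $ i\<bar>"])
    fix y :: "real ^ 'n"
    have "\<bar>y $ i - \<nu> $ i\<bar> * \<bar>y $ i\<bar> \<le> ((1 + \<bar>\<nu> $ i\<bar>) * (1 + norm y)) * (1 + norm y)"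
      by (intro mult_mono nu c1) auto
    then show "\<bar>(y $ i - \<nu> $ i) * y $ i\<bar> \<le> (1 + \<bar>\<nu> $ i\<bar>) * (1 + norm y)\<^sup>2"
      by (simp add: abs_mult power2_eq_square mult_ac)
  qed measurable
  have i2: "integrable lborel (\<lambda>y. (y $ i - \<nu> $ i) * gauss (mat 1) \<nu> y)"
  proof (rule integrable_id_gauss[where K = "1 + \<bar>\<nu> $ i\<bar>"])
    fix y :: "real ^ 'n"
    have "(1 + \<bar>\<nu> $ i\<bar>) * (1 + norm y) \<le> (1 + \<bar>\<nu> $ i\<bar>) * (1 + norm y)\<^sup>2"
      by (intro mult_left_mono self_le_power) auto
    then show "\<bar>y $ i - \<nu> $ i\<bar> \<le> (1 + \<bar>\<nu> $ i\<bar>) * (1 + norm y)\<^sup>2"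
      using nu[of y] by linarith
  qed measurable
  have i3: "integrable lborel (\<lambda>y. gauss (mat 1) \<nu> y)"
    using integrable_gauss[of 1 "mat 1" \<nu>] by simp
  have split: "(y $ i)\<^sup>2 * gauss (mat 1) \<nu> y = ((y $ i - \<nu> $ i) * y $ i) * gauss (mat 1) \<nu> y +
      \<nu> $ i * ((y $ i - \<nu> $ i) * gauss (mat 1) \<nu> y) + (\<nu> $ i)\<^sup>2 * gauss (mat 1) \<nu> y" for y
    by (simp add: power2_eq_square algebra_simps)
  have st: "(\<integral>y. ((y $ i - \<nu> $ i) * y $ i) * gauss (mat 1) \<nu> y \<partial>lborel) = ?Z"
    using gauss_stein_identity[of \<nu> N] unfolding Ny tr by (simp add: inner_axis)
  show "integrable lborel (\<lambda>y. (y $ i)\<^sup>2 * gauss (mat 1) \<nu> y)"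
    unfolding split using i1 i2 i3 by (intro Bochner_Integration.integrable_add integrable_mult_right)
  show "(\<integral>y. (y $ i)\<^sup>2 * gauss (mat 1) \<nu> y \<partial>lborel) = (1 + (\<nu> $ i)\<^sup>2) * ?Z"
    unfolding split using i1 i2 i3 by (simp add: st gauss_first_moment distrib_right)
qed

lemma gauss_integral_pos: "0 < (\<integral>y. gauss (mat 1) (\<nu> :: real ^ 'n) y \<partial>lborel)"
proof -
  have i: "integrable lborel (gauss (mat 1) \<nu>)"
    using integrable_gauss[of 1 "mat 1" \<nu>] by simp
  have "(\<integral>y. gauss (mat 1) \<nu> y \<partial>lborel) \<noteq> 0"
  proof
    assume "(\<integral>y. gauss (mat 1) \<nu> y \<partial>lborel) = 0"
    then have "AE y in lborel. gauss (mat 1) \<nu> y = 0"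
      by (subst (asm) integral_nonneg_eq_0_iff_AE[OF i]) (auto simp: gauss_nonneg)
    then have "AE y in (lborel :: (real ^ 'n) measure). False"
      by eventually_elim (use gauss_pos less_irrefl in metis)
    then show False by (simp add: AE_iff_null emeasure_lborel_UNIV null_sets_def)
  qed
  moreover have "0 \<le> (\<integral>y. gauss (mat 1) \<nu> y \<partial>lborel)"
    by (intro integral_nonneg_AE) (auto simp: gauss_nonneg)
  ultimately show ?thesis by linarith
qed

text \<open>
  The passage to eigencoordinates rescaled by \<open>s\<close>; the rotation leaves the standard covariance
  unchanged.
\<close>

lemma integral_mvn_density_transform:
  fixes P :: "real ^ 'n ^ 'n" and s \<mu> :: "real ^ 'n" and g :: "real ^ 'n \<Rightarrow> real"
  assumes P: "orthogonal_matrix P" and s: "\<And>i. 0 < s $ i" and g[measurable]: "g \<in> borel_measurable borel"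
  defines "T \<equiv> transpose P ** diag_mat s"
  shows "(\<integral>x. mvn_density \<mu> x * g x \<partial>lborel) =
    (2 * pi) powr (- real CARD('n) / 2) * (\<Prod>i\<in>UNIV. s $ i) *
    (\<integral>y. g (T *v y) * gauss (diag_mat s) (P *v \<mu>) y \<partial>lborel)"
proof -
  have detS: "det (diag_mat s) = (\<Prod>i\<in>UNIV. s $ i)"
    by (subst det_diagonal) (auto simp: diag_mat_def)
  have pos: "0 < (\<Prod>i\<in>UNIV. s $ i)" using s by (intro prod_pos) auto
  have "\<bar>det P\<bar> = 1" using det_orthogonal_matrix[OF P] by auto
  then have det: "\<bar>det T\<bar> = (\<Prod>i\<in>UNIV. s $ i)"
    using pos by (simp add: T_def det_mul det_transpose abs_mult detS)
  have dens: "mvn_density \<mu> (T *v y) = (2 * pi) powr (- real CARD('n) / 2) * gauss (diag_mat s) (P *v \<mu>) y" for y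
  proof -
    have PT: "P *v (T *v y) = diag_mat s *v y"
      unfolding T_def matrix_vector_mul_assoc[symmetric] by (rule orthogonal_matrix_mult_cancel(2)[OF P])
    have "norm (T *v y - \<mu>) = norm (P *v (T *v y - \<mu>))"
      using orthogonal_matrix_inner[OF P, of "T *v y - \<mu>" "T *v y - \<mu>"] by (simp add: norm_eq_sqrt_inner)
    also have "P *v (T *v y - \<mu>) = diag_mat s *v y - P *v \<mu>"
      by (simp add: matrix_vector_mult_diff_distrib PT)
    finally show ?thesis by (simp add: mvn_density_def gauss_def)
  qed
  have [measurable]: "mvn_density \<mu> \<in> borel_measurable borel"
    unfolding mvn_density_def[abs_def] by measurable
  have "(\<integral>x. mvn_density \<mu> x * g x \<partial>lborel) = \<bar>det T\<bar> * (\<integral>y. mvn_density \<mu> (T *v y) * g (T *v y) \<partial>lborel)"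
    by (rule integral_linear_change(2)) (use det pos in auto)
  also have "(\<integral>y. mvn_density \<mu> (T *v y) * g (T *v y) \<partial>lborel) =
      (\<integral>y. (2 * pi) powr (- real CARD('n) / 2) * (g (T *v y) * gauss (diag_mat s) (P *v \<mu>) y) \<partial>lborel)"
    unfolding dens by (intro Bochner_Integration.integral_cong refl) (simp only: mult_ac)
  also have "\<dots> = (2 * pi) powr (- real CARD('n) / 2) * (\<integral>y. g (T *v y) * gauss (diag_mat s) (P *v \<mu>) y \<partial>lborel)"
    by (rule integral_mult_right_zero)
  finally show ?thesis unfolding det by (simp only: mult_ac)
qed

section \<open>The law of a ratio of quadratic forms\<close>

lemma pos_semidef_null:
  fixes B :: "real ^ 'n ^ 'n"
  assumes B: "pos_semidef B" and x: "x \<bullet> (B *v x) = 0"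
  shows "B *v x = 0"
proof -
  have m: "(- 1 *\<^sub>R B) *v y = - (B *v y)" for y
    by (simp only: scaleR_matrix_vector_assoc[symmetric]) simp
  have "(- 1 *\<^sub>R B) *v x = 0"
  proof (rule neg_semidef_null)
    show "transpose (- 1 *\<^sub>R B) = - 1 *\<^sub>R B"
      using B by (simp add: pos_semidef_def transpose_def vec_eq_iff)
    show "y \<bullet> ((- 1 *\<^sub>R B) *v y) \<le> 0" for y using B by (simp only: m) (simp add: pos_semidef_def)
    show "x \<bullet> ((- 1 *\<^sub>R B) *v x) = 0" using x by (simp only: m) simp
  qed
  then show ?thesis by (simp only: m) simp
qed

text \<open>
  The form of the denominator in the coordinates of \<open>edge_scales\<close>, in units of the top eigenvalue.
\<close>

definition scaled_form :: "'n :: finite \<Rightarrow> real ^ 'n \<Rightarrow> real ^ 'n ^ 'n \<Rightarrow> real ^ 'n ^ 'n" where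
  "scaled_form k e H = (\<chi> i j. H $ i $ j * edge_scales k e $ i * edge_scales k e $ j / e $ k)"

lemma scaled_form_inner:
  "x \<bullet> (scaled_form k e H *v y) = (diag_mat (edge_scales k e) *v x) \<bullet> (H *v (diag_mat (edge_scales k e) *v y)) / e $ k"
  unfolding inner_vec_def
  by (simp add: scaled_form_def matrix_vector_mult_def[of H] matrix_vector_mult_def[of "vec_lambda _"] sum_distrib_left sum_divide_distrib mult_ac)

lemma scaled_diagonal_inner:
  assumes e: "0 < e $ k" "\<And>i. i \<noteq> k \<Longrightarrow> e $ i < 0"
  shows "(\<Sum>i\<in>UNIV. e $ i * (edge_scales k e $ i * y $ i)\<^sup>2) = e $ k * (y \<bullet> (lorentz_mat k *v y))"
proof -
  have "e $ i * (edge_scales k e $ i * y $ i)\<^sup>2 = e $ k * (y $ i * (lorentz_mat k *v y) $ i)" for i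
  proof (cases "i = k")
    case True
    then show ?thesis by (simp add: edge_scales_def lorentz_mat_mult_vec power2_eq_square)
  next
    case False
    have "0 \<le> e $ k / - e $ i" using e False by (intro divide_nonneg_pos) auto
    then have "(edge_scales k e $ i)\<^sup>2 = e $ k / - e $ i"
      using False unfolding edge_scales_def by (simp only: vec_lambda_beta if_False real_sqrt_pow2)
    moreover have "e $ i \<noteq> 0" using e(2)[OF False] by simp
    ultimately have "e $ i * (edge_scales k e $ i)\<^sup>2 = - e $ k" by simp
    then show ?thesis using False
      by (simp add: lorentz_mat_mult_vec power_mult_distrib mult.assoc[symmetric]) (simp add: power2_eq_square mult_ac)
  qed
  then show ?thesis by (simp add: inner_vec_def sum_distrib_left)
qed

locale gauss_ratio = prob_space M for M :: "'w measure" +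
  fixes A B :: "real ^ ('n :: finite) ^ 'n" and \<mu> :: "real ^ 'n" and \<epsilon> :: "'w \<Rightarrow> real ^ 'n" and R :: "'w \<Rightarrow> real"
  assumes A_sym: "transpose A = A"
    and B_psd: "pos_semidef B" and B_nz: "B \<noteq> 0"
    and eps: "distributed M lborel \<epsilon> (\<lambda>x. ennreal (mvn_density \<mu> x))"
    and R_eq: "R = (\<lambda>\<omega>. qform A (\<epsilon> \<omega>) / qform B (\<epsilon> \<omega>))"
begin

lemma measurable_eps [measurable]: "\<epsilon> \<in> borel_measurable M"
  using eps by (simp add: distributed_def)

lemma measurable_R [measurable]: "R \<in> borel_measurable M"
  unfolding R_eq qform_def by measurable

lemma expectation_eps:
  assumes "g \<in> borel_measurable borel"
  shows "(\<integral>\<omega>. g (\<epsilon> \<omega>) \<partial>M) = (\<integral>x. mvn_density \<mu> x * g x \<partial>lborel)"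
  using distributed_integral[OF eps, of g] assms by (simp add: mvn_density_def)

text \<open>
  The null space of \<open>B\<close> is a proper subspace and thus negligible.
\<close>

lemma qform_B_pos: "AE \<omega> in M. 0 < qform B (\<epsilon> \<omega>)"
proof -
  have ne: "{x. B *v x = 0} \<noteq> UNIV"
  proof
    assume "{x. B *v x = 0} = UNIV"
    then have "B *v x = 0 *v x" for x by auto
    then have "B = 0" by (simp add: matrix_eq)
    with B_nz show False by simp
  qed
  have sub: "subspace {x. B *v x = 0}"
    by (auto simp: subspace_def matrix_vector_right_distrib matrix_vector_mult_scaleR)
  have "dim {x. B *v x = 0} < DIM(real ^ 'n)"
  proof -
    have "dim {x. B *v x = 0} \<noteq> DIM(real ^ 'n)"
      using ne sub by (metis dim_eq_full span_eq_iff)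
    moreover have "dim {x. B *v x = 0} \<le> DIM(real ^ 'n)" by (rule dim_subset_UNIV)
    ultimately show ?thesis by linarith
  qed
  then have "negligible {x. B *v x = 0}" by (rule negligible_lowdim)
  moreover have "closed {x. B *v x = 0}" by (rule closed_subspace[OF sub])
  ultimately have "{x. B *v x = 0} \<in> null_sets lborel"
    using null_sets_completion_iff[of "{x. B *v x = 0}" lborel]
    by (simp add: negligible_iff_null_sets borel_closed)
  then have "AE x in lborel. x \<notin> {x. B *v x = 0}" by (rule AE_not_in)
  then have "AE x in density lborel (\<lambda>x. ennreal (mvn_density \<mu> x)). 0 < qform B x"
  proof (subst AE_density)
    have "0 < qform B x" if "B *v x \<noteq> 0" for x
      using that pos_semidef_null[OF B_psd, of x] B_psd unfolding qform_def pos_semidef_def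
      by (metis order_le_less)
    with \<open>AE x in lborel. x \<notin> {x. B *v x = 0}\<close>
    show "AE x in lborel. 0 < ennreal (mvn_density \<mu> x) \<longrightarrow> 0 < qform B x" by (auto elim!: eventually_mono)
  qed (use eps in \<open>simp add: distributed_def\<close>)
  moreover have "distr M lborel \<epsilon> = density lborel (\<lambda>x. ennreal (mvn_density \<mu> x))"
    using eps by (simp add: distributed_def)
  ultimately have "AE x in distr M lborel \<epsilon>. 0 < qform B x" by (simp only:)
  then show ?thesis by (rule AE_distrD[rotated]) simp
qed

lemma prob_R_gt_eq:
  "measure M {\<omega> \<in> space M. R \<omega> > r} = (\<integral>x. mvn_density \<mu> x * indicator {x. 0 < x \<bullet> ((A - r *\<^sub>R B) *v x)} x \<partial>lborel)"
proof -
  let ?S = "{x. 0 < x \<bullet> ((A - r *\<^sub>R B) *v x)}"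
  have "measure M {\<omega> \<in> space M. R \<omega> > r} = (\<integral>\<omega>. indicator {\<omega> \<in> space M. R \<omega> > r} \<omega> \<partial>M)"
  proof -
    have "{\<omega> \<in> space M. R \<omega> > r} \<inter> space M = {\<omega> \<in> space M. R \<omega> > r}" by auto
    then show ?thesis by simp
  qed
  also have "\<dots> = (\<integral>\<omega>. indicator ?S (\<epsilon> \<omega>) \<partial>M)"
  proof (rule integral_cong_AE)
    show "AE \<omega> in M. indicator {\<omega> \<in> space M. R \<omega> > r} \<omega> = (indicator ?S (\<epsilon> \<omega>) :: real)"
      using qform_B_pos AE_space
    proof eventually_elim
      case (elim \<omega>)
      have "\<epsilon> \<omega> \<bullet> ((A - r *\<^sub>R B) *v \<epsilon> \<omega>) = qform A (\<epsilon> \<omega>) - r * qform B (\<epsilon> \<omega>)"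
        by (simp add: qform_def matrix_vector_mult_diff_rdistrib inner_diff_right scaleR_matrix_vector_assoc[symmetric])
      then have "R \<omega> > r \<longleftrightarrow> \<epsilon> \<omega> \<in> ?S"
        using elim(1) by (simp add: R_eq pos_less_divide_eq)
      then show ?case using elim(2) by (simp add: indicator_def)
    qed
  qed measurable
  also have "\<dots> = (\<integral>x. mvn_density \<mu> x * indicator ?S x \<partial>lborel)"
    by (rule expectation_eps) measurable
  finally show ?thesis .
qed

lemma cdf_R: "cdf (distr M borel R) r = 1 - measure M {\<omega> \<in> space M. R \<omega> > r}"
proof -
  have "cdf (distr M borel R) r = measure M {\<omega> \<in> space M. R \<omega> \<le> r}"
    by (simp add: cdf_def measure_distr vimage_def Int_def conj_commute)
  also have "{\<omega> \<in> space M. R \<omega> \<le> r} = space M - {\<omega> \<in> space M. R \<omega> > r}" by auto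
  also have "measure M \<dots> = 1 - measure M {\<omega> \<in> space M. R \<omega> > r}" by (rule prob_compl) measurable
  finally show ?thesis .
qed

text \<open>
  By the Lindelof property the complement of the support is a countable union of open null sets.
\<close>

lemma AE_in_support: "AE \<omega> in M. R \<omega> \<in> rv_support M R"
proof -
  let ?D = "distr M borel R"
  interpret D: prob_space ?D by (rule prob_space_distr) simp
  define F where "F = {U :: real set. open U \<and> measure ?D U = 0}"
  have "\<exists>F'\<subseteq>F. countable F' \<and> \<Union>F' = \<Union>F"
    by (rule Lindelof[of F]) (auto simp: F_def)
  then obtain F' where F': "F' \<subseteq> F" "countable F'" "\<Union>F' = \<Union>F" by blast
  have comp: "- rv_support M R = \<Union>F'"
    unfolding F' rv_support_def F_def by (auto simp: zero_less_measure_iff)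
  have "(\<Union>U\<in>F'. U) \<in> null_sets ?D"
  proof (rule null_sets_UN'[OF F'(2)])
    fix U assume "U \<in> F'"
    then have "open U" "measure ?D U = 0" using F' by (auto simp: F_def)
    then show "U \<in> null_sets ?D" by (auto simp: null_sets_def D.emeasure_eq_measure)
  qed
  then have "\<Union>F' \<in> null_sets ?D" by simp
  then have "AE x in ?D. x \<notin> \<Union>F'" by (rule AE_not_in)
  then have "AE \<omega> in M. R \<omega> \<notin> \<Union>F'" by (rule AE_distrD[rotated]) simp
  then show ?thesis by eventually_elim (use comp in auto)
qed

lemma left_end_less_right_end:
  assumes nd: "\<not> (\<exists>c. AE \<omega> in M. R \<omega> = c)"
  shows "left_end M R < right_end M R"
proof -
  have ne: "rv_support M R \<noteq> {}"
  proof
    assume "rv_support M R = {}"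
    with AE_in_support have "AE \<omega> in M. False" by simp
    then show False using AE_False by simp
  qed
  then obtain x where x: "x \<in> rv_support M R" by blast
  have "\<exists>y\<in>rv_support M R. y \<noteq> x"
  proof (rule ccontr)
    assume "\<not> (\<exists>y\<in>rv_support M R. y \<noteq> x)"
    then have "AE \<omega> in M. R \<omega> = x" using AE_in_support by (auto elim!: eventually_mono)
    with nd show False by blast
  qed
  then obtain y where y: "y \<in> rv_support M R" "y \<noteq> x" by blast
  have "left_end M R \<le> ereal (min x y)" unfolding left_end_def
    using x y by (intro INF_lower) (auto simp: min_def)
  also have "ereal (min x y) < ereal (max x y)"
    unfolding less_ereal.simps using y(2) by (auto simp: min_def max_def)
  also have "ereal (max x y) \<le> right_end M R" unfolding right_end_def
    using x y by (intro SUP_upper) (auto simp: max_def)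
  finally show ?thesis .
qed

lemma prob_R_gt_pos:
  assumes "ereal r < right_end M R"
  shows "0 < measure M {\<omega> \<in> space M. R \<omega> > r}"
proof -
  from assms obtain x where x: "x \<in> rv_support M R" "r < x"
    unfolding right_end_def less_SUP_iff by auto
  then have "0 < measure (distr M borel R) {r<..}"
    unfolding rv_support_def by (auto dest!: spec[of _ "{r<..}"])
  also have "measure (distr M borel R) {r<..} = measure M {\<omega> \<in> space M. R \<omega> > r}"
    by (simp add: measure_distr vimage_def Int_def conj_commute)
  finally show ?thesis .
qed

context
  fixes r :: real and e :: "real ^ 'n" and P :: "real ^ 'n ^ 'n" and k :: 'n
  assumes P: "orthogonal_matrix P" and diag: "A - r *\<^sub>R B = transpose P ** diag_mat e ** P"
begin

abbreviation (input) H :: "real ^ 'n ^ 'n" where "H \<equiv> P ** B ** transpose P"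

lemma H_inner: "(P *v x) \<bullet> (H *v (P *v y)) = x \<bullet> (B *v y)"
proof -
  have "H *v (P *v y) = P *v (B *v y)"
    unfolding matrix_vector_mul_assoc[symmetric] orthogonal_matrix_mult_cancel(1)[OF P] ..
  then show ?thesis using orthogonal_matrix_inner[OF P] by simp
qed

text \<open>
  The sign of the mean is that of the sum, which decides which branch of the Lugannani-Rice formula is
  in force.
\<close>

lemma mean_eq:
  "(\<integral>\<omega>. qform (A - r *\<^sub>R B) (\<epsilon> \<omega>) \<partial>M) = (2 * pi) powr (- real CARD('n) / 2) *
     (\<Sum>i\<in>UNIV. e $ i * (1 + ((P *v \<mu>) $ i)\<^sup>2)) * (\<integral>y. gauss (mat 1) (P *v \<mu>) y \<partial>lborel)"
proof -
  define s :: "real ^ 'n" where "s = (\<chi> i. 1)"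
  have ds: "diag_mat s = mat 1" by (auto simp: diag_mat_def mat_def s_def vec_eq_iff)
  have q: "qform (A - r *\<^sub>R B) (transpose P *v y) = (\<Sum>i\<in>UNIV. e $ i * (y $ i)\<^sup>2)" for y
    unfolding qform_def spectral_qform[OF diag] orthogonal_matrix_mult_cancel(2)[OF P] ..
  have "(\<integral>\<omega>. qform (A - r *\<^sub>R B) (\<epsilon> \<omega>) \<partial>M) = (\<integral>x. mvn_density \<mu> x * qform (A - r *\<^sub>R B) x \<partial>lborel)"
    by (rule expectation_eps) (simp add: qform_def)
  also have "\<dots> = (2 * pi) powr (- real CARD('n) / 2) * (\<Prod>i\<in>UNIV. s $ i) *
      (\<integral>y. qform (A - r *\<^sub>R B) ((transpose P ** diag_mat s) *v y) * gauss (diag_mat s) (P *v \<mu>) y \<partial>lborel)"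
    by (rule integral_mvn_density_transform[OF P]) (auto simp: s_def qform_def)
  also have "\<dots> = (2 * pi) powr (- real CARD('n) / 2) * (\<integral>y. (\<Sum>i\<in>UNIV. e $ i * ((y $ i)\<^sup>2 * gauss (mat 1) (P *v \<mu>) y)) \<partial>lborel)"
    unfolding ds matrix_mul_rid q by (simp only: s_def vec_lambda_beta prod.neutral_const mult_1_right sum_distrib_right mult.assoc)
  also have "(\<integral>y. (\<Sum>i\<in>UNIV. e $ i * ((y $ i)\<^sup>2 * gauss (mat 1) (P *v \<mu>) y)) \<partial>lborel) =
      (\<Sum>i\<in>UNIV. e $ i * (1 + ((P *v \<mu>) $ i)\<^sup>2)) * (\<integral>y. gauss (mat 1) (P *v \<mu>) y \<partial>lborel)"
    by (subst Bochner_Integration.integral_sum)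
      (auto simp: integrable_second_moment gauss_second_moment sum_distrib_left sum_distrib_right mult_ac)
  finally show ?thesis by (simp only: mult_ac)
qed

context
  assumes e: "0 < e $ k" "\<And>i. i \<noteq> k \<Longrightarrow> e $ i < 0"
begin

abbreviation (input) s where "s \<equiv> edge_scales k e"
abbreviation (input) G where "G \<equiv> scaled_form k e H"

lemma scaled_form_psd:
  "transpose G = G" "0 \<le> x \<bullet> (G *v x)"
proof -
  have "H $ i $ j = H $ j $ i" for i j
  proof -
    have "transpose H = H"
      using B_psd by (simp add: matrix_transpose_mul matrix_mul_assoc pos_semidef_def)
    then show ?thesis by (simp add: transpose_def vec_eq_iff)
  qed
  then show "transpose G = G"
    by (simp add: scaled_form_def transpose_def vec_eq_iff mult_ac)
  have "0 \<le> z \<bullet> (H *v z)" for z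
    using H_inner[of "transpose P *v z" "transpose P *v z"] B_psd
    unfolding orthogonal_matrix_mult_cancel(2)[OF P] by (simp add: pos_semidef_def)
  then show "0 \<le> x \<bullet> (G *v x)"
    unfolding scaled_form_inner using e by simp
qed

text \<open>
  A vanishing rate would force all entries of the rescaled form, and with them \<open>B\<close>, to vanish.
\<close>

lemma edge_rate_pos:
  assumes n: "2 \<le> CARD('n)"
  shows "0 < edge_rate k G"
proof (rule ccontr)
  assume "\<not> 0 < edge_rate k G"
  then have "G $ i $ j = 0" for i j
    using psd_entry_le_edge_rate[OF n scaled_form_psd, of i j k] by simp
  then have "H $ i $ j = 0" for i j
    using edge_scales_pos[of e k, OF e] e(1) by (simp add: scaled_form_def) (metis less_irrefl)
  then have H0: "H = 0" by (simp add: vec_eq_iff)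
  have "B = 0"
  proof -
    have "transpose P ** H ** P = (transpose P ** P) ** B ** (transpose P ** P)"
      by (simp only: matrix_mul_assoc)
    then show ?thesis using P unfolding H0 by (simp add: orthogonal_matrix_def)
  qed
  with B_nz show False ..
qed

text \<open>
  The coordinates are adapted to the fixed value \<open>r\<close>, while the level \<open>\<rho>\<close> varies: this exhibits the tail
  as the mass of a moving cone under a fixed Gaussian weight.
\<close>

lemma prob_R_gt_transformed:
  "measure M {\<omega> \<in> space M. R \<omega> > \<rho>} = (2 * pi) powr (- real CARD('n) / 2) * (\<Prod>i\<in>UNIV. s $ i) *
    (\<integral>y. indicator {y. 0 < y \<bullet> ((lorentz_mat k - (\<rho> - r) *\<^sub>R G) *v y)} y * gauss (diag_mat s) (P *v \<mu>) y \<partial>lborel)"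
proof -
  let ?T = "transpose P ** diag_mat s"
  have PT: "P *v (?T *v y) = diag_mat s *v y" for y
    unfolding matrix_vector_mul_assoc[symmetric] by (rule orthogonal_matrix_mult_cancel(2)[OF P])
  have "(?T *v y) \<bullet> ((A - \<rho> *\<^sub>R B) *v (?T *v y)) = e $ k * (y \<bullet> ((lorentz_mat k - (\<rho> - r) *\<^sub>R G) *v y))" for y
  proof -
    have "(?T *v y) \<bullet> ((A - \<rho> *\<^sub>R B) *v (?T *v y)) =
        (?T *v y) \<bullet> ((A - r *\<^sub>R B) *v (?T *v y)) - (\<rho> - r) * ((?T *v y) \<bullet> (B *v (?T *v y)))"
      by (simp add: matrix_vector_mult_diff_rdistrib inner_diff_right scaleR_matrix_vector_assoc[symmetric] algebra_simps)
    also have "(?T *v y) \<bullet> ((A - r *\<^sub>R B) *v (?T *v y)) = e $ k * (y \<bullet> (lorentz_mat k *v y))"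
      unfolding spectral_qform[OF diag] PT diag_mat_mult_vec by (rule scaled_diagonal_inner[OF e])
    also have "(?T *v y) \<bullet> (B *v (?T *v y)) = e $ k * (y \<bullet> (G *v y))"
      unfolding H_inner[symmetric] PT scaled_form_inner using e by simp
    finally show ?thesis
      by (simp add: matrix_vector_mult_diff_rdistrib inner_diff_right scaleR_matrix_vector_assoc[symmetric] algebra_simps)
  qed
  then have ind: "indicator {x. 0 < x \<bullet> ((A - \<rho> *\<^sub>R B) *v x)} (?T *v y) =
      (indicator {y. 0 < y \<bullet> ((lorentz_mat k - (\<rho> - r) *\<^sub>R G) *v y)} y :: real)" for y
    using e by (simp add: indicator_def zero_less_mult_iff)
  have "measure M {\<omega> \<in> space M. R \<omega> > \<rho>} = (2 * pi) powr (- real CARD('n) / 2) * (\<Prod>i\<in>UNIV. s $ i) *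
      (\<integral>y. indicator {x. 0 < x \<bullet> ((A - \<rho> *\<^sub>R B) *v x)} (?T *v y) * gauss (diag_mat s) (P *v \<mu>) y \<partial>lborel)"
    unfolding prob_R_gt_eq by (rule integral_mvn_density_transform[OF P edge_scales_pos[of e k, OF e]]) measurable
  then show ?thesis unfolding ind .
qed

lemma prob_R_gt_cone:
  "measure M {\<omega> \<in> space M. R \<omega> > r} = (2 * pi) powr (- real CARD('n) / 2) * (\<Prod>i\<in>UNIV. s $ i) *
    (\<integral>y. indicator (light_cone k) y * gauss (diag_mat s) (P *v \<mu>) y \<partial>lborel)"
  unfolding prob_R_gt_transformed[of r] by (simp add: light_cone_eq)

lemma cdf_R_has_derivative:
  "(cdf (distr M borel R) has_real_derivative
     - ((2 * pi) powr (- real CARD('n) / 2) * (\<Prod>i\<in>UNIV. s $ i) *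
       (trace ((1 / 2) *\<^sub>R (lorentz_mat k ** G)) * (\<integral>y. indicator (light_cone k) y * gauss (diag_mat s) (P *v \<mu>) y \<partial>lborel) -
        (\<integral>y. indicator (light_cone k) y * ((diag_mat s *v y - P *v \<mu>) \<bullet>
           (diag_mat s *v (((1 / 2) *\<^sub>R (lorentz_mat k ** G)) *v y))) * gauss (diag_mat s) (P *v \<mu>) y \<partial>lborel)))) (at r)"
    (is "(_ has_real_derivative - (?c * ?D)) (at r)")
proof -
  obtain c where c: "0 < c" "\<And>y. c * norm y \<le> norm (diag_mat s *v y)"
    by (rule diag_mat_coercive[of s]) (use edge_scales_pos[of e k, OF e] in auto)
  let ?F = "\<lambda>h. \<integral>y. indicator {y. 0 < y \<bullet> ((lorentz_mat k - h *\<^sub>R G) *v y)} y * gauss (diag_mat s) (P *v \<mu>) y \<partial>lborel"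
  have F: "(?F has_real_derivative ?D) (at (r - r))"
    using has_real_derivative_gauss_cone[OF c scaled_form_psd(1), of k "P *v \<mu>"] by simp
  have "((\<lambda>\<rho>. ?F (\<rho> - r)) has_real_derivative ?D * (1 - 0)) (at r)"
    by (rule DERIV_chain2[where f = ?F and g = "\<lambda>\<rho>. \<rho> - r", OF F]) (intro DERIV_diff DERIV_ident DERIV_const)
  then have "((\<lambda>\<rho>. 1 - ?c * ?F (\<rho> - r)) has_real_derivative 0 - ?c * (?D * (1 - 0))) (at r)"
    by (intro DERIV_diff DERIV_const DERIV_cmult)
  moreover have "(\<lambda>\<rho>. 1 - ?c * ?F (\<rho> - r)) = cdf (distr M borel R)"
    unfolding cdf_R prob_R_gt_transformed by (rule refl)
  ultimately show ?thesis by simp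
qed

end

end

end

section \<open>Eigenvalues and noncentrality at the edge\<close>

lemma eventually_at_edge_between:
  assumes "l < \<rho>"
  shows "\<forall>\<^sub>F r in at_edge \<rho>. l < ereal r \<and> ereal r < \<rho>"
proof (cases \<rho>)
  case (real b)
  show ?thesis
  proof (cases l)
    case (real a)
    then have "a < b" using assms \<open>\<rho> = ereal b\<close> by simp
    then show ?thesis
      using eventually_at_left_real[of a b] real \<open>\<rho> = ereal b\<close> by (auto simp: at_edge_def elim!: eventually_mono)
  next
    case MInf
    then show ?thesis
      using eventually_at_left_real[of "b - 1" b] \<open>\<rho> = ereal b\<close> by (auto simp: at_edge_def elim!: eventually_mono)
  qed (use assms in auto)
next
  case PInf
  then show ?thesis
    using assms eventually_gt_at_top by (cases l) (auto simp: at_edge_def intro: eventually_gt_at_top)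
qed (use assms in auto)

lemma at_edge_neq_bot: "at_edge \<rho> \<noteq> bot"
  by (simp add: at_edge_def)

text \<open>
  The vector along which the noncentrality \<open>\<nu>0\<close> is measured.  For a finite as for an infinite edge, its
  form values stay nonnegative up to the edge, which forces it to align with the top eigenvector.
\<close>

lemma edge_vector:
  fixes A B :: "real ^ 'n ^ 'n"
  assumes B: "pos_semidef B" and nc: "edge_noncentrality A B \<mu> \<rho> \<nu>0"
  obtains x0 where "norm x0 = 1" "\<nu>0 = x0 \<bullet> \<mu>" "\<And>r. ereal r < \<rho> \<Longrightarrow> 0 \<le> x0 \<bullet> ((A - r *\<^sub>R B) *v x0)"
    "\<rho> \<noteq> \<infinity> \<Longrightarrow> (A - real_of_ereal \<rho> *\<^sub>R B) *v x0 = 0"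
proof (cases "\<rho> = \<infinity>")
  case True
  then obtain p :: nat and b :: "nat \<Rightarrow> real ^ 'n" and w :: "nat \<Rightarrow> real" where
    b: "\<forall>j<p. \<forall>k<p. b j \<bullet> b k = (if j = k then 1 else 0)"
    and span: "span (b ` {..<p}) = {x. B *v x = 0}"
    and w: "(\<Sum>j<p. (w j)\<^sup>2) = 1" "\<forall>j<p. (\<Sum>k<p. (b j \<bullet> (A *v b k)) * w k) = 0"
    and \<nu>: "\<nu>0 = (\<Sum>j<p. w j * (b j \<bullet> \<mu>))"
    using nc by (auto simp: edge_noncentrality_def)
  define x0 where "x0 = (\<Sum>j<p. w j *\<^sub>R b j)"
  have "x0 \<bullet> x0 = (\<Sum>i<p. \<Sum>j<p. w i * w j * (b j \<bullet> b i))"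
    unfolding x0_def by (simp add: inner_sum_left inner_sum_right sum_distrib_left mult_ac)
  also have "\<dots> = (\<Sum>i<p. \<Sum>j<p. if j = i then (w i)\<^sup>2 else 0)"
    using b by (intro sum.cong refl) (auto simp: power2_eq_square)
  also have "\<dots> = 1" using w(1) by simp
  finally have "norm x0 = 1" by (simp add: norm_eq_sqrt_inner)
  moreover have "\<nu>0 = x0 \<bullet> \<mu>"
    unfolding x0_def \<nu> by (simp add: inner_sum_left)
  moreover have "0 \<le> x0 \<bullet> ((A - r *\<^sub>R B) *v x0)" for r
  proof -
    have "x0 \<in> span (b ` {..<p})"
      unfolding x0_def by (intro span_sum span_scale span_base) auto
    then have Bx: "B *v x0 = 0" unfolding span by simp
    have "A *v x0 = (\<Sum>k<p. w k *\<^sub>R (A *v b k))"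
      unfolding x0_def by (simp add: linear_sum[OF matrix_vector_mul_linear] matrix_vector_mult_scaleR)
    then have "b j \<bullet> (A *v x0) = 0" if "j < p" for j
      using w(2) that by (simp add: inner_sum_right mult.commute)
    then have "x0 \<bullet> (A *v x0) = 0"
      by (subst x0_def) (simp add: inner_sum_left)
    then show ?thesis
      by (simp add: matrix_vector_mult_diff_rdistrib scaleR_matrix_vector_assoc[symmetric] Bx)
  qed
  ultimately show ?thesis using that[of x0] True by blast
next
  case False
  then obtain x0 where x0: "norm x0 = 1" "(A - real_of_ereal \<rho> *\<^sub>R B) *v x0 = 0" "\<nu>0 = x0 \<bullet> \<mu>"
    using nc by (auto simp: edge_noncentrality_def)
  have "0 \<le> x0 \<bullet> ((A - r *\<^sub>R B) *v x0)" if r: "ereal r < \<rho>" for r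
  proof -
    have rr: "r \<le> real_of_ereal \<rho>" using r False by (cases \<rho>) auto
    have "x0 \<bullet> ((A - r *\<^sub>R B) *v x0) = x0 \<bullet> ((A - real_of_ereal \<rho> *\<^sub>R B) *v x0) + (real_of_ereal \<rho> - r) * (x0 \<bullet> (B *v x0))"
      by (simp add: matrix_vector_mult_diff_rdistrib scaleR_matrix_vector_assoc[symmetric] inner_diff_right algebra_simps)
    then show ?thesis unfolding x0(2) using rr B by (simp add: pos_semidef_def)
  qed
  then show ?thesis using that[of x0] x0 by blast
qed

locale edge_family =
  fixes A B :: "real ^ ('n :: {finite, linorder}) ^ 'n::_" and l \<rho> :: ereal and P :: "real \<Rightarrow> real ^ 'n::_ ^ 'n::_"
  assumes n2: "2 \<le> CARD('n)"
    and A_sym: "transpose A = A" and B_psd: "pos_semidef B"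
    and l_less: "l < \<rho>"
    and P: "\<And>r. l < ereal r \<Longrightarrow> ereal r < \<rho> \<Longrightarrow> orthogonal_matrix (P r) \<and>
              A - r *\<^sub>R B = transpose (P r) ** diag_mat (eigvals (A - r *\<^sub>R B)) ** P r"
    and top_pos: "\<And>r. l < ereal r \<Longrightarrow> ereal r < \<rho> \<Longrightarrow> 0 < eigvals (A - r *\<^sub>R B) $ Max UNIV"
    and in_CR: "class_CR A B \<rho>"
    and mult: "edge_mult A B \<rho> = 1"
begin

abbreviation (input) k :: 'n where "k \<equiv> Max UNIV"
abbreviation (input) e where "e r \<equiv> eigvals (A - r *\<^sub>R B)"

lemmas between = eventually_at_edge_between[OF l_less]

lemma top_lim: "((\<lambda>r. e r $ k) \<longlongrightarrow> 0) (at_edge \<rho>)"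
  using in_CR by (simp add: class_CR_def)

lemma mono_e: "l < ereal r \<Longrightarrow> ereal r < \<rho> \<Longrightarrow> mono (\<lambda>i. e r $ i)"
  using P[of r] by (blast intro: mono_eigvals)

lemma form_eq:
  "l < ereal r \<Longrightarrow> ereal r < \<rho> \<Longrightarrow> x \<bullet> ((A - r *\<^sub>R B) *v x) = (\<Sum>i\<in>UNIV. e r $ i * ((P r *v x) $ i)\<^sup>2)"
  using P[of r] by (intro spectral_qform) blast

lemma norm_P: "l < ereal r \<Longrightarrow> ereal r < \<rho> \<Longrightarrow> (\<Sum>i\<in>UNIV. ((P r *v x) $ i)\<^sup>2) = (norm x)\<^sup>2"
  using P[of r] orthogonal_matrix_inner[of "P r" x x]
  by (simp add: norm_vec_sum[symmetric] norm_eq_sqrt_inner)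

lemma form_shift:
  "x \<bullet> ((A - r' *\<^sub>R B) *v x) = x \<bullet> ((A - r *\<^sub>R B) *v x) - (r' - r) * (x \<bullet> (B *v x))"
  by (simp add: matrix_vector_mult_diff_rdistrib scaleR_matrix_vector_assoc[symmetric] inner_diff_right algebra_simps)

lemma rest_bounded_of_complement:
  assumes "\<forall>\<^sub>F r in at_edge \<rho>. \<forall>x. x \<bullet> z = 0 \<longrightarrow> x \<bullet> ((A - r *\<^sub>R B) *v x) \<le> - c * (norm x)\<^sup>2"
  shows "\<forall>\<^sub>F r in at_edge \<rho>. \<forall>i. i \<noteq> k \<longrightarrow> e r $ i \<le> - c"
  using assms between
proof eventually_elim
  case (elim r)
  show ?case
  proof (intro allI impI)
    fix i assume "i \<noteq> k"
    then show "e r $ i \<le> - c"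
      using P[of r] mono_e[of r] elim by (intro lower_eigenvalues_le[of "P r" "A - r *\<^sub>R B" "e r" z c i]) auto
  qed
qed

text \<open>
  As a limit of forms with largest eigenvalue tending to \<open>0\<close>, the form at the edge is negative semidefinite.
  Its simple null direction \<open>x0\<close> leaves a definite form on the complement, and definiteness persists, with
  half the constant, for \<open>r\<close> near the edge.
\<close>

lemma rest_bounded_finite:
  assumes fin: "\<rho> \<noteq> \<infinity>" and x0: "norm x0 = 1" "(A - real_of_ereal \<rho> *\<^sub>R B) *v x0 = 0"
  obtains c where "0 < c" "\<forall>\<^sub>F r in at_edge \<rho>. \<forall>i. i \<noteq> k \<longrightarrow> e r $ i \<le> - c"
proof -
  define b where "b = real_of_ereal \<rho>"
  let ?S = "A - b *\<^sub>R B"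
  have F: "at_edge \<rho> = at_left b" using fin by (simp add: at_edge_def b_def)
  have sym: "transpose ?S = ?S"
    using A_sym B_psd by (simp add: pos_semidef_def transpose_def vec_eq_iff)
  have neg: "x \<bullet> (?S *v x) \<le> 0" for x
  proof (rule tendsto_le[OF at_edge_neq_bot])
    show "((\<lambda>r. e r $ k * (norm x)\<^sup>2) \<longlongrightarrow> 0) (at_edge \<rho>)"
      using tendsto_mult_left_zero[OF top_lim] .
    have "((\<lambda>r. x \<bullet> (?S *v x) - (r - b) * (x \<bullet> (B *v x))) \<longlongrightarrow> x \<bullet> (?S *v x) - (b - b) * (x \<bullet> (B *v x))) (at_left b)"
      by (intro tendsto_intros)
    then show "((\<lambda>r. x \<bullet> ((A - r *\<^sub>R B) *v x)) \<longlongrightarrow> x \<bullet> (?S *v x)) (at_edge \<rho>)"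
      unfolding F form_shift[of x _ b, symmetric] .
    show "\<forall>\<^sub>F r in at_edge \<rho>. x \<bullet> ((A - r *\<^sub>R B) *v x) \<le> e r $ k * (norm x)\<^sup>2"
      using between
    proof eventually_elim
      case (elim r)
      have "(\<Sum>i\<in>UNIV. e r $ i * ((P r *v x) $ i)\<^sup>2) \<le> (\<Sum>i\<in>UNIV. e r $ k * ((P r *v x) $ i)\<^sup>2)"
        using mono_e[of r] elim by (intro sum_mono mult_right_mono) (auto simp: mono_def)
      then show ?case
        using elim by (simp add: form_eq norm_P sum_distrib_left[symmetric])
    qed
  qed
  have dim: "dim {x. ?S *v x = 0} = 1" using mult fin by (simp add: edge_mult_def b_def)
  obtain c where c: "0 < c" "\<And>x. x \<bullet> x0 = 0 \<Longrightarrow> x \<bullet> (?S *v x) \<le> - c * (norm x)\<^sup>2"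
    by (rule simple_null_neg_on_complement[OF sym neg dim x0[folded b_def]]) blast
  obtain K where K: "0 < K" "\<And>y. norm (B *v y) \<le> K * norm y" by (rule matrix_vector_mult_norm_le[of B]) blast
  have ev: "\<forall>\<^sub>F r in at_left b. r \<in> {b - c / (2 * K)<..<b}"
    by (rule eventually_at_left_real) (use K(1) c(1) in simp)
  have "\<forall>\<^sub>F r in at_edge \<rho>. \<forall>x. x \<bullet> x0 = 0 \<longrightarrow> x \<bullet> ((A - r *\<^sub>R B) *v x) \<le> - (c / 2) * (norm x)\<^sup>2"
    unfolding F using ev
  proof (eventually_elim, intro allI impI)
    fix r and x :: "real ^ 'n::_"
    assume r: "r \<in> {b - c / (2 * K)<..<b}" and x: "x \<bullet> x0 = 0"
    have xB: "x \<bullet> (B *v x) \<le> K * (norm x)\<^sup>2"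
    proof -
      have "x \<bullet> (B *v x) \<le> norm x * norm (B *v x)" by (rule norm_cauchy_schwarz)
      also have "\<dots> \<le> norm x * (K * norm x)" by (intro mult_left_mono K) auto
      finally show ?thesis by (simp add: power2_eq_square mult_ac)
    qed
    have "(b - r) * (x \<bullet> (B *v x)) \<le> (b - r) * (K * (norm x)\<^sup>2)"
      using r xB by (intro mult_left_mono) auto
    also have "\<dots> \<le> c / (2 * K) * (K * (norm x)\<^sup>2)"
      using r K by (intro mult_right_mono) auto
    also have "\<dots> = c / 2 * (norm x)\<^sup>2" using K by simp
    finally have "(b - r) * (x \<bullet> (B *v x)) \<le> c / 2 * (norm x)\<^sup>2" .
    moreover have "(b - r) * (x \<bullet> (B *v x)) = - ((r - b) * (x \<bullet> (B *v x)))"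
      by (simp add: left_diff_distrib)
    ultimately show "x \<bullet> ((A - r *\<^sub>R B) *v x) \<le> - (c / 2) * (norm x)\<^sup>2"
      using c(2)[OF x] form_shift[of x r b] by linarith
  qed
  from rest_bounded_of_complement[OF this] show ?thesis using that[of "c / 2"] c by simp
qed

text \<open>
  The second largest eigenvalue does not tend to \<open>0\<close>, so it leaves some interval \<open>(- c, c)\<close> for arbitrarily
  large \<open>r\<close>.  Once the largest one is below \<open>c\<close>, it can only do so at the lower end.  At one such \<open>r1\<close> the
  form is bounded by \<open>- c\<close> on the hyperplane orthogonal to the top eigenvector, and the forms decrease in
  \<open>r\<close>.
\<close>

lemma rest_bounded_infinite:
  assumes inf: "\<rho> = \<infinity>"
  obtains c where "0 < c" "\<forall>\<^sub>F r in at_edge \<rho>. \<forall>i. i \<noteq> k \<longrightarrow> e r $ i \<le> - c"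
proof -
  have F: "at_edge \<rho> = at_top" using inf by (simp add: at_edge_def)
  let ?Z = "{i. ((\<lambda>r. e r $ i) \<longlongrightarrow> 0) at_top}"
  have "card ?Z = 1" using mult inf by (simp add: edge_mult_def)
  moreover have "k \<in> ?Z" using top_lim by (simp add: F)
  ultimately have Z: "?Z = {k}" by (metis card_1_singletonE singletonD)
  note ne = UNIV_minus_nonempty[OF n2, of k]
  define j where "j = Max (UNIV - {k})"
  have j: "j \<noteq> k" using Max_in[OF _ ne] by (auto simp: j_def)
  have j_max: "i \<le> j" if "i \<noteq> k" for i using that by (simp add: j_def)
  from j Z have "\<not> ((\<lambda>r. e r $ j) \<longlongrightarrow> 0) (at_edge \<rho>)" unfolding F by blast
  then obtain c where c: "0 < c" and fr: "\<exists>\<^sub>F r in at_edge \<rho>. \<not> dist (e r $ j) 0 < c"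
    unfolding tendsto_iff frequently_def by auto
  have ev: "\<forall>\<^sub>F r in at_edge \<rho>. e r $ k < c \<and> l < ereal r \<and> ereal r < \<rho>"
    using order_tendstoD(2)[OF top_lim c] between by eventually_elim simp
  obtain r1 where r1: "\<not> dist (e r1 $ j) 0 < c" "e r1 $ k < c" "l < ereal r1" "ereal r1 < \<rho>"
    using frequently_ex[OF frequently_eventually_conj[OF fr ev]] by auto
  have "e r1 $ j \<le> e r1 $ k" using mono_e[OF r1(3,4)] by (simp add: mono_def)
  then have ej: "e r1 $ j \<le> - c" using r1(1,2) by (auto simp: dist_real_def abs_if split: if_splits)
  define z where "z = transpose (P r1) *v axis k 1"
  have "x \<bullet> ((A - r1 *\<^sub>R B) *v x) \<le> - c * (norm x)\<^sup>2" if x: "x \<bullet> z = 0" for x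
  proof -
    have "(P r1 *v x) $ k = x \<bullet> z"
      unfolding z_def inner_transpose_mult by (simp add: inner_axis)
    then have 0: "(P r1 *v x) $ k = 0" using x by simp
    have "e r1 $ i * ((P r1 *v x) $ i)\<^sup>2 \<le> - c * ((P r1 *v x) $ i)\<^sup>2" for i
    proof (cases "i = k")
      case False
      have "e r1 $ i \<le> - c" using mono_e[OF r1(3,4)] j_max[OF False] ej by (auto simp: mono_def dest: order_trans)
      then show ?thesis by (rule mult_right_mono) simp
    qed (simp add: 0)
    then have "x \<bullet> ((A - r1 *\<^sub>R B) *v x) \<le> (\<Sum>i\<in>UNIV. - c * ((P r1 *v x) $ i)\<^sup>2)"
      unfolding form_eq[OF r1(3,4)] by (rule sum_mono)
    then show ?thesis unfolding sum_distrib_left[symmetric] norm_P[OF r1(3,4)] .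
  qed
  moreover have "\<forall>\<^sub>F r in at_edge \<rho>. r1 \<le> r" unfolding F by (rule eventually_ge_at_top)
  ultimately have "\<forall>\<^sub>F r in at_edge \<rho>. \<forall>x. x \<bullet> z = 0 \<longrightarrow> x \<bullet> ((A - r *\<^sub>R B) *v x) \<le> - c * (norm x)\<^sup>2"
  proof (elim eventually_mono, intro allI impI)
    fix r and x :: "real ^ 'n::_"
    assume *: "\<And>x. x \<bullet> z = 0 \<Longrightarrow> x \<bullet> ((A - r1 *\<^sub>R B) *v x) \<le> - c * (norm x)\<^sup>2" and r: "r1 \<le> r" and x: "x \<bullet> z = 0"
    have "0 \<le> (r - r1) * (x \<bullet> (B *v x))" using r B_psd by (simp add: pos_semidef_def)
    then show "x \<bullet> ((A - r *\<^sub>R B) *v x) \<le> - c * (norm x)\<^sup>2"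
      using *[OF x] form_shift[of x r r1] by linarith
  qed
  from rest_bounded_of_complement[OF this] show ?thesis using that[of c] c by simp
qed

text \<open>
  The form at \<open>x0\<close> is nonnegative, so the squared length of the part of \<open>x0\<close> off the top eigenvector is at
  most \<open>\<lambda>\<^sub>n / c\<close>.  The top eigenvector therefore converges to \<open>x0\<close> up to sign.
\<close>

lemma top_noncentrality_tendsto:
  assumes x0: "norm x0 = 1" "\<nu>0 = x0 \<bullet> \<mu>" "\<And>r. ereal r < \<rho> \<Longrightarrow> 0 \<le> x0 \<bullet> ((A - r *\<^sub>R B) *v x0)"
    and c: "0 < c" "\<forall>\<^sub>F r in at_edge \<rho>. \<forall>i. i \<noteq> k \<longrightarrow> e r $ i \<le> - c"
  shows "((\<lambda>r. ((P r *v \<mu>) $ k)\<^sup>2) \<longlongrightarrow> \<nu>0\<^sup>2) (at_edge \<rho>)"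
proof -
  define a where "a r = (P r *v x0) $ k" for r
  define g where "g r = (\<Sum>i\<in>UNIV - {k}. ((P r *v x0) $ i)\<^sup>2)" for r
  have ag: "\<forall>\<^sub>F r in at_edge \<rho>. (a r)\<^sup>2 + g r = 1"
    using between
  proof eventually_elim
    case (elim r)
    then show ?case using norm_P[of r x0] x0(1) by (simp add: a_def g_def sum.remove[of UNIV k])
  qed
  have g0: "(g \<longlongrightarrow> 0) (at_edge \<rho>)"
  proof (rule Lim_null_comparison)
    show "\<forall>\<^sub>F r in at_edge \<rho>. norm (g r) \<le> e r $ k / c"
      using between c(2) ag
    proof eventually_elim
      case (elim r)
      have g: "0 \<le> g r" unfolding g_def by (rule sum_nonneg) simp
      have "0 \<le> e r $ k * (a r)\<^sup>2 + (\<Sum>i\<in>UNIV - {k}. e r $ i * ((P r *v x0) $ i)\<^sup>2)"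
        using x0(3)[of r] elim form_eq[of r x0] by (simp add: a_def sum.remove[of UNIV k])
      moreover have "(\<Sum>i\<in>UNIV - {k}. e r $ i * ((P r *v x0) $ i)\<^sup>2) \<le> (\<Sum>i\<in>UNIV - {k}. - c * ((P r *v x0) $ i)\<^sup>2)"
        using elim by (intro sum_mono mult_right_mono) auto
      moreover have "(\<Sum>i\<in>UNIV - {k}. - c * ((P r *v x0) $ i)\<^sup>2) = - c * g r"
        unfolding g_def by (rule sum_distrib_left[symmetric])
      moreover have "e r $ k * (a r)\<^sup>2 \<le> e r $ k * 1"
        using elim(3) g top_pos[of r] elim(1) by (intro mult_left_mono) auto
      ultimately have "c * g r \<le> e r $ k" by simp
      then show ?case using g c(1) by (simp add: pos_le_divide_eq mult.commute)
    qed
    show "((\<lambda>r. e r $ k / c) \<longlongrightarrow> 0) (at_edge \<rho>)" using tendsto_divide_zero[OF top_lim] .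
  qed
  have a1: "((\<lambda>r. (a r)\<^sup>2) \<longlongrightarrow> 1) (at_edge \<rho>)"
  proof -
    have "((\<lambda>r. 1 - g r) \<longlongrightarrow> 1 - 0) (at_edge \<rho>)" by (intro tendsto_intros g0)
    moreover have "\<forall>\<^sub>F r in at_edge \<rho>. 1 - g r = (a r)\<^sup>2" using ag by eventually_elim simp
    ultimately show ?thesis by (simp add: tendsto_cong)
  qed
  have av: "((\<lambda>r. a r * (P r *v \<mu>) $ k) \<longlongrightarrow> \<nu>0) (at_edge \<rho>)"
  proof -
    have "((\<lambda>r. \<nu>0 - a r * (P r *v \<mu>) $ k) \<longlongrightarrow> 0) (at_edge \<rho>)"
    proof (rule Lim_null_comparison)
      show "\<forall>\<^sub>F r in at_edge \<rho>. norm (\<nu>0 - a r * (P r *v \<mu>) $ k) \<le> sqrt (g r) * norm \<mu>"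
        using between
      proof eventually_elim
        case (elim r)
        define y where "y = P r *v x0 - a r *\<^sub>R axis k 1"
        have yk: "y $ k = 0" and yi: "y $ i = (P r *v x0) $ i" if "i \<noteq> k" for i
          using that by (auto simp: y_def a_def axis_def)
        have ny: "norm y = sqrt (g r)"
        proof -
          have yk: "y $ k = 0" by (simp add: y_def a_def axis_def)
          have "(norm y)\<^sup>2 = g r"
            by (simp add: norm_vec_sum sum.remove[of UNIV k] yk g_def) (rule sum.cong, auto simp: y_def axis_def)
          then show ?thesis by (metis norm_ge_zero real_sqrt_unique)
        qed
        have "\<nu>0 = (P r *v x0) \<bullet> (P r *v \<mu>)"
          using orthogonal_matrix_inner[of "P r" x0 \<mu>] P[of r] elim x0(2) by simp
        then have "\<nu>0 - a r * (P r *v \<mu>) $ k = y \<bullet> (P r *v \<mu>)"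
          by (simp add: y_def inner_diff_left inner_axis')
        then have "\<bar>\<nu>0 - a r * (P r *v \<mu>) $ k\<bar> \<le> norm y * norm (P r *v \<mu>)"
          by (simp add: Cauchy_Schwarz_ineq2)
        moreover have "norm (P r *v \<mu>) = norm \<mu>"
          using orthogonal_matrix_inner[of "P r" \<mu> \<mu>] P[of r] elim by (simp add: norm_eq_sqrt_inner)
        ultimately show ?case by (simp add: ny)
      qed
      have "((\<lambda>r. sqrt (g r) * norm \<mu>) \<longlongrightarrow> sqrt 0 * norm \<mu>) (at_edge \<rho>)" by (intro tendsto_intros g0)
      then show "((\<lambda>r. sqrt (g r) * norm \<mu>) \<longlongrightarrow> 0) (at_edge \<rho>)" by simp
    qed
    from tendsto_diff[OF tendsto_const[of \<nu>0] this] show ?thesis by simp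
  qed
  have "((\<lambda>r. (a r * (P r *v \<mu>) $ k)\<^sup>2 / (a r)\<^sup>2) \<longlongrightarrow> \<nu>0\<^sup>2 / 1) (at_edge \<rho>)"
    by (intro tendsto_intros av a1) auto
  moreover have "\<forall>\<^sub>F r in at_edge \<rho>. (a r * (P r *v \<mu>) $ k)\<^sup>2 / (a r)\<^sup>2 = ((P r *v \<mu>) $ k)\<^sup>2"
    using order_tendstoD(1)[OF a1, of 0] by (auto simp: power_mult_distrib elim!: eventually_mono)
  ultimately show ?thesis by (simp add: tendsto_cong)
qed

end

section \<open>The relative limits at the right edge\<close>

lemma coordinate_reflection_sym: "transpose (coordinate_reflection k) = coordinate_reflection k"
  by (auto simp: coordinate_reflection_def diag_mat_def transpose_def vec_eq_iff)

lemma coordinate_reflection_involution: "coordinate_reflection k ** coordinate_reflection k = mat 1"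
  by (simp add: matrix_eq matrix_vector_mul_assoc[symmetric] vec_eq_iff)

lemma coordinate_reflection_diag:
  "coordinate_reflection k ** diag_mat e ** coordinate_reflection k = diag_mat e"
  by (simp add: matrix_eq matrix_vector_mul_assoc[symmetric] vec_eq_iff)

lemma coordinate_reflection_conj_diag_entry:
  "(coordinate_reflection k ** H ** coordinate_reflection k) $ i $ i = H $ i $ i"
proof -
  have 1: "(coordinate_reflection k ** M) $ i $ j = (if i = k then - M $ i $ j else M $ i $ j)" for M and i j
    by (simp add: coordinate_reflection_def diag_mat_def matrix_matrix_mult_def if_distrib[of "\<lambda>u. u * _"] cong: if_cong)
  have 2: "(M ** coordinate_reflection k) $ i $ j = (if j = k then - M $ i $ j else M $ i $ j)" for M and i j
    by (simp add: coordinate_reflection_def diag_mat_def matrix_matrix_mult_def if_distrib[of "\<lambda>u. _ * u"] cong: if_cong)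
  show ?thesis by (simp add: 1 2)
qed

text \<open>
  Only the square of the top noncentrality converges, as \<open>P r\<close> may change the sign of the top eigenvector
  arbitrarily with \<open>r\<close>.  Reflecting the eigenvector makes this noncentrality nonnegative and changes neither
  the diagonal entries of the denominator nor any other noncentrality.
\<close>

lemma sign_adjusted_diagonalizer:
  fixes P :: "real ^ 'n ^ 'n"
  assumes P: "orthogonal_matrix P" "S = transpose P ** diag_mat e ** P"
  obtains Q where "orthogonal_matrix Q" "S = transpose Q ** diag_mat e ** Q"
    "(Q *v \<mu>) $ k = \<bar>(P *v \<mu>) $ k\<bar>" "\<And>i. i \<noteq> k \<Longrightarrow> (Q *v \<mu>) $ i = (P *v \<mu>) $ i"
    "\<And>B i. (Q ** B ** transpose Q) $ i $ i = (P ** B ** transpose P) $ i $ i"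
proof (cases "0 \<le> (P *v \<mu>) $ k")
  case True
  then show ?thesis using that[of P] P by simp
next
  case False
  let ?C = "coordinate_reflection k :: real ^ 'n ^ 'n"
  let ?Q = "?C ** P"
  note C = coordinate_reflection_sym[of k] coordinate_reflection_involution[of k] coordinate_reflection_diag[of k]
  have T: "transpose ?Q = transpose P ** ?C" by (simp add: matrix_transpose_mul C)
  have "transpose ?Q ** ?Q = transpose P ** (?C ** ?C) ** P" unfolding T by (simp only: matrix_mul_assoc)
  moreover have "?Q ** transpose ?Q = ?C ** (P ** transpose P) ** ?C" unfolding T by (simp only: matrix_mul_assoc)
  ultimately have 1: "orthogonal_matrix ?Q" using P(1) by (simp add: orthogonal_matrix_def C)
  have "transpose ?Q ** diag_mat e ** ?Q = transpose P ** (?C ** diag_mat e ** ?C) ** P"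
    unfolding T by (simp only: matrix_mul_assoc)
  then have 2: "S = transpose ?Q ** diag_mat e ** ?Q" unfolding C(3) using P(2) by simp
  have v: "?Q *v \<mu> = ?C *v (P *v \<mu>)" by (simp add: matrix_vector_mul_assoc)
  have "?Q ** B ** transpose ?Q = ?C ** (P ** B ** transpose P) ** ?C" for B
    unfolding T by (simp only: matrix_mul_assoc)
  then show ?thesis
    using that[OF 1 2] False unfolding v by (simp add: coordinate_reflection_conj_diag_entry)
qed

theorem theorem9:
  fixes A B :: "real ^ ('n :: {finite, linorder}) ^ 'n::_"
    and \<mu> :: "real ^ 'n::_"
    and M :: "'w measure"
    and \<epsilon> :: "'w \<Rightarrow> real ^ 'n::_"
    and R :: "'w \<Rightarrow> real"
    and l r\<^sub>s :: ereal
    and P :: "real \<Rightarrow> real ^ 'n::_ ^ 'n::_"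
    and \<nu>0 :: real
  assumes n: "CARD('n) \<ge> 2"
    and A: "transpose A = A" "rank A \<ge> 1"
    and B: "pos_semidef B" "B \<noteq> 0"
    and M: "prob_space M"
    and eps: "distributed M lborel \<epsilon> (\<lambda>x. ennreal (mvn_density \<mu> x))"
    and R: "R = (\<lambda>\<omega>. qform A (\<epsilon> \<omega>) / qform B (\<epsilon> \<omega>))"
    and nondegenerate: "\<not> (\<exists>c. AE \<omega> in M. R \<omega> = c)"
    and l: "l = left_end M R"
    and r\<^sub>s: "r\<^sub>s = right_end M R"
    and in_CR: "class_CR A B r\<^sub>s"
    and mult: "edge_mult A B r\<^sub>s = 1"
    and \<nu>0: "edge_noncentrality A B \<mu> r\<^sub>s \<nu>0"
    and P: "\<And>r. l < ereal r \<Longrightarrow> ereal r < r\<^sub>s \<Longrightarrow>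
              orthogonal_matrix (P r) \<and>
              A - r *\<^sub>R B = transpose (P r) ** diag_mat (eigvals (A - r *\<^sub>R B)) ** P r"
  shows "((\<lambda>r. measure M {\<omega> \<in> space M. R \<omega> > r} /
               (1 - lr_cdf (eigvals (A - r *\<^sub>R B)) (P r *v \<mu>)
                      (\<integral>\<omega>. qform (A - r *\<^sub>R B) (\<epsilon> \<omega>) \<partial>M)))
           \<longlongrightarrow> edge_limit CARD('n) \<nu>0) (at_edge r\<^sub>s) \<and>
         (\<forall>f. is_density M R f \<longrightarrow>
           ((\<lambda>r. f r / sp_density (eigvals (A - r *\<^sub>R B)) (P r *v \<mu>)
                          (P r ** B ** transpose (P r)))
             \<longlongrightarrow> edge_limit CARD('n) \<nu>0) (at_edge r\<^sub>s))"
proof -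
  define k where "k = (Max UNIV :: 'n)"
  define e where "e r = eigvals (A - r *\<^sub>R B)" for r
  define v where "v r = P r *v \<mu>" for r
  define H where "H r = P r ** B ** transpose (P r)" for r
  define G where "G r = scaled_form k (e r) (H r)" for r
  define m where "m r = (\<integral>\<omega>. qform (A - r *\<^sub>R B) (\<epsilon> \<omega>) \<partial>M)" for r
  interpret prob_space M by (rule M)
  interpret GR: gauss_ratio M A B \<mu> \<epsilon> R
    by unfold_locales (use A B eps R in auto)
  have lr: "l < r\<^sub>s" unfolding l r\<^sub>s by (rule GR.left_end_less_right_end[OF nondegenerate])
  have mono: "mono (\<lambda>i. e r $ i)" if "l < ereal r" "ereal r < r\<^sub>s" for r
    using P[OF that] unfolding e_def by (blast intro: mono_eigvals)
  have top_pos: "0 < e r $ k" if r: "l < ereal r" "ereal r < r\<^sub>s" for r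
  proof (rule ccontr)
    assume "\<not> 0 < e r $ k"
    moreover have "e r $ i \<le> e r $ k" for i using mono[OF r] by (simp add: mono_def k_def)
    ultimately have "e r $ i \<le> 0" for i by (meson not_less order_trans)
    then have "x \<bullet> ((A - r *\<^sub>R B) *v x) \<le> 0" for x
      using P[OF r] spectral_qform[of "A - r *\<^sub>R B" "P r" "e r" x] unfolding e_def
      by (auto intro!: sum_nonpos mult_nonpos_nonneg)
    then have "{x. 0 < x \<bullet> ((A - r *\<^sub>R B) *v x)} = {}" by (auto simp: not_less)
    then have "measure M {\<omega> \<in> space M. R \<omega> > r} = 0" unfolding GR.prob_R_gt_eq by simp
    then show False using GR.prob_R_gt_pos[of r] r by (simp add: r\<^sub>s)
  qed
  interpret EF: edge_family A B l r\<^sub>s P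
    by unfold_locales (use n A B lr P top_pos in_CR mult in \<open>auto simp: e_def k_def\<close>)
  obtain x0 where x0: "norm x0 = 1" "\<nu>0 = x0 \<bullet> \<mu>" "\<And>r. ereal r < r\<^sub>s \<Longrightarrow> 0 \<le> x0 \<bullet> ((A - r *\<^sub>R B) *v x0)"
    "r\<^sub>s \<noteq> \<infinity> \<Longrightarrow> (A - real_of_ereal r\<^sub>s *\<^sub>R B) *v x0 = 0"
    by (rule edge_vector[OF B(1) \<nu>0]) blast
  obtain c where c: "0 < c" "\<forall>\<^sub>F r in at_edge r\<^sub>s. \<forall>i. i \<noteq> k \<longrightarrow> e r $ i \<le> - c"
  proof (cases "r\<^sub>s = \<infinity>")
    case True
    from EF.rest_bounded_infinite[OF this] show ?thesis using that unfolding e_def k_def by blast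
  next
    case False
    from EF.rest_bounded_finite[OF False x0(1) x0(4)[OF False]] show ?thesis using that unfolding e_def k_def by blast
  qed
  have v_norm: "norm (v r) = norm \<mu>" if "l < ereal r" "ereal r < r\<^sub>s" for r
    using orthogonal_matrix_inner[of "P r" \<mu> \<mu>] P[OF that] by (simp add: v_def norm_eq_sqrt_inner)
  have v_top: "((\<lambda>r. (v r $ k)\<^sup>2) \<longlongrightarrow> \<nu>0\<^sup>2) (at_edge r\<^sub>s)"
    unfolding v_def k_def
    by (rule EF.top_noncentrality_tendsto[OF x0(1-3) c(1)]) (use c(2) in \<open>simp_all add: e_def k_def\<close>)
  interpret ES: edge_spectrum r\<^sub>s e v "norm \<mu>" c \<nu>0
  proof
    show "\<forall>\<^sub>F r in at_edge r\<^sub>s. mono (\<lambda>i. e r $ i)"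
      using EF.between by eventually_elim (auto intro: mono)
    show "\<forall>\<^sub>F r in at_edge r\<^sub>s. 0 < e r $ Max UNIV"
      using EF.between by eventually_elim (use top_pos in \<open>auto simp: k_def\<close>)
    show "((\<lambda>r. e r $ Max UNIV) \<longlongrightarrow> 0) (at_edge r\<^sub>s)"
      using EF.top_lim by (simp add: e_def)
    show "\<forall>\<^sub>F r in at_edge r\<^sub>s. norm (v r) \<le> norm \<mu>"
      using EF.between by eventually_elim (simp add: v_norm)
  qed (use n c v_top in \<open>auto simp: k_def\<close>)
  define good where "good r \<longleftrightarrow> l < ereal r \<and> ereal r < r\<^sub>s \<and> (\<forall>i. i \<noteq> k \<longrightarrow> e r $ i \<le> - c)" for r
  have good: "\<forall>\<^sub>F r in at_edge r\<^sub>s. good r"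
    using EF.between c(2) by eventually_elim (simp add: good_def)
  have good_e: "0 < e r $ k" "\<And>i. i \<noteq> k \<Longrightarrow> e r $ i < 0" if "good r" for r
    using that top_pos c(1) by (force simp: good_def)+
  have good_P: "orthogonal_matrix (P r)" "A - r *\<^sub>R B = transpose (P r) ** diag_mat (e r) ** P r" if "good r" for r
    using P[of r] that by (auto simp: good_def e_def)
  \<comment> \<open>the integrals over the cone are evaluated with the diagonalizer \<open>Q\<close>, the approximations with \<open>P\<close>\<close>
  have "\<exists>Q. \<forall>r. good r \<longrightarrow> orthogonal_matrix (Q r) \<and> A - r *\<^sub>R B = transpose (Q r) ** diag_mat (e r) ** Q r \<and>
    (Q r *v \<mu>) $ k = \<bar>v r $ k\<bar> \<and> (\<forall>i. i \<noteq> k \<longrightarrow> (Q r *v \<mu>) $ i = v r $ i) \<and>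
    (\<forall>i. (Q r ** B ** transpose (Q r)) $ i $ i = H r $ i $ i)"
    unfolding v_def H_def
  proof (intro choice allI)
    fix r
    show "\<exists>Q. good r \<longrightarrow> orthogonal_matrix Q \<and> A - r *\<^sub>R B = transpose Q ** diag_mat (e r) ** Q \<and>
      (Q *v \<mu>) $ k = \<bar>(P r *v \<mu>) $ k\<bar> \<and> (\<forall>i. i \<noteq> k \<longrightarrow> (Q *v \<mu>) $ i = (P r *v \<mu>) $ i) \<and>
      (\<forall>i. (Q ** B ** transpose Q) $ i $ i = (P r ** B ** transpose (P r)) $ i $ i)"
    proof (cases "good r")
      case True
      show ?thesis
        by (rule sign_adjusted_diagonalizer[OF good_P[OF True], of \<mu> k]) blast
    qed simp
  qed
  then obtain Q where Q: "\<And>r. good r \<Longrightarrow> orthogonal_matrix (Q r)"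
    "\<And>r. good r \<Longrightarrow> A - r *\<^sub>R B = transpose (Q r) ** diag_mat (e r) ** Q r"
    "\<And>r. good r \<Longrightarrow> (Q r *v \<mu>) $ k = \<bar>v r $ k\<bar>"
    "\<And>r i. good r \<Longrightarrow> i \<noteq> k \<Longrightarrow> (Q r *v \<mu>) $ i = v r $ i"
    "\<And>r i. good r \<Longrightarrow> (Q r ** B ** transpose (Q r)) $ i $ i = H r $ i $ i"
    by blast
  define s where "s r = edge_scales k (e r)" for r
  define \<nu> where "\<nu> r = Q r *v \<mu>" for r
  interpret CL: cone_limit k r\<^sub>s s \<nu> "norm \<mu>" "\<bar>\<nu>0\<bar>"
  proof
    show "((\<lambda>r. s r $ i) \<longlongrightarrow> 0) (at_edge r\<^sub>s)" if "i \<noteq> k" for i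
      using ES.scales_rest[of i] that unfolding s_def k_def by blast
    show "\<forall>\<^sub>F r in at_edge r\<^sub>s. s r $ k = 1" by (simp add: s_def edge_scales_def)
    show "\<forall>\<^sub>F r in at_edge r\<^sub>s. \<forall>i. 0 < s r $ i" using ES.scales_pos by (simp add: s_def k_def)
    show "\<forall>\<^sub>F r in at_edge r\<^sub>s. norm (\<nu> r) \<le> norm \<mu>"
      using good by eventually_elim
        (use Q(1) orthogonal_matrix_inner[of _ \<mu> \<mu>] in \<open>simp add: \<nu>_def norm_eq_sqrt_inner\<close>)
    have "((\<lambda>r. sqrt ((v r $ k)\<^sup>2)) \<longlongrightarrow> sqrt (\<nu>0\<^sup>2)) (at_edge r\<^sub>s)"
      by (intro tendsto_real_sqrt v_top)
    moreover have "\<forall>\<^sub>F r in at_edge r\<^sub>s. sqrt ((v r $ k)\<^sup>2) = \<nu> r $ k"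
      using good by eventually_elim (simp add: Q(3) \<nu>_def)
    ultimately show "((\<lambda>r. \<nu> r $ k) \<longlongrightarrow> \<bar>\<nu>0\<bar>) (at_edge r\<^sub>s)" by (simp add: tendsto_cong)
  qed
  let ?c = "(2 * pi) powr (- real CARD('n) / 2)"
  let ?L = "mgf_const CARD('n) \<nu>0 / (sqrt (2 * pi) * edge_u CARD('n) \<nu>0)"
  have L0: "?L \<noteq> 0" using ES.mgf_const_pos ES.edge_u_pos by simp
  have scale: "(\<Prod>i\<in>UNIV. s r $ i) = ES.edge_scale r * CL.normalizer r" if "good r" for r
  proof -
    have "(\<Sum>i\<in>UNIV - {k}. (\<nu> r $ i)\<^sup>2) = (\<Sum>i\<in>UNIV - {k}. (v r $ i)\<^sup>2)"
      using that by (intro sum.cong) (auto simp: \<nu>_def Q(4))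
    then show ?thesis
      unfolding ES.edge_scale_def CL.normalizer_def s_def k_def[symmetric] by (simp add: mult.assoc exp_add[symmetric])
  qed
  have lim: "?c * cone_gauss_mass k \<bar>\<nu>0\<bar> / ?L = edge_limit CARD('n) \<nu>0"
    by (rule edge_limit_eq[OF n])
  \<comment> \<open>near the edge the mean is negative: the positive eigenvalue vanishes and some other one stays below \<open>- c\<close>\<close>
  have mean: "\<forall>\<^sub>F r in at_edge r\<^sub>s. m r \<noteq> 0"
  proof -
    have "((\<lambda>r. e r $ k * (1 + (norm \<mu>)\<^sup>2)) \<longlongrightarrow> 0) (at_edge r\<^sub>s)"
      using tendsto_mult_left_zero[OF ES.top_lim] by (simp add: k_def)
    from order_tendstoD(2)[OF this c(1)] good show ?thesis
    proof eventually_elim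
      case (elim r)
      have vk: "(v r $ k)\<^sup>2 \<le> (norm \<mu>)\<^sup>2"
      proof -
        have "\<bar>v r $ k\<bar> \<le> norm \<mu>" using component_le_norm_cart[of "v r" k] v_norm[of r] elim by (simp add: good_def)
        then show ?thesis by (metis abs_ge_zero power2_abs power_mono)
      qed
      obtain j where j: "j \<in> UNIV - {k}" using UNIV_minus_nonempty[OF n, of k] by blast
      have le: "e r $ i * (1 + (v r $ i)\<^sup>2) \<le> - c" if "i \<noteq> k" for i
      proof -
        have "e r $ i * (1 + (v r $ i)\<^sup>2) \<le> - c * (1 + (v r $ i)\<^sup>2)"
          using elim(2) that by (intro mult_right_mono) (auto simp: good_def)
        also have "\<dots> \<le> - c" using c(1) by (simp add: algebra_simps)
        finally show ?thesis .
      qed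
      have "(\<Sum>i\<in>UNIV - {k}. e r $ i * (1 + (v r $ i)\<^sup>2)) \<le> (\<Sum>i\<in>{j}. e r $ i * (1 + (v r $ i)\<^sup>2))"
      proof -
        have "(\<Sum>i\<in>UNIV - {k} - {j}. e r $ i * (1 + (v r $ i)\<^sup>2)) \<le> 0"
          using le c(1) by (intro sum_nonpos) force
        then show ?thesis using j by (simp add: sum.remove[of "UNIV - {k}" j])
      qed
      also have "\<dots> \<le> - c" using le j by simp
      finally have 1: "(\<Sum>i\<in>UNIV - {k}. e r $ i * (1 + (v r $ i)\<^sup>2)) \<le> - c" .
      have 2: "e r $ k * (1 + (v r $ k)\<^sup>2) \<le> e r $ k * (1 + (norm \<mu>)\<^sup>2)"
        using good_e(1)[OF elim(2)] vk by (intro mult_left_mono) auto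
      have "(\<Sum>i\<in>UNIV. e r $ i * (1 + (v r $ i)\<^sup>2)) < 0"
        using 1 2 elim(1) by (simp add: sum.remove[of UNIV k])
      then show ?case
        unfolding m_def GR.mean_eq[OF good_P[OF elim(2)]]
        using gauss_integral_pos[of "v r"] by (simp add: v_def)
    qed
  qed
  have tail: "((\<lambda>r. measure M {\<omega> \<in> space M. R \<omega> > r} / ES.edge_scale r) \<longlongrightarrow> ?c * cone_gauss_mass k \<bar>\<nu>0\<bar>) (at_edge r\<^sub>s)"
  proof -
    have "((\<lambda>r. ?c * (CL.normalizer r * (\<integral>y. indicator (light_cone k) y * gauss (diag_mat (s r)) (\<nu> r) y \<partial>lborel))) \<longlongrightarrow>
        ?c * cone_gauss_mass k \<bar>\<nu>0\<bar>) (at_edge r\<^sub>s)"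
      by (intro tendsto_mult tendsto_const CL.cone_mass_tendsto)
    moreover have "\<forall>\<^sub>F r in at_edge r\<^sub>s. ?c * (CL.normalizer r * (\<integral>y. indicator (light_cone k) y * gauss (diag_mat (s r)) (\<nu> r) y \<partial>lborel)) =
        measure M {\<omega> \<in> space M. R \<omega> > r} / ES.edge_scale r"
      using good ES.edge_scale_pos
    proof eventually_elim
      case (elim r)
      then show ?case
        using GR.prob_R_gt_cone[OF Q(1,2)[OF elim(1)] good_e[OF elim(1)]] scale[OF elim(1)]
        by (simp add: s_def \<nu>_def)
    qed
    ultimately show ?thesis by (rule Lim_transform_eventually)
  qed
  have part1: "((\<lambda>r. measure M {\<omega> \<in> space M. R \<omega> > r} / (1 - lr_cdf (e r) (v r) (m r))) \<longlongrightarrow> edge_limit CARD('n) \<nu>0) (at_edge r\<^sub>s)"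
  proof -
    have "((\<lambda>r. (measure M {\<omega> \<in> space M. R \<omega> > r} / ES.edge_scale r) / ((1 - lr_cdf (e r) (v r) (m r)) / ES.edge_scale r)) \<longlongrightarrow>
        edge_limit CARD('n) \<nu>0) (at_edge r\<^sub>s)"
      unfolding lim[symmetric] by (intro tendsto_divide tail ES.lugannani_rice_tail_tendsto[OF mean] L0)
    moreover have "\<forall>\<^sub>F r in at_edge r\<^sub>s. (measure M {\<omega> \<in> space M. R \<omega> > r} / ES.edge_scale r) / ((1 - lr_cdf (e r) (v r) (m r)) / ES.edge_scale r) =
        measure M {\<omega> \<in> space M. R \<omega> > r} / (1 - lr_cdf (e r) (v r) (m r))"
      using ES.edge_scale_pos by eventually_elim simp
    ultimately show ?thesis by (rule Lim_transform_eventually)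
  qed
  have part2: "((\<lambda>r. f r / sp_density (e r) (v r) (H r)) \<longlongrightarrow> edge_limit CARD('n) \<nu>0) (at_edge r\<^sub>s)"
    if f: "is_density M R f" for f
  proof -
    define G' where "G' r = scaled_form k (e r) (Q r ** B ** transpose (Q r))" for r
    \<comment> \<open>the rate depends on diagonal entries only, which are the same for \<open>Q\<close> and \<open>P\<close>\<close>
    have rate_eq: "edge_rate k (G' r) = edge_rate k (G r)" if "good r" for r
      using Q(5)[OF that] by (simp add: edge_rate_def G'_def G_def scaled_form_def)
    have G': "\<forall>\<^sub>F r in at_edge r\<^sub>s. transpose (G' r) = G' r \<and> (\<forall>x. 0 \<le> x \<bullet> (G' r *v x)) \<and> 0 < edge_rate k (G' r)"
      using good
    proof eventually_elim
      case (elim r)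
      note * = Q(1,2)[OF elim] good_e[OF elim]
      show ?case unfolding G'_def
        using GR.scaled_form_psd[OF *] GR.edge_rate_pos[OF * n] by blast
    qed
    have G: "\<forall>\<^sub>F r in at_edge r\<^sub>s. (\<forall>i j. G r $ i $ j = H r $ i $ j * ES.scales r $ i * ES.scales r $ j / e r $ Max UNIV) \<and>
        transpose (G r) = G r \<and> (\<forall>x. 0 \<le> x \<bullet> (G r *v x)) \<and> 0 < edge_rate (Max UNIV) (G r)"
      using good
    proof eventually_elim
      case (elim r)
      note * = good_P[OF elim] good_e[OF elim]
      have "G r $ i $ j = H r $ i $ j * ES.scales r $ i * ES.scales r $ j / e r $ Max UNIV" for i j
        by (simp add: G_def scaled_form_def k_def)
      moreover have "transpose (G r) = G r" "\<And>x. 0 \<le> x \<bullet> (G r *v x)" "0 < edge_rate k (G r)"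
        unfolding G_def H_def using GR.scaled_form_psd[OF *] GR.edge_rate_pos[OF * n] by blast+
      ultimately show ?case unfolding k_def by blast
    qed
    have dens: "((\<lambda>r. f r / (edge_rate k (G r) * ES.edge_scale r)) \<longlongrightarrow> ?c * cone_gauss_mass k \<bar>\<nu>0\<bar>) (at_edge r\<^sub>s)"
    proof -
      let ?D = "\<lambda>r. trace ((1 / 2) *\<^sub>R (lorentz_mat k ** G' r)) * (\<integral>y. indicator (light_cone k) y * gauss (diag_mat (s r)) (\<nu> r) y \<partial>lborel) -
         (\<integral>y. indicator (light_cone k) y * ((diag_mat (s r) *v y - \<nu> r) \<bullet>
           (diag_mat (s r) *v (((1 / 2) *\<^sub>R (lorentz_mat k ** G' r)) *v y))) * gauss (diag_mat (s r)) (\<nu> r) y \<partial>lborel)"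
      have "((\<lambda>r. - ?c * (CL.normalizer r * ?D r / edge_rate k (G' r))) \<longlongrightarrow> - ?c * - cone_gauss_mass k \<bar>\<nu>0\<bar>) (at_edge r\<^sub>s)"
        by (intro tendsto_mult tendsto_const CL.cone_derivative_tendsto[OF n G'])
      moreover have "\<forall>\<^sub>F r in at_edge r\<^sub>s. - ?c * (CL.normalizer r * ?D r / edge_rate k (G' r)) = f r / (edge_rate k (G r) * ES.edge_scale r)"
        using good ES.edge_scale_pos
      proof eventually_elim
        case (elim r)
        have "(cdf (distr M borel R) has_real_derivative - (?c * (\<Prod>i\<in>UNIV. s r $ i) * ?D r)) (at r)"
          using GR.cdf_R_has_derivative[OF Q(1,2)[OF elim(1)] good_e[OF elim(1)]] unfolding s_def \<nu>_def G'_def .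
        then have "f r = - (?c * (\<Prod>i\<in>UNIV. s r $ i) * ?D r)"
          using f unfolding is_density_def by blast
        then have fr: "f r = - ?c * (CL.normalizer r * ?D r) * ES.edge_scale r"
          unfolding scale[OF elim(1)] by (simp only: mult_ac mult_minus_left mult_minus_right)
        have "x * (y / w) = x * y * z / (w * z)" if "z \<noteq> 0" for x y z w :: real using that by simp
        note cancel = this
        show ?case unfolding fr rate_eq[OF elim(1)] by (rule cancel) (use elim(2) in linarith)
      qed
      ultimately show ?thesis unfolding minus_mult_minus by (rule Lim_transform_eventually)
    qed
    have "((\<lambda>r. (f r / (edge_rate k (G r) * ES.edge_scale r)) / (sp_density (e r) (v r) (H r) / (edge_rate k (G r) * ES.edge_scale r))) \<longlongrightarrow>
        edge_limit CARD('n) \<nu>0) (at_edge r\<^sub>s)"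
      unfolding lim[symmetric] 
      by (rule tendsto_divide[OF dens ES.sp_density_tendsto[OF G, folded k_def] L0])
    moreover have "\<forall>\<^sub>F r in at_edge r\<^sub>s. (f r / (edge_rate k (G r) * ES.edge_scale r)) / (sp_density (e r) (v r) (H r) / (edge_rate k (G r) * ES.edge_scale r)) =
        f r / sp_density (e r) (v r) (H r)"
      using G ES.edge_scale_pos by eventually_elim (simp add: k_def)
    ultimately show ?thesis by (rule Lim_transform_eventually)
  qed
  show ?thesis using part1 part2 unfolding e_def v_def m_def H_def by blast
qed

end
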